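(* Let $\mathcal{A}$ be a unital $C^*$-algebra and let $F\in B^a(H_{\mathcal{A}})$. Then the following inclusions hold, where $\partial$ denotes the boundary in the $C^*$-algebra $Z(\mathcal{A})$: $$\partial\sigma_{ew}^{\mathcal{A}}(F)\subseteq\partial\sigma_{ef}^{\mathcal{A}}(F),$$ $$\partial\sigma_{ef}^{\mathcal{A}}(F)\subseteq\partial\sigma_{e\beta}^{\mathcal{A}}(F)\subseteq\partial\sigma_{ek}^{\mathcal{A}}(F),\qquad \partial\sigma_{ef}^{\mathcal{A}}(F)\subseteq\partial\sigma_{e\alpha}^{\mathcal{A}}(F)\subseteq\partial\sigma_{ek}^{\mathcal{A}}(F).$$
   Context: $\mathcal{A}$ is a unital $C^*$-algebra with center $Z(\mathcal{A})$ (with the norm topology); $H_{\mathcal{A}}$ is the standard countably generated (right) Hilbert $\mathcal{A}$-module. $B^a(H_{\mathcal{A}})$ is the set of bounded adjointable operators on $H_{\mathcal{A}}$. For $\alpha\in Z(\mathcal{A})$, $\alpha I$ is the operator $x\mapsto x\alpha$ on $H_{\mathcal{A}}$. $\tilde\oplus$ denotes the internal direct sum of closed submodules, not necessarily orthogonal. A Hilbert module is finitely generated if it equals the $\mathcal{A}$-linear span of a finite subset. "Isomorphism" between closed submodules means a bounded bijective $\mathcal{A}$-linear map (with bounded inverse). For $F\in B^a(H_{\mathcal{A}})$ consider decompositions $H_{\mathcal{A}}=M_1\tilde\oplus N_1\stackrel{F}{\longrightarrow}M_2\tilde\oplus N_2=H_{\mathcal{A}}$ (all four submodules closed) with respect to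 which $F$ has matrix $\begin{bmatrix}F_1&0\\0&F_4\end{bmatrix}$ (i.e. $F(M_1)\subseteq M_2$, $F(N_1)\subseteq N_2$, $F_1=F_{|M_1}:M_1\to M_2$, $F_4=F_{|N_1}:N_1\to N_2$) and $F_1$ is an isomorphism. Then: - $\mathcal{M}\Phi_+(H_{\mathcal{A}})$ (upper semi-$\mathcal{A}$-Fredholm): those $F$ having such a decomposition with $N_1$ finitely generated; - $\mathcal{M}\Phi_-(H_{\mathcal{A}})$ (lower semi-$\mathcal{A}$-Fredholm): those $F$ having such a decomposition with $N_2$ finitely generated; - $\mathcal{M}\Phi(H_{\mathcal{A}})$ ($\mathcal{A}$-Fredholm): those $F$ having such a decomposition with both $N_1$ and $N_2$ finitely generated (an $\mathcal{M}\Phi$-decomposition). For such $F$, $\mathrm{index}\,F=[N_1]-[N_2]\in K(\mathcal{A})$, the $K_0$-group of $\mathcal{A}$, where $[N_i]$ is the class of $N_i$; it is known that this does not depend on the choice of $\mathcal{M}\Phi$-decomposition; - $\mathcal{M}\Phi_0(H_{\mathcal{A}})=\{F\in\mathcal{M}\Phi(H_{\mathcal{A}})\mid \mathrm{index}\,F=0\}$. The spectra are the following subsets of $Z(\mathcal{A})$: - $\sigma_{ew}^{\mathcal{A}}(F)=\{\alpha\in Z(\mathcal{A})\mid F-\alpha I\notin\mathcal{M}\Phi_0(H_{\mathcal{A}})\}$, - $\sigma_{ef}^{\mathcal{A}}(F)=\{\alpha\in Z(\mathcal{A})\mid F-\alpha I\notin\mathcal{M}\Phi(H_{\mathcal{A}})\}$,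 - $\sigma_{e\alpha}^{\mathcal{A}}(F)=\{\alpha\in Z(\mathcal{A})\mid F-\alpha I\notin\mathcal{M}\Phi_+(H_{\mathcal{A}})\}$, - $\sigma_{e\beta}^{\mathcal{A}}(F)=\{\alpha\in Z(\mathcal{A})\mid F-\alpha I\notin\mathcal{M}\Phi_-(H_{\mathcal{A}})\}$, - $\sigma_{ek}^{\mathcal{A}}(F)=\{\alpha\in Z(\mathcal{A})\mid F-\alpha I\notin\mathcal{M}\Phi_+(H_{\mathcal{A}})\cup\mathcal{M}\Phi_-(H_{\mathcal{A}})\}$. *)

theory Defs
  imports
    "HOL-Analysis.Analysis"
    "HOL-Algebra.Group"
    "HOL-Library.Function_Algebras"
begin

section \<open>Unital $C^*$-algebras\<close>

text \<open>
  Completeness, submultiplicativity of the norm and the unit come from the library classes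
  (which also give the usual convention that the unit is nonzero). The complex scalar
  multiplication extends the real one of the library.
\<close>

class cstar_algebra = real_normed_algebra_1 + banach +
  fixes scaleC :: "complex \<Rightarrow> 'a \<Rightarrow> 'a"
    and star :: "'a \<Rightarrow> 'a"
  assumes scaleC_add_right: "scaleC c (x + y) = scaleC c x + scaleC c y"
    and scaleC_add_left: "scaleC (c + d) x = scaleC c x + scaleC d x"
    and scaleC_scaleC: "scaleC c (scaleC d x) = scaleC (c * d) x"
    and scaleC_of_real: "scaleC (complex_of_real r) x = r *\<^sub>R x"
    and mult_scaleC_left: "scaleC c x * y = scaleC c (x * y)"
    and mult_scaleC_right: "x * scaleC c y = scaleC c (x * y)"
    and norm_scaleC: "norm (scaleC c x) = cmod c * norm x"
    and star_add: "star (x + y) = star x + star y"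
    and star_scaleC: "star (scaleC c x) = scaleC (cnj c) (star x)"
    and star_mult: "star (x * y) = star y * star x"
    and star_star: "star (star x) = x"
    and cstar_identity: "norm (star x * x) = (norm x)\<^sup>2"

instantiation complex :: cstar_algebra
begin

definition scaleC_complex :: "complex \<Rightarrow> complex \<Rightarrow> complex"
  where "scaleC_complex = (*)"

definition star_complex :: "complex \<Rightarrow> complex"
  where "star_complex = cnj"

instance
  by standard
    (auto simp: scaleC_complex_def star_complex_def algebra_simps norm_mult power2_eq_square
      scaleR_conv_of_real)

end

definition cstar_center :: "'a::cstar_algebra set"
  where "cstar_center = {z. \<forall>a. z * a = a * z}"

section \<open>The standard Hilbert module and its submodules\<close>

text \<open>
  Elements of the standard module are sequences, with the pointwise operations; all notions
  below only refer to sequences in the carrier \<open>HA\<close>.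
\<close>

definition HA :: "(nat \<Rightarrow> 'a::cstar_algebra) set"
  where "HA = {x. summable (\<lambda>i. star (x i) * x i)}"

definition hinner :: "(nat \<Rightarrow> 'a::cstar_algebra) \<Rightarrow> (nat \<Rightarrow> 'a) \<Rightarrow> 'a"
  where "hinner x y = (\<Sum>i. star (x i) * y i)"

definition hnorm :: "(nat \<Rightarrow> 'a::cstar_algebra) \<Rightarrow> real"
  where "hnorm x = sqrt (norm (hinner x x))"

definition ract :: "(nat \<Rightarrow> 'a::cstar_algebra) \<Rightarrow> 'a \<Rightarrow> nat \<Rightarrow> 'a"
  where "ract x a = (\<lambda>i. x i * a)"

definition closed_submodule :: "(nat \<Rightarrow> 'a::cstar_algebra) set \<Rightarrow> bool"
  where "closed_submodule M \<longleftrightarrow>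
    M \<subseteq> HA \<and> 0 \<in> M \<and> (\<forall>x\<in>M. \<forall>y\<in>M. x + y \<in> M) \<and> (\<forall>x\<in>M. \<forall>a. ract x a \<in> M) \<and>
    (\<forall>s x. (\<forall>n::nat. s n \<in> M) \<and> x \<in> HA \<and> (\<lambda>n. hnorm (s n - x)) \<longlonglongrightarrow> 0 \<longrightarrow> x \<in> M)"

definition finitely_generated :: "(nat \<Rightarrow> 'a::cstar_algebra) set \<Rightarrow> bool"
  where "finitely_generated M \<longleftrightarrow>
    (\<exists>S. finite S \<and> S \<subseteq> HA \<and> M = {\<Sum>s\<in>S. ract s (c s) | c. True})"

text \<open>\<open>direct_sum H M N\<close>: \<open>H\<close> is the internal, not necessarily orthogonal, direct sum of the
  closed submodules \<open>M\<close> and \<open>N\<close>.\<close>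

definition direct_sum ::
  "(nat \<Rightarrow> 'a::cstar_algebra) set \<Rightarrow> (nat \<Rightarrow> 'a) set \<Rightarrow> (nat \<Rightarrow> 'a) set \<Rightarrow> bool"
  where "direct_sum H M N \<longleftrightarrow>
    closed_submodule M \<and> closed_submodule N \<and> M \<inter> N = {0} \<and> H = {x + y | x y. x \<in> M \<and> y \<in> N}"

definition module_linear_on ::
  "(nat \<Rightarrow> 'a::cstar_algebra) set \<Rightarrow> ((nat \<Rightarrow> 'a) \<Rightarrow> nat \<Rightarrow> 'a) \<Rightarrow> bool"
  where "module_linear_on M f \<longleftrightarrow>
    (\<forall>x\<in>M. \<forall>y\<in>M. f (x + y) = f x + f y) \<and> (\<forall>x\<in>M. \<forall>a. f (ract x a) = ract (f x) a)"

definition bounded_on ::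
  "(nat \<Rightarrow> 'a::cstar_algebra) set \<Rightarrow> ((nat \<Rightarrow> 'a) \<Rightarrow> nat \<Rightarrow> 'a) \<Rightarrow> bool"
  where "bounded_on M f \<longleftrightarrow> (\<exists>C. \<forall>x\<in>M. hnorm (f x) \<le> C * hnorm x)"

definition module_iso ::
  "((nat \<Rightarrow> 'a::cstar_algebra) \<Rightarrow> nat \<Rightarrow> 'a) \<Rightarrow> (nat \<Rightarrow> 'a) set \<Rightarrow> (nat \<Rightarrow> 'a) set \<Rightarrow> bool"
  where "module_iso f M N \<longleftrightarrow>
    bij_betw f M N \<and> module_linear_on M f \<and> bounded_on M f \<and> bounded_on N (inv_into M f)"

definition isomorphic :: "(nat \<Rightarrow> 'a::cstar_algebra) set \<Rightarrow> (nat \<Rightarrow> 'a) set \<Rightarrow> bool"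
  where "isomorphic M N \<longleftrightarrow> (\<exists>f. module_iso f M N)"

section \<open>Operators\<close>

definition adjointable_ops :: "((nat \<Rightarrow> 'a::cstar_algebra) \<Rightarrow> nat \<Rightarrow> 'a) set"
  where "adjointable_ops =
    {F. F ` HA \<subseteq> HA \<and> module_linear_on HA F \<and> bounded_on HA F \<and>
        (\<exists>G. G ` HA \<subseteq> HA \<and> (\<forall>x\<in>HA. \<forall>y\<in>HA. hinner (F x) y = hinner x (G y)))}"

text \<open>The operator \<open>\<alpha>I\<close>.\<close>

definition scalar_op :: "'a::cstar_algebra \<Rightarrow> (nat \<Rightarrow> 'a) \<Rightarrow> nat \<Rightarrow> 'a"
  where "scalar_op \<alpha> = (\<lambda>x. ract x \<alpha>)"

section \<open>The group $K_0$\<close>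

text \<open>
  Finitely generated projective modules are the direct summands, up to isomorphism, of the free
  modules \<open>free_module n\<close>, that is $\mathcal{A}^n$ placed in the first \<open>n\<close> coordinates. Every
  isomorphism class of such modules has a representative among the closed submodules of \<open>HA\<close>.
  The external direct sum of two submodules is realised inside \<open>HA\<close> by interleaving coordinates,
  which is the identification of \<open>HA \<oplus> HA\<close> with \<open>HA\<close>.
\<close>

definition free_module :: "nat \<Rightarrow> (nat \<Rightarrow> 'a::cstar_algebra) set"
  where "free_module n = {x. \<forall>i\<ge>n. x i = 0}"

definition fg_projective :: "(nat \<Rightarrow> 'a::cstar_algebra) set \<Rightarrow> bool"
  where "fg_projective P \<longleftrightarrow>
    closed_submodule P \<and> (\<exists>n Q R. direct_sum (free_module n) Q R \<and> isomorphic P Q)"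

definition interleave :: "(nat \<Rightarrow> 'a) \<Rightarrow> (nat \<Rightarrow> 'a) \<Rightarrow> nat \<Rightarrow> 'a"
  where "interleave x y = (\<lambda>i. if even i then x (i div 2) else y (i div 2))"

definition ext_sum :: "(nat \<Rightarrow> 'a::cstar_algebra) set \<Rightarrow> (nat \<Rightarrow> 'a) set \<Rightarrow> (nat \<Rightarrow> 'a) set"
  where "ext_sum P Q = {interleave x y | x y. x \<in> P \<and> y \<in> Q}"

text \<open>
  Grothendieck construction on the isomorphism classes of finitely generated projective modules:
  the class of the pair \<open>(P, Q)\<close> is the formal difference of the classes of \<open>P\<close> and \<open>Q\<close>.
  The group is additive, but written with the multiplicative record of the library.
\<close>

definition k0_rel ::
  "(((nat \<Rightarrow> 'a::cstar_algebra) set \<times> (nat \<Rightarrow> 'a) set) \<times>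
    ((nat \<Rightarrow> 'a) set \<times> (nat \<Rightarrow> 'a) set)) set"
  where "k0_rel = {((P, Q), (P', Q')).
    fg_projective P \<and> fg_projective Q \<and> fg_projective P' \<and> fg_projective Q' \<and>
    (\<exists>R. fg_projective R \<and>
      isomorphic (ext_sum (ext_sum P Q') R) (ext_sum (ext_sum P' Q) R))}"

definition K0 :: "((nat \<Rightarrow> 'a::cstar_algebra) set \<times> (nat \<Rightarrow> 'a) set) set monoid"
  where "K0 =
    \<lparr>carrier = (Collect fg_projective \<times> Collect fg_projective) // k0_rel,
     monoid.mult = (\<lambda>X Y. \<Union>(P, Q)\<in>X. \<Union>(P', Q')\<in>Y. k0_rel `` {(ext_sum P P', ext_sum Q Q')}),
     one = k0_rel `` {({0}, {0})}\<rparr>"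

definition k0_class ::
  "(nat \<Rightarrow> 'a::cstar_algebra) set \<Rightarrow> ((nat \<Rightarrow> 'a) set \<times> (nat \<Rightarrow> 'a) set) set"
  where "k0_class N = k0_rel `` {(N, {0})}"

section \<open>Semi-Fredholm operators and spectra\<close>

definition fredholm_decomp ::
  "((nat \<Rightarrow> 'a::cstar_algebra) \<Rightarrow> nat \<Rightarrow> 'a) \<Rightarrow> (nat \<Rightarrow> 'a) set \<Rightarrow> (nat \<Rightarrow> 'a) set \<Rightarrow>
    (nat \<Rightarrow> 'a) set \<Rightarrow> (nat \<Rightarrow> 'a) set \<Rightarrow> bool"
  where "fredholm_decomp F M1 N1 M2 N2 \<longleftrightarrow>
    direct_sum HA M1 N1 \<and> direct_sum HA M2 N2 \<and>
    F ` M1 \<subseteq> M2 \<and> F ` N1 \<subseteq> N2 \<and> module_iso F M1 M2"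

definition MPhi_plus :: "((nat \<Rightarrow> 'a::cstar_algebra) \<Rightarrow> nat \<Rightarrow> 'a) set"
  where "MPhi_plus = {F \<in> adjointable_ops.
    \<exists>M1 N1 M2 N2. fredholm_decomp F M1 N1 M2 N2 \<and> finitely_generated N1}"

definition MPhi_minus :: "((nat \<Rightarrow> 'a::cstar_algebra) \<Rightarrow> nat \<Rightarrow> 'a) set"
  where "MPhi_minus = {F \<in> adjointable_ops.
    \<exists>M1 N1 M2 N2. fredholm_decomp F M1 N1 M2 N2 \<and> finitely_generated N2}"

definition MPhi :: "((nat \<Rightarrow> 'a::cstar_algebra) \<Rightarrow> nat \<Rightarrow> 'a) set"
  where "MPhi = {F \<in> adjointable_ops.
    \<exists>M1 N1 M2 N2. fredholm_decomp F M1 N1 M2 N2 \<and> finitely_generated N1 \<and> finitely_generated N2}"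

text \<open>
  The value does not depend on the decomposition, so the choice made by \<open>SOME\<close> is immaterial;
  it is meaningful for \<open>F \<in> MPhi\<close> only.
\<close>

definition fredholm_index ::
  "((nat \<Rightarrow> 'a::cstar_algebra) \<Rightarrow> nat \<Rightarrow> 'a) \<Rightarrow> ((nat \<Rightarrow> 'a) set \<times> (nat \<Rightarrow> 'a) set) set"
  where "fredholm_index F = (SOME k. \<exists>M1 N1 M2 N2.
    fredholm_decomp F M1 N1 M2 N2 \<and> finitely_generated N1 \<and> finitely_generated N2 \<and>
    k = k0_class N1 \<otimes>\<^bsub>K0\<^esub> inv\<^bsub>K0\<^esub> (k0_class N2))"

definition MPhi_zero :: "((nat \<Rightarrow> 'a::cstar_algebra) \<Rightarrow> nat \<Rightarrow> 'a) set"
  where "MPhi_zero = {F \<in> MPhi. fredholm_index F = \<one>\<^bsub>K0\<^esub>}"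

definition sigma_ew :: "((nat \<Rightarrow> 'a::cstar_algebra) \<Rightarrow> nat \<Rightarrow> 'a) \<Rightarrow> 'a set"
  where "sigma_ew F = {\<alpha> \<in> cstar_center. F - scalar_op \<alpha> \<notin> MPhi_zero}"

definition sigma_ef :: "((nat \<Rightarrow> 'a::cstar_algebra) \<Rightarrow> nat \<Rightarrow> 'a) \<Rightarrow> 'a set"
  where "sigma_ef F = {\<alpha> \<in> cstar_center. F - scalar_op \<alpha> \<notin> MPhi}"

definition sigma_ea :: "((nat \<Rightarrow> 'a::cstar_algebra) \<Rightarrow> nat \<Rightarrow> 'a) \<Rightarrow> 'a set"
  where "sigma_ea F = {\<alpha> \<in> cstar_center. F - scalar_op \<alpha> \<notin> MPhi_plus}"

definition sigma_eb :: "((nat \<Rightarrow> 'a::cstar_algebra) \<Rightarrow> nat \<Rightarrow> 'a) \<Rightarrow> 'a set"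
  where "sigma_eb F = {\<alpha> \<in> cstar_center. F - scalar_op \<alpha> \<notin> MPhi_minus}"

definition sigma_ek :: "((nat \<Rightarrow> 'a::cstar_algebra) \<Rightarrow> nat \<Rightarrow> 'a) \<Rightarrow> 'a set"
  where "sigma_ek F = {\<alpha> \<in> cstar_center. F - scalar_op \<alpha> \<notin> MPhi_plus \<union> MPhi_minus}"

text \<open>Boundary relative to the center, not to the whole algebra.\<close>

definition center_boundary :: "'a::cstar_algebra set \<Rightarrow> 'a set"
  where "center_boundary S = (top_of_set cstar_center) frontier_of S"

end

theory Submission
  imports Defs
begin

text \<open>
  All five inclusions rest on one topological observation. Let \<open>P\<close> and \<open>Q\<close> be classes of operators with
  \<open>P \<subseteq> Q\<close>, and consider the central scalars \<open>\<alpha>\<close> for which \<open>F - \<alpha> I\<close> lies outside \<open>P\<close> or outside \<open>Q\<close>,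
  respectively. If \<open>P\<close> is open along the translates of \<open>F\<close>, and if near a translate in \<open>Q - P\<close> no
  translate belongs to \<open>P\<close>, then the boundary of the first set is contained in the boundary of the second
  (\<open>center_boundary_subset\<close>). So what has to be shown is that the semi-Fredholm classes are open, that their
  differences are separated from the smaller class, and that the index is locally constant.

  Decompositions are hard to compare directly, therefore they are replaced by bounded module maps \<open>G\<close> with
  \<open>G F G = G\<close> (\<open>outer_inverse_of_fredholm_decomp\<close>, \<open>fredholm_decomp_of_outer_inverse\<close>). The
  complements \<open>N1\<close> and \<open>N2\<close> are then the kernels of \<open>G F\<close> and of \<open>G\<close>. Two facts about outer inverses carry
  the proof. If \<open>D\<close> is close to \<open>F\<close>, a Neumann series turns \<open>G\<close> into an outer inverse of \<open>D\<close> with the same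
  \<open>N2\<close> and an isomorphic \<open>N1\<close> (\<open>outer_inverse_perturbation\<close>). And if \<open>G\<close> and \<open>G'\<close> are outer inverses of the
  same operator, then \<open>N1 \<oplus> N2'\<close> is isomorphic to \<open>N1' \<oplus> N2\<close> (\<open>iso_sub_defects\<close>). The first gives
  openness. The second shows that an operator which is both upper and lower semi-Fredholm has only
  decompositions in which finite generation of \<open>N1\<close> is equivalent to that of \<open>N2\<close>, which separates the
  classes; and in \<open>K0\<close> it says that the index does not depend on the decomposition.

  Passing between decompositions and outer inverses requires projections in direct sums of closed
  submodules to be bounded, which is the open mapping theorem (\<open>bounded_preimages\<close>); so \<open>HA\<close> has to be a Banach
  space. Its norm satisfies the triangle inequality by the Cauchy--Schwarz inequality, which in turn needs
  the positivity of \<open>star x * x\<close> (\<open>cstar_pos_star_mult_self\<close>) and the monotonicity of the norm on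
  positive elements. Finally the index takes values in \<open>K0\<close> only if finitely generated complements are
  projective in the sense of the definition, that is, direct summands of free modules of finite rank; this is
  \<open>projective_sub_of_finitely_generated\<close>.
\<close>

section \<open>Positivity in $C^*$-algebras\<close>

lemma star_zero [simp]: "star (0::'a::cstar_algebra) = 0"
  using star_add[of "0::'a" 0] by simp

lemma star_minus: "star (- x) = - star (x::'a::cstar_algebra)"
  using star_add[of x "- x"] by (simp add: eq_neg_iff_add_eq_0 add.commute)

lemma star_diff: "star (x - y) = star x - star (y::'a::cstar_algebra)"
  using star_add[of x "- y"] by (simp add: star_minus)

lemma star_one [simp]: "star (1::'a::cstar_algebra) = 1"
  using star_mult[of "star 1" "1::'a"] by (simp add: star_star)

lemma star_scaleR: "star (r *\<^sub>R x) = r *\<^sub>R star (x::'a::cstar_algebra)"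
  using star_scaleC[of "complex_of_real r" x] by (simp add: scaleC_of_real)

lemma star_of_real [simp]: "star (of_real r :: 'a::cstar_algebra) = of_real r"
  by (simp add: of_real_def star_scaleR)

lemma norm_star [simp]: "norm (star x) = norm (x::'a::cstar_algebra)"
proof -
  have le: "norm x \<le> norm (star x)" for x :: 'a
  proof (cases "x = 0")
    case False
    have "norm x * norm x \<le> norm (star x) * norm x"
      using norm_mult_ineq[of "star x" x] by (simp add: cstar_identity power2_eq_square)
    with False show ?thesis by simp
  qed simp
  show ?thesis using le[of x] le[of "star x"] by (simp add: star_star)
qed

lemma bounded_linear_star: "bounded_linear (star :: 'a::cstar_algebra \<Rightarrow> 'a)"
  by (rule bounded_linear_intro[where K = 1]) (auto simp: star_add star_scaleR)

lemmas continuous_on_star [continuous_intros] =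
  bounded_linear.continuous_on[OF bounded_linear_star]

lemmas tendsto_star [tendsto_intros] = bounded_linear.tendsto[OF bounded_linear_star]

lemma star_power: "star (x ^ n) = star (x::'a::cstar_algebra) ^ n"
  by (induction n) (auto simp: star_mult power_commutes)

lemma star_sum: "star (\<Sum>i\<in>I. x i) = (\<Sum>i\<in>I. star (x i :: 'a::cstar_algebra))"
  by (induction I rule: infinite_finite_induct) (auto simp: star_add)

lemma norm_square_selfadjoint: "star h = h \<Longrightarrow> norm (h * h) = (norm (h::'a::cstar_algebra))\<^sup>2"
  using cstar_identity[of h] by simp

lemma scaleC_minus_one: "scaleC (-1) x = - (x::'a::cstar_algebra)"
  using scaleC_of_real[of "-1" x] by simp

lemma scaleC_minus_right: "scaleC c (- x) = - scaleC c (x::'a::cstar_algebra)"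
proof -
  have "scaleC c (scaleC (-1) x) = scaleC (-1) (scaleC c x)" by (simp add: scaleC_scaleC)
  then show ?thesis by (simp add: scaleC_minus_one)
qed

lemma scaleC_scaleR: "scaleC c (r *\<^sub>R x) = r *\<^sub>R scaleC c (x::'a::cstar_algebra)"
  by (simp only: scaleC_of_real[symmetric] scaleC_scaleC mult.commute)

lemma scaleC_diff_right: "scaleC c (x - y) = scaleC c x - scaleC c (y::'a::cstar_algebra)"
  using scaleC_add_right[of c x "- y"] by (simp add: scaleC_minus_right)

text \<open>
  The element \<open>u = k + \<i> l\<close> satisfies \<open>star u * u = k * k + l * l\<close> because \<open>k\<close> and \<open>l\<close>
  commute, and \<open>k\<close> is its real part. This replaces the functional calculus wherever the norm of a
  square is compared with the norm of a sum of squares.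
\<close>

lemma norm_le_norm_sum_of_squares:
  fixes k l :: "'a::cstar_algebra"
  assumes "star k = k" "star l = l" "k * l = l * k"
  shows "(norm k)\<^sup>2 \<le> norm (k * k + l * l)"
proof -
  define u where "u = k + scaleC \<i> l"
  have su: "star u = k - scaleC \<i> l"
    using scaleC_scaleC[of "-1" \<i> l] scaleC_of_real[of "-1" "scaleC \<i> l"]
    by (simp add: u_def star_add star_scaleC assms)
  have "star u * u = k * k + l * l"
    unfolding su
    by (simp add: u_def algebra_simps mult_scaleC_left mult_scaleC_right scaleC_scaleC assms(3)
        scaleC_diff_right scaleC_add_right scaleC_minus_one)
  then have "norm (k * k + l * l) = (norm u)\<^sup>2"
    using cstar_identity[of u] by simp
  moreover have "norm k \<le> norm u"
  proof -
    have "2 *\<^sub>R k = u + star u" unfolding su by (simp add: u_def scaleR_2)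
    then have "2 * norm k \<le> norm u + norm (star u)"
      by (metis norm_scaleR norm_triangle_ineq abs_numeral)
    then show ?thesis by simp
  qed
  ultimately show ?thesis by simp
qed

text \<open>
  The element \<open>x = 1 - c\<close> solves \<open>x = (h + x * x) / 2\<close>, and the right-hand side is a contraction on
  the ball of radius \<open>norm h\<close>. Iterating inside the self-adjoint elements that commute with
  everything commuting with \<open>h\<close> passes both properties on to the root.
\<close>

lemma sqrt_one_minus:
  fixes h :: "'a::cstar_algebra"
  assumes "star h = h" "norm h < 1"
  obtains c where "star c = c" "c * c = 1 - h" "\<And>y. y * h = h * y \<Longrightarrow> y * c = c * y"
proof -
  define q where "q = norm h"
  have q: "0 \<le> q" "q < 1" using assms by (auto simp: q_def)
  define X where "X = {x::'a. star x = x} \<inter> cball 0 q \<inter> (\<Inter>y\<in>{y. y * h = h * y}. {x. y * x = x * y})"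
  define T where "T x = (1/2) *\<^sub>R (h + x * x)" for x
  have "closed X" unfolding X_def
    by (intro closed_Int closed_INT ballI closed_Collect_eq continuous_intros closed_cball)
  then have cX: "complete X" by (simp add: complete_eq_closed)
  have "0 \<in> X" using q by (auto simp: X_def)
  then have "X \<noteq> {}" by blast
  moreover have "T ` X \<subseteq> X"
  proof
    fix z assume "z \<in> T ` X"
    then obtain x where "x \<in> X" and z: "z = T x" by auto
    then have sx: "star x = x" and nx: "norm x \<le> q"
      and cx: "\<And>y. y * h = h * y \<Longrightarrow> y * x = x * y" by (auto simp: X_def)
    have "norm (x * x) \<le> q * q"
      using nx q by (intro order.trans[OF norm_mult_ineq] mult_mono) auto
    also have "\<dots> \<le> q" using q by (simp add: mult_left_le)
    finally have "norm (h + x * x) \<le> q + q"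
      by (intro order.trans[OF norm_triangle_ineq]) (simp add: q_def)
    then have "norm z \<le> q" by (simp add: z T_def)
    moreover have "star z = z" by (simp add: z T_def star_scaleR star_add star_mult sx assms(1))
    moreover have "y * z = z * y" if "y * h = h * y" for y
    proof -
      have "y * x = x * y" using cx that by blast
      then have "y * (x * x) = (x * x) * y" by (metis mult.assoc)
      then show ?thesis by (simp only: z T_def distrib_left distrib_right that mult_scaleR_left mult_scaleR_right)
    qed
    ultimately show "z \<in> X" unfolding X_def by simp
  qed
  moreover have "dist (T x) (T y) \<le> q * dist x y" if "x \<in> X" "y \<in> X" for x y
  proof -
    have "T x - T y = (1/2) *\<^sub>R (x * (x - y) + (x - y) * y)"
      by (simp add: T_def algebra_simps)
    then have "norm (T x - T y) \<le> (1/2) * (norm (x * (x - y)) + norm ((x - y) * y))"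
      by (simp add: norm_triangle_ineq)
    also have "\<dots> \<le> (1/2) * (norm x * norm (x - y) + norm (x - y) * norm y)"
      by (intro mult_left_mono add_mono norm_mult_ineq) auto
    also have "\<dots> \<le> (1/2) * (q * norm (x - y) + norm (x - y) * q)"
      using that by (intro mult_left_mono add_mono mult_right_mono) (auto simp: X_def)
    finally show ?thesis by (simp add: dist_norm algebra_simps)
  qed
  ultimately obtain x where x: "x \<in> X" "T x = x"
    using Banach_fix[of X q T] q cX by metis
  have sx: "star x = x" and cx: "\<And>y. y * h = h * y \<Longrightarrow> y * x = x * y" using x(1) by (auto simp: X_def)
  have "x + x = h + x * x" using x(2) unfolding T_def
    by (metis scaleR_2 scaleR_half_double scaleR_add_right)
  then have "(1 - x) * (1 - x) = 1 - h" by (simp add: algebra_simps)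
  moreover have "y * (1 - x) = (1 - x) * y" if "y * h = h * y" for y
    using cx[OF that] by (simp add: left_diff_distrib right_diff_distrib)
  moreover have "star (1 - x) = 1 - x" by (simp add: star_diff sx)
  ultimately show thesis using that by blast
qed

text \<open>
  A self-adjoint element has nonnegative spectrum iff it lies in the ball of radius \<open>t\<close> around some
  scalar \<open>t\<close>. In this form sums of positive elements are positive by the triangle inequality.
\<close>

definition cstar_pos :: "'a::cstar_algebra \<Rightarrow> bool"
  where "cstar_pos a \<longleftrightarrow> star a = a \<and> (\<exists>t. norm (of_real t - a) \<le> t)"

lemma cstar_pos_selfadjoint: "cstar_pos a \<Longrightarrow> star a = a"
  by (simp add: cstar_pos_def)

text \<open>
  For \<open>a\<close> itself the constant of the contraction may be 1; hence the shift by a positive scalar, which is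
  removed later by closedness of the cone.
\<close>

lemma cstar_pos_sqrt:
  fixes a :: "'a::cstar_algebra"
  assumes "cstar_pos a" "0 < e"
  obtains k where "star k = k" "k * k = a + of_real e" "\<And>y. y * a = a * y \<Longrightarrow> y * k = k * y"
proof -
  obtain t where t: "norm (of_real t - a) \<le> t" and sa: "star a = a"
    using assms by (auto simp: cstar_pos_def)
  have t0: "0 \<le> t" using t norm_ge_zero order_trans by blast
  define h where "h = (1 / (t + e)) *\<^sub>R (of_real t - a)"
  have te: "t + e > 0" using t0 assms by simp
  have "norm h = norm (of_real t - a) / (t + e)" using te by (simp add: h_def)
  also have "\<dots> < 1" using t assms te by simp
  finally have "norm h < 1" .
  moreover have "star h = h" by (simp add: h_def star_scaleR star_diff sa)
  ultimately obtain c where c: "star c = c" "c * c = 1 - h" "\<And>y. y * h = h * y \<Longrightarrow> y * c = c * y"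
    using sqrt_one_minus by blast
  define k where "k = sqrt (t + e) *\<^sub>R c"
  have "k * k = (t + e) *\<^sub>R (1 - h)" using te by (simp add: k_def c(2))
  also have "\<dots> = of_real (t + e) - (of_real t - a)"
    using te by (simp add: h_def scaleR_diff_right of_real_def)
  finally have "k * k = a + of_real e" by simp
  moreover have "\<And>y. y * a = a * y \<Longrightarrow> y * k = k * y"
  proof -
    fix y assume "y * a = a * y"
    then have "y * h = h * y" by (simp add: h_def algebra_simps of_real_def)
    then show "y * k = k * y" using c(3)[of y] by (simp add: k_def)
  qed
  moreover have "star k = k" by (simp add: k_def star_scaleR c(1))
  ultimately show thesis using that by blast
qed

text \<open>
  If \<open>l * l = of_real t - k * k\<close>, then \<open>k\<close> and \<open>l\<close> commute and their squares add up to the scalar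
  \<open>t\<close>, so that \<open>norm_le_norm_sum_of_squares\<close> bounds \<open>l\<close>.
\<close>

lemma norm_of_real_minus_square:
  fixes k :: "'a::cstar_algebra"
  assumes "star k = k" "(norm k)\<^sup>2 < t"
  shows "norm (of_real t - k * k) \<le> t"
proof -
  have t: "t > 0" using assms(2) by (smt (verit) zero_le_power2)
  define h where "h = (1/t) *\<^sub>R (k * k)"
  have "norm h < 1" using t assms by (simp add: h_def norm_square_selfadjoint)
  moreover have "star h = h" by (simp add: h_def star_scaleR star_mult assms)
  ultimately obtain c where c: "star c = c" "c * c = 1 - h" "\<And>y. y * h = h * y \<Longrightarrow> y * c = c * y"
    using sqrt_one_minus by blast
  define l where "l = sqrt t *\<^sub>R c"
  have "k * h = h * k" by (simp add: h_def mult.assoc)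
  then have "k * l = l * k" using c(3)[of k] by (simp add: l_def)
  moreover have "star l = l" by (simp add: l_def star_scaleR c(1))
  moreover have ll: "l * l = of_real t - k * k"
    using t by (simp add: l_def c(2)) (simp add: h_def scaleR_diff_right of_real_def)
  ultimately have "(norm l)\<^sup>2 \<le> norm (of_real t :: 'a)"
    using norm_le_norm_sum_of_squares[of l k] assms(1) by simp
  then show ?thesis using ll t norm_square_selfadjoint[OF \<open>star l = l\<close>] by simp
qed

text \<open>
  The definition of positivity asks for some scalar; any scalar above the norm will do. This makes
  positivity a closed condition.
\<close>

lemma cstar_pos_norm_le:
  fixes a :: "'a::cstar_algebra"
  assumes "cstar_pos a" "norm a \<le> t"
  shows "norm (of_real t - a) \<le> t"
proof (rule field_le_epsilon)
  fix e :: real assume "e > 0"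
  define d where "d = e / 3"
  have d: "d > 0" using \<open>e > 0\<close> by (simp add: d_def)
  obtain k where k: "star k = k" "k * k = a + of_real d"
    using cstar_pos_sqrt[OF assms(1) d] by blast
  have "(norm k)\<^sup>2 \<le> t + d"
    using norm_square_selfadjoint[OF k(1)] norm_triangle_ineq[of a "of_real d"] k(2) assms(2) d by simp
  then have "norm (of_real (t + 2 * d) - (a + of_real d)) \<le> t + 2 * d"
    using norm_of_real_minus_square[OF k(1), of "t + 2 * d"] d k(2) by simp
  then have "norm ((of_real t - a) + of_real d) \<le> t + 2 * d"
    by (simp only: of_real_add mult_2 add_diff_eq diff_add_eq diff_diff_eq2 add_diff_add) (simp add: algebra_simps)
  then have "norm (of_real t - a) \<le> t + 2 * d + norm (of_real d :: 'a)"
    by (smt (verit) norm_diff_ineq)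
  then show "norm (of_real t - a) \<le> t + e" using d by (simp add: d_def)
qed

lemma cstar_pos_iff:
  "cstar_pos a \<longleftrightarrow> star a = a \<and> norm (of_real (norm a) - a) \<le> norm (a::'a::cstar_algebra)"
  using cstar_pos_norm_le[of a "norm a"] by (auto simp: cstar_pos_def)

lemma closed_cstar_pos: "closed (Collect (cstar_pos :: 'a::cstar_algebra \<Rightarrow> bool))"
  unfolding cstar_pos_iff
  by (intro closed_Collect_conj closed_Collect_eq closed_Collect_le continuous_intros)

lemma cstar_pos_limit:
  "(f \<longlongrightarrow> (a::'a::cstar_algebra)) G \<Longrightarrow> eventually (\<lambda>n. cstar_pos (f n)) G \<Longrightarrow> G \<noteq> bot \<Longrightarrow> cstar_pos a"
  using Lim_in_closed_set[OF closed_cstar_pos, of f G a] by auto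

lemma cstar_pos_if_pos_plus_eps:
  fixes a b :: "'a::cstar_algebra"
  assumes "\<And>e. e > 0 \<Longrightarrow> cstar_pos (a + e *\<^sub>R b)"
  shows "cstar_pos a"
proof (rule cstar_pos_limit)
  show "((\<lambda>e. a + e *\<^sub>R b) \<longlongrightarrow> a) (at_right 0)"
    by (rule tendsto_eq_intros refl | simp)+
  show "\<forall>\<^sub>F e in at_right 0. cstar_pos (a + e *\<^sub>R b)"
    using assms by (auto simp: eventually_at_right_less intro: eventually_mono[OF eventually_at_right_less])
qed simp

lemma cstar_pos_square: "star k = k \<Longrightarrow> cstar_pos (k * (k::'a::cstar_algebra))"
  using norm_of_real_minus_square[of k "(norm k)\<^sup>2 + 1"]
  by (auto simp: cstar_pos_def star_mult simp del: of_real_add of_real_power intro!: exI[of _ "(norm k)\<^sup>2 + 1"])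

lemma cstar_pos_add: "cstar_pos a \<Longrightarrow> cstar_pos b \<Longrightarrow> cstar_pos (a + (b::'a::cstar_algebra))"
proof -
  assume "cstar_pos a" "cstar_pos b"
  then obtain s t where "star a = a" "star b = b" "norm (of_real s - a) \<le> s" "norm (of_real t - b) \<le> t"
    by (auto simp: cstar_pos_def)
  moreover have "norm (of_real (s + t) - (a + b)) \<le> norm (of_real s - a) + norm (of_real t - b)"
    by (smt (verit) add_diff_add norm_triangle_ineq of_real_add)
  ultimately show ?thesis by (auto simp: cstar_pos_def star_add intro!: exI[of _ "s + t"])
qed

lemma cstar_pos_scaleR: "0 \<le> r \<Longrightarrow> cstar_pos a \<Longrightarrow> cstar_pos (r *\<^sub>R (a::'a::cstar_algebra))"
proof -
  assume r: "0 \<le> r" and "cstar_pos a"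
  then obtain t where "star a = a" "norm (of_real t - a) \<le> t"
    by (auto simp: cstar_pos_def)
  moreover have "of_real (r * t) - r *\<^sub>R a = r *\<^sub>R (of_real t - a)"
    by (simp add: of_real_def scaleR_diff_right)
  ultimately show ?thesis using r by (auto simp: cstar_pos_def star_scaleR mult_left_mono intro!: exI[of _ "r * t"])
qed

lemma cstar_pos_of_real: "0 \<le> r \<Longrightarrow> cstar_pos (of_real r :: 'a::cstar_algebra)"
  by (auto simp: cstar_pos_def intro!: exI[of _ r])

lemma cstar_pos_zero [simp]: "cstar_pos (0::'a::cstar_algebra)"
  using cstar_pos_of_real[of 0] by simp

lemma cstar_pos_sum: "(\<And>i. i \<in> I \<Longrightarrow> cstar_pos (f i)) \<Longrightarrow> cstar_pos (\<Sum>i\<in>I. f i :: 'a::cstar_algebra)"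
  by (induction I rule: infinite_finite_induct) (auto simp: cstar_pos_add)

lemma cstar_pos_norm_diff:
  "star a = a \<Longrightarrow> norm a \<le> t \<Longrightarrow> cstar_pos (of_real t - (a::'a::cstar_algebra))"
  by (auto simp: cstar_pos_def star_diff intro!: exI[of _ t])

text \<open>
  Put \<open>t = norm (p + q)\<close>. Then \<open>t - p = (t - (p + q)) + q\<close> is positive together with \<open>p\<close>, so up to a
  small scalar both are squares of commuting elements, and these squares add up to a scalar close
  to \<open>t\<close>.
\<close>

lemma norm_le_norm_add_pos:
  fixes p q :: "'a::cstar_algebra"
  assumes p: "cstar_pos p" and q: "cstar_pos q"
  shows "norm p \<le> norm (p + q)"
proof (rule field_le_epsilon)
  fix e :: real assume "e > 0"
  define d where "d = e / 3"
  have d: "d > 0" using \<open>e > 0\<close> by (simp add: d_def)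
  define t where "t = norm (p + q)"
  have "cstar_pos (of_real t - (p + q))"
    using assms by (intro cstar_pos_norm_diff) (auto simp: t_def star_add cstar_pos_selfadjoint)
  from cstar_pos_add[OF this q] have tp: "cstar_pos (of_real t - p)" by simp
  obtain k where k: "star k = k" "k * k = p + of_real d" "\<And>y. y * p = p * y \<Longrightarrow> y * k = k * y"
    using cstar_pos_sqrt[OF p d] by blast
  obtain l where l: "star l = l" "l * l = of_real t - p + of_real d"
      "\<And>y. y * (of_real t - p) = (of_real t - p) * y \<Longrightarrow> y * l = l * y"
    using cstar_pos_sqrt[OF tp d] by blast
  have "p * l = l * p" by (rule l(3)) (simp add: algebra_simps of_real_def)
  then have "l * k = k * l" using k(3)[of l] by simp
  then have "(norm k)\<^sup>2 \<le> norm (k * k + l * l)"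
    using norm_le_norm_sum_of_squares[of k l] k(1) l(1) by simp
  also have "k * k + l * l = of_real (t + 2 * d)" 
    by (simp only: k(2) l(2) mult_2 of_real_add) simp
  also have "norm (of_real (t + 2 * d) :: 'a) = t + 2 * d"
    using d by (simp only: norm_of_real) (simp add: t_def)
  finally have "norm (p + of_real d) \<le> t + 2 * d" using norm_square_selfadjoint[OF k(1)] k(2) by simp
  then have "norm p \<le> t + 2 * d + norm (of_real d :: 'a)"
    by (smt (verit) norm_diff_ineq)
  then show "norm p \<le> norm (p + q) + e" using d by (simp add: d_def t_def)
qed

lemma cstar_pos_mult_commuting:
  fixes a b :: "'a::cstar_algebra"
  assumes a: "cstar_pos a" and b: "cstar_pos b" and ab: "a * b = b * a"
  shows "cstar_pos (a * b)"
proof (rule cstar_pos_limit)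
  show "((\<lambda>e. (a + of_real e) * (b + of_real e)) \<longlongrightarrow> a * b) (at_right 0)"
    by (rule tendsto_eq_intros refl | simp)+
  have "cstar_pos ((a + of_real e) * (b + of_real e))" if e: "e > 0" for e
  proof -
    obtain k where k: "star k = k" "k * k = a + of_real e" "\<And>y. y * a = a * y \<Longrightarrow> y * k = k * y"
      using cstar_pos_sqrt[OF a e] by blast
    obtain l where l: "star l = l" "l * l = b + of_real e" "\<And>y. y * b = b * y \<Longrightarrow> y * l = l * y"
      using cstar_pos_sqrt[OF b e] by blast
    have lk: "l * k = k * l" using k(3)[of l] l(3)[of a] ab by metis
    then have "star (k * l) = k * l" by (simp add: star_mult k(1) l(1))
    from cstar_pos_square[OF this] have "cstar_pos ((k * l) * (k * l))" .
    also have "(k * l) * (k * l) = (k * k) * (l * l)" using lk by (metis mult.assoc)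
    finally show ?thesis by (simp add: k(2) l(2))
  qed
  then show "\<forall>\<^sub>F e in at_right 0. cstar_pos ((a + of_real e) * (b + of_real e))"
    by (auto intro: eventually_mono[OF eventually_at_right_less])
qed simp

text \<open>
  The key step of Kaplansky's theorem in a quantitative form: \<open>- star x * x\<close> cannot be positive unless
  \<open>x = 0\<close>. Put \<open>n = - star x * x\<close>, \<open>p = x * star x\<close> and \<open>s = (norm x)\<^sup>2\<close>. Since \<open>p - n\<close> is a sum of
  two squares, almost positivity passes from \<open>n\<close> to \<open>p\<close>, hence \<open>norm (s - p) \<le> s + d\<close>. Conjugation by
  \<open>x\<close> turns \<open>s - p\<close> into \<open>- (s n + n * n)\<close>, whose norm is therefore at most \<open>s (s + d)\<close>; but \<open>s n\<close>
  dominates \<open>n * n\<close> up to terms of order \<open>d\<close>, so that this norm is at least about \<open>2 s\<^sup>2\<close>.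
\<close>

lemma norm_le_if_minus_square_almost_pos:
  fixes x :: "'a::cstar_algebra"
  assumes "0 \<le> d" and pos: "cstar_pos (of_real d - star x * x)"
  shows "(norm x)\<^sup>2 \<le> 3 * d"
proof (cases "x = 0")
  case False
  define s where "s = (norm x)\<^sup>2"
  define n where "n = - (star x * x)"
  define p where "p = x * star x"
  define u where "u = (1/2) *\<^sub>R (x + star x)"
  define v where "v = scaleC (1/2) (scaleC \<i> (star x - x))"
  have s: "s > 0" using False by (simp add: s_def)
  have [simp]: "star n = n" "star p = p" "norm n = s" "norm p = s"
    using cstar_identity[of x] cstar_identity[of "star x"]
    by (auto simp: n_def p_def s_def star_minus star_mult star_star)
  have "scaleC (1/2) x = (1/2) *\<^sub>R x" for x :: 'a
    using scaleC_of_real[of "1/2" x] by simp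
  then have v: "v = (1/2) *\<^sub>R scaleC \<i> (star x - x)" by (simp add: v_def)
  have "star u = u" by (simp add: u_def star_scaleR star_add star_star add.commute)
  have "star v = (1/2) *\<^sub>R scaleC (-1) (scaleC \<i> (x - star x))"
    by (simp add: v star_scaleR star_scaleC star_diff star_star scaleC_scaleC)
  also have "scaleC (-1) (scaleC \<i> (x - star x)) = scaleC \<i> (scaleC (-1) (x - star x))"
    by (simp add: scaleC_scaleC)
  also have "scaleC (-1) (x - star x) = star x - x" by (simp add: scaleC_minus_one)
  finally have "star v = v" by (simp add: v)
  have "v * v = (1/4) *\<^sub>R scaleC (-1) ((star x - x) * (star x - x))"
  proof -
    have "v * v = (1/2) *\<^sub>R (1/2) *\<^sub>R scaleC (\<i> * \<i>) ((star x - x) * (star x - x))"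
      by (simp only: v mult_scaleR_left mult_scaleR_right mult_scaleC_left mult_scaleC_right scaleC_scaleC scaleC_scaleR)
    then show ?thesis by simp
  qed
  then have vv: "v * v = (1/4) *\<^sub>R (- ((star x - x) * (star x - x)))" by (simp add: scaleC_minus_one)
  have uu: "u * u = (1/4) *\<^sub>R ((x + star x) * (x + star x))" by (simp add: u_def)
  have "u * u + v * v = (1/4) *\<^sub>R (2 *\<^sub>R (p - n))"
    unfolding vv uu scaleR_add_right[symmetric] by (simp add: p_def n_def algebra_simps scaleR_2)
  then have p: "p = 2 *\<^sub>R (u * u) + 2 *\<^sub>R (v * v) + n"
    by (simp add: scaleR_add_right[symmetric])
  have npos: "cstar_pos (n + of_real d)" using pos by (simp add: n_def)
  have "cstar_pos (2 *\<^sub>R (u * u) + 2 *\<^sub>R (v * v) + (n + of_real d))"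
    by (intro cstar_pos_add cstar_pos_scaleR cstar_pos_square npos \<open>star u = u\<close> \<open>star v = v\<close>) auto
  then have ppos: "cstar_pos (p + of_real d)" by (simp add: p add.assoc)
  have "norm (of_real (s + d) - (p + of_real d)) \<le> s + d"
    using norm_triangle_ineq[of p "of_real d"] \<open>0 \<le> d\<close> by (intro cstar_pos_norm_le ppos) simp
  then have sp: "norm (of_real s - p) \<le> s + d" by simp
  have "star x * (of_real s - p) * x = - (s *\<^sub>R n + n * n)"
    by (simp add: p_def n_def algebra_simps of_real_def)
  then have "norm (s *\<^sub>R n + n * n) = norm (star x * (of_real s - p) * x)"
    by (metis norm_minus_cancel)
  also have "\<dots> \<le> norm (star x * (of_real s - p)) * norm x" by (rule norm_mult_ineq)
  also have "\<dots> \<le> (norm (star x) * norm (of_real s - p)) * norm x"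
    by (intro mult_right_mono norm_mult_ineq) auto
  also have "\<dots> = s * norm (of_real s - p)" by (simp add: s_def power2_eq_square)
  also have "\<dots> \<le> s * (s + d)" using sp s by (intro mult_left_mono) auto
  finally have 1: "norm (s *\<^sub>R n + n * n) \<le> s * (s + d)" .
  have "cstar_pos ((n + of_real d) * (of_real s - n))"
    by (intro cstar_pos_mult_commuting npos cstar_pos_norm_diff)
      (auto simp: algebra_simps of_real_def)
  moreover have "cstar_pos (2 *\<^sub>R (n * n))" by (intro cstar_pos_scaleR cstar_pos_square) auto
  ultimately have "norm (2 *\<^sub>R (n * n)) \<le> norm (2 *\<^sub>R (n * n) + (n + of_real d) * (of_real s - n))"
    by (intro norm_le_norm_add_pos)
  also have "2 *\<^sub>R (n * n) + (n + of_real d) * (of_real s - n) = (s *\<^sub>R n + n * n) + d *\<^sub>R (of_real s - n)"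
    by (simp add: algebra_simps of_real_def scaleR_2)
  also have "norm \<dots> \<le> s * (s + d) + d * (s + s)"
    using \<open>0 \<le> d\<close> s norm_triangle_ineq4[of "of_real s" n]
    by (intro order.trans[OF norm_triangle_ineq] add_mono 1) (auto intro: mult_left_mono)
  finally have "2 * (s * s) \<le> s * (s + d) + d * (s + s)"
    by (simp add: norm_square_selfadjoint power2_eq_square)
  then have "s * s \<le> s * (3 * d)" by (simp add: algebra_simps)
  with s have "s \<le> 3 * d" by simp
  then show ?thesis by (simp add: s_def)
qed (use assms in simp)

lemma norm_power_two_power_selfadjoint:
  "star h = h \<Longrightarrow> norm (h ^ (2 ^ m)) = norm (h::'a::cstar_algebra) ^ (2 ^ m)"
proof (induction m)
  case (Suc m)
  then have "norm (h ^ (2 ^ m) * h ^ (2 ^ m)) = (norm (h ^ (2 ^ m)))\<^sup>2"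
    by (intro norm_square_selfadjoint) (simp add: star_power)
  then show ?case using Suc by (simp add: mult_2 power_add power2_eq_square)
qed simp

text \<open>
  Powers take the place of the usual decomposition into a positive and a negative part. For
  \<open>norm x < 1\<close> write \<open>\<tau> = 1 - star x * x = c * c\<close>. The polynomial inequality
  \<open>(k + 1) (\<tau> ^ k - \<tau> ^ (k + 1)) \<le> 1\<close> says that \<open>y = sqrt (k + 1) x c ^ k\<close> satisfies
  \<open>star y * y \<le> 1\<close>, and then the preceding lemma bounds the norm of \<open>\<tau> ^ k - \<tau> ^ (k + 1)\<close> by
  \<open>3 / (k + 1)\<close>. For large \<open>k\<close> this is impossible if \<open>norm \<tau> > 1\<close>.
\<close>

theorem cstar_pos_star_mult_self: "cstar_pos (star x * (x::'a::cstar_algebra))"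
proof -
  have main: "cstar_pos (star x * x)" if x: "norm x < 1" for x :: 'a
  proof -
    define h where "h = star x * x"
    have h: "star h = h" "norm h < 1"
      using x by (auto simp: h_def star_mult star_star cstar_identity power_less_one_iff)
    obtain c where c: "star c = c" "c * c = 1 - h"
      using sqrt_one_minus[OF h] by blast
    define \<tau> where "\<tau> = c * c"
    have \<tau>: "star \<tau> = \<tau>" by (simp add: \<tau>_def star_mult c(1))
    have ck: "c ^ k * c ^ k = \<tau> ^ k" for k
      by (simp add: \<tau>_def power_add[symmetric] mult_2[symmetric] power_mult power2_eq_square)
    have pk: "cstar_pos (\<tau> ^ k)" for k
      using cstar_pos_square[of "c ^ k"] by (simp add: ck star_power c(1))
    have cc: "c ^ k * \<tau> = \<tau> * c ^ k" for k
      unfolding \<tau>_def by (metis power_add power2_eq_square add.commute)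
    \<comment> \<open>The weighted inequality between arithmetic and geometric mean, \<open>(k + 1) \<tau> ^ k \<le> 1 + k \<tau> ^ (k + 1)\<close>: the
      difference of consecutive cases is \<open>(k + 1) \<tau> ^ k (1 - \<tau>)\<^sup>2\<close>.\<close>
    have R: "cstar_pos (1 - real (Suc k) *\<^sub>R \<tau> ^ k + real k *\<^sub>R \<tau> ^ Suc k)" for k
    proof (induction k)
      case (Suc k)
      note cc = cc[of k]
      have "star (c ^ k * (1 - \<tau>)) = c ^ k * (1 - \<tau>)"
        using cc by (simp add: star_mult star_diff star_power c(1) \<tau> algebra_simps)
      from cstar_pos_square[OF this]
      have "cstar_pos (c ^ k * (1 - \<tau>) * (c ^ k * (1 - \<tau>)))" .
      also have "c ^ k * (1 - \<tau>) * (c ^ k * (1 - \<tau>)) = (c ^ k * c ^ k) * ((1 - \<tau>) * (1 - \<tau>))"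
        using cc by (simp add: algebra_simps) (metis mult.assoc)
      also have "\<dots> = \<tau> ^ k - 2 *\<^sub>R \<tau> ^ Suc k + \<tau> ^ Suc (Suc k)"
        unfolding ck by (simp add: algebra_simps scaleR_2 power_commutes) (metis mult.assoc power_commutes)
      finally have "cstar_pos (real (Suc k) *\<^sub>R (\<tau> ^ k - 2 *\<^sub>R \<tau> ^ Suc k + \<tau> ^ Suc (Suc k)))"
        by (intro cstar_pos_scaleR) auto
      moreover have "(1 - real (Suc k) *\<^sub>R a + real k *\<^sub>R b) + real (Suc k) *\<^sub>R (a - 2 *\<^sub>R b + d) =
          1 - real (Suc (Suc k)) *\<^sub>R b + real (Suc k) *\<^sub>R d" for a b d :: 'a
        by (simp add: algebra_simps scaleR_2)
      ultimately show ?case using cstar_pos_add[OF Suc] by metis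
    qed simp
    have bound: "real (Suc k) * norm (\<tau> ^ k - \<tau> ^ Suc k) \<le> 3" for k
    proof -
      define y where "y = sqrt (real (Suc k)) *\<^sub>R (x * c ^ k)"
      have yy: "star y * y = real (Suc k) *\<^sub>R (\<tau> ^ k - \<tau> ^ Suc k)"
      proof -
        have "star y * y = real (Suc k) *\<^sub>R (c ^ k * h * c ^ k)"
          by (simp add: y_def star_scaleR star_mult star_power c(1) h_def mult.assoc)
        also have "c ^ k * h * c ^ k = c ^ k * c ^ k - c ^ k * \<tau> * c ^ k"
          unfolding \<tau>_def c(2) by (simp add: algebra_simps)
        also have "c ^ k * \<tau> * c ^ k = \<tau> ^ Suc k"
          unfolding cc by (simp add: mult.assoc ck)
        finally show ?thesis by (simp add: ck)
      qed
      have "of_real 1 - star y * y = (1 - real (Suc k) *\<^sub>R \<tau> ^ k + real k *\<^sub>R \<tau> ^ Suc k) + \<tau> ^ Suc k"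
        unfolding yy by (simp add: algebra_simps)
      then have "cstar_pos (of_real 1 - star y * y)"
        using cstar_pos_add[OF R pk] by metis
      then have "norm (star y * y) \<le> 3"
        using norm_le_if_minus_square_almost_pos[of 1 y] by (simp add: cstar_identity)
      then show ?thesis by (simp add: yy)
    qed
    have "norm \<tau> \<le> 1"
    proof (rule ccontr)
      assume "\<not> norm \<tau> \<le> 1"
      then have T: "norm \<tau> > 1" by simp
      define T where "T = norm \<tau>"
      obtain m where m: "3 / (T - 1) < real (2 ^ m)"
        using real_arch_pow[of 2 "3 / (T - 1)"] by auto
      \<comment> \<open>For exponents that are powers of two the norm of the power is the power of the norm.\<close>
      define k where "k = (2::nat) ^ m - 1"
      have k: "Suc k = 2 ^ m" by (simp add: k_def)
      have "T ^ Suc k = norm (\<tau> ^ Suc k)"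
        unfolding k T_def by (simp add: norm_power_two_power_selfadjoint[OF \<tau>])
      also have "\<dots> \<le> norm (\<tau> ^ k) + norm (\<tau> ^ k - \<tau> ^ Suc k)"
        by (smt (verit) norm_triangle_ineq4 norm_minus_commute norm_triangle_sub)
      also have "norm (\<tau> ^ k) \<le> T ^ k" by (simp add: T_def norm_power_ineq)
      finally have "T ^ k * (T - 1) \<le> norm (\<tau> ^ k - \<tau> ^ Suc k)" by (simp add: algebra_simps)
      moreover have "1 * (T - 1) \<le> T ^ k * (T - 1)"
        using T by (intro mult_right_mono) (auto simp: T_def)
      ultimately have "real (Suc k) * (T - 1) \<le> real (Suc k) * norm (\<tau> ^ k - \<tau> ^ Suc k)"
        by (intro mult_left_mono) auto
      also have "\<dots> \<le> 3" by (rule bound)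
      finally show False using m T unfolding k by (simp add: T_def field_simps)
    qed
    then have "norm (of_real 1 - h) \<le> 1" using c(2) by (simp add: \<tau>_def)
    then show ?thesis using h by (auto simp: cstar_pos_def h_def intro!: exI[of _ 1])
  qed
  define r where "r = 1 / (norm x + 1)"
  have r: "r > 0" by (simp add: r_def add_nonneg_pos)
  have "norm (r *\<^sub>R x) < 1" by (simp add: r_def add_nonneg_pos)
  from main[OF this] have "cstar_pos ((r * r) *\<^sub>R (star x * x))"
    by (simp add: star_scaleR)
  from cstar_pos_scaleR[OF _ this, of "1 / (r * r)"] show ?thesis using r by simp
qed

lemma cstar_pos_conjugate:
  fixes a p :: "'a::cstar_algebra"
  assumes "cstar_pos p"
  shows "cstar_pos (star a * p * a)"
proof (rule cstar_pos_if_pos_plus_eps)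
  fix e :: real assume "e > 0"
  then obtain k where k: "star k = k" "k * k = p + of_real e"
    using cstar_pos_sqrt[OF assms] by blast
  have "star (k * a) * (k * a) = star a * (k * k) * a" by (simp add: star_mult k(1) mult.assoc)
  also have "\<dots> = star a * p * a + e *\<^sub>R (star a * a)"
    by (simp add: k(2) algebra_simps of_real_def)
  finally show "cstar_pos (star a * p * a + e *\<^sub>R (star a * a))"
    using cstar_pos_star_mult_self[of "k * a"] by simp
qed

section \<open>The standard module as a Banach space\<close>

text \<open>
  The Cauchy--Schwarz inequality for columns with entries in the algebra. For \<open>s \<ge> norm A\<close> the sum of
  the \<open>star z * z\<close> with \<open>z = x i * C - s y i\<close> is positive, and in its expansion \<open>star C * A * C\<close> is
  dominated by \<open>s star C * C\<close>. What remains is \<open>s star C * C \<le> s\<^sup>2 B\<close>.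
\<close>

lemma norm_sum_star_mult_squared_le:
  fixes x y :: "'i \<Rightarrow> 'a::cstar_algebra"
  shows "(norm (\<Sum>i\<in>I. star (x i) * y i))\<^sup>2
    \<le> norm (\<Sum>i\<in>I. star (x i) * x i) * norm (\<Sum>i\<in>I. star (y i) * y i)"
proof -
  define A B C where "A = (\<Sum>i\<in>I. star (x i) * x i)" and "B = (\<Sum>i\<in>I. star (y i) * y i)"
    and "C = (\<Sum>i\<in>I. star (x i) * y i)"
  have sA: "star A = A" by (simp add: A_def star_sum star_mult star_star)
  have sC: "(\<Sum>i\<in>I. star (y i) * x i) = star C" by (simp add: C_def star_sum star_mult star_star)
  have le: "(norm C)\<^sup>2 \<le> s * norm B" if s: "s > 0" "norm A \<le> s" for s
  proof -
    have "(\<Sum>i\<in>I. star (x i * C - s *\<^sub>R y i) * (x i * C - s *\<^sub>R y i))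
        = star C * A * C - s *\<^sub>R (star C * C) - s *\<^sub>R (star C * C) + (s * s) *\<^sub>R B"
    proof -
      have "star (x i * C - s *\<^sub>R y i) * (x i * C - s *\<^sub>R y i)
        = star C * (star (x i) * x i) * C - s *\<^sub>R (star C * (star (x i) * y i))
          - s *\<^sub>R ((star (y i) * x i) * C) + (s * s) *\<^sub>R (star (y i) * y i)" for i
        by (simp add: star_diff star_mult star_scaleR algebra_simps)
      then show ?thesis
        by (simp add: sum.distrib sum_subtractf sum_distrib_left[symmetric] sum_distrib_right[symmetric]
            scaleR_sum_right[symmetric] sC A_def[symmetric] B_def[symmetric] C_def[symmetric])
    qed
    moreover have "cstar_pos (\<Sum>i\<in>I. star (x i * C - s *\<^sub>R y i) * (x i * C - s *\<^sub>R y i))"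
      by (intro cstar_pos_sum cstar_pos_star_mult_self)
    moreover have "cstar_pos (star C * (of_real s - A) * C)"
      by (intro cstar_pos_conjugate cstar_pos_norm_diff sA s)
    moreover have "star C * (of_real s - A) * C = s *\<^sub>R (star C * C) - star C * A * C"
      by (simp add: algebra_simps of_real_def)
    ultimately have "cstar_pos ((star C * A * C - s *\<^sub>R (star C * C) - s *\<^sub>R (star C * C) + (s * s) *\<^sub>R B)
        + (s *\<^sub>R (star C * C) - star C * A * C))"
      using cstar_pos_add by metis
    then have "cstar_pos ((s * s) *\<^sub>R B - s *\<^sub>R (star C * C))" by (simp add: algebra_simps)
    moreover have "cstar_pos (s *\<^sub>R (star C * C))"
      using s by (intro cstar_pos_scaleR cstar_pos_star_mult_self) auto
    ultimately have "norm (s *\<^sub>R (star C * C)) \<le> norm (s *\<^sub>R (star C * C) + ((s * s) *\<^sub>R B - s *\<^sub>R (star C * C)))"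
      by (intro norm_le_norm_add_pos)
    then have "s * (norm C)\<^sup>2 \<le> s * (s * norm B)" using s by (simp add: cstar_identity)
    then show ?thesis using s by simp
  qed
  have "(norm C)\<^sup>2 \<le> norm A * norm B"
  proof (rule tendsto_lowerbound)
    show "((\<lambda>e. (norm A + e) * norm B) \<longlongrightarrow> norm A * norm B) (at_right 0)"
      by (rule tendsto_eq_intros refl | simp)+
    show "\<forall>\<^sub>F e in at_right 0. (norm C)\<^sup>2 \<le> (norm A + e) * norm B"
      by (rule eventually_mono[OF eventually_at_right_less]) (rule le, auto simp: add_nonneg_pos)
  qed simp
  then show ?thesis by (simp add: A_def B_def C_def)
qed

text \<open>
  The seminorm of a block of coordinates. Membership in \<open>HA\<close> is the convergence of a series, hence a
  Cauchy condition on such blocks.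
\<close>

definition col_norm :: "nat set \<Rightarrow> (nat \<Rightarrow> 'a::cstar_algebra) \<Rightarrow> real"
  where "col_norm I x = sqrt (norm (\<Sum>i\<in>I. star (x i) * x i))"

lemma col_norm_nonneg [simp]: "0 \<le> col_norm I x"
  by (simp add: col_norm_def)

lemma col_norm_squared: "(col_norm I x)\<^sup>2 = norm (\<Sum>i\<in>I. star (x i) * x i)"
  by (simp add: col_norm_def)

lemma norm_sum_star_mult_le: "norm (\<Sum>i\<in>I. star (x i) * y i) \<le> col_norm I x * col_norm I y"
  by (rule power2_le_imp_le)
    (auto simp: power_mult_distrib col_norm_squared norm_sum_star_mult_squared_le)

lemma col_norm_add: "col_norm I (x + y) \<le> col_norm I x + col_norm I y"
proof (rule power2_le_imp_le)
  have "(\<Sum>i\<in>I. star ((x + y) i) * (x + y) i) = (\<Sum>i\<in>I. star (x i) * x i) + (\<Sum>i\<in>I. star (x i) * y i)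
     + (\<Sum>i\<in>I. star (y i) * x i) + (\<Sum>i\<in>I. star (y i) * y i)"
    by (simp add: star_add algebra_simps sum.distrib)
  then have "(col_norm I (x + y))\<^sup>2 \<le> (col_norm I x)\<^sup>2 + norm (\<Sum>i\<in>I. star (x i) * y i)
     + norm (\<Sum>i\<in>I. star (y i) * x i) + (col_norm I y)\<^sup>2"
    unfolding col_norm_squared by (simp only:) (intro order.trans[OF norm_triangle_ineq] add_mono order.refl)
  also have "\<dots> \<le> (col_norm I x)\<^sup>2 + col_norm I x * col_norm I y
     + col_norm I y * col_norm I x + (col_norm I y)\<^sup>2"
    by (intro add_mono norm_sum_star_mult_le order.refl)
  finally have "(col_norm I (x + y))\<^sup>2 \<le> (col_norm I x)\<^sup>2 + col_norm I x * col_norm I y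
     + col_norm I y * col_norm I x + (col_norm I y)\<^sup>2" .
  then show "(col_norm I (x + y))\<^sup>2 \<le> (col_norm I x + col_norm I y)\<^sup>2"
    by (simp add: power2_eq_square algebra_simps)
qed simp

lemma col_norm_minus_commute: "col_norm I (x - y) = col_norm I (y - x)"
proof -
  have "star (x i - y i) * (x i - y i) = star (y i - x i) * (y i - x i)" for i
    by (simp add: star_diff algebra_simps)
  then show ?thesis by (simp add: col_norm_def)
qed

lemma col_norm_mono: "finite J \<Longrightarrow> I \<subseteq> J \<Longrightarrow> col_norm I x \<le> col_norm J x"
proof -
  assume J: "finite J" "I \<subseteq> J"
  have "cstar_pos (\<Sum>i\<in>I. star (x i) * x i)" "cstar_pos (\<Sum>i\<in>J - I. star (x i) * x i)"
    by (auto intro!: cstar_pos_sum cstar_pos_star_mult_self)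
  from norm_le_norm_add_pos[OF this] show ?thesis
    using sum.subset_diff[OF J(2,1), of "\<lambda>i. star (x i) * x i"] by (simp add: col_norm_def add.commute)
qed

lemma col_norm_singleton: "col_norm {i} x = norm (x i)"
  by (simp add: col_norm_def cstar_identity)

lemma col_norm_ract: "col_norm I (ract x a) \<le> col_norm I x * norm a"
proof (rule power2_le_imp_le)
  have "(\<Sum>i\<in>I. star (ract x a i) * ract x a i) = star a * (\<Sum>i\<in>I. star (x i) * x i) * a"
    by (simp add: ract_def star_mult mult.assoc sum_distrib_left sum_distrib_right)
  then have "(col_norm I (ract x a))\<^sup>2 \<le> norm (star a) * norm (\<Sum>i\<in>I. star (x i) * x i) * norm a"
    unfolding col_norm_squared
    by (auto intro!: order.trans[OF norm_mult_ineq] mult_right_mono norm_mult_ineq)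
  then show "(col_norm I (ract x a))\<^sup>2 \<le> (col_norm I x * norm a)\<^sup>2"
    by (simp add: power_mult_distrib col_norm_squared) (simp add: power2_eq_square mult_ac)
qed simp

lemma HA_iff_col_norm:
  "x \<in> HA \<longleftrightarrow> (\<forall>e>0. \<exists>N. \<forall>m\<ge>N. \<forall>n. col_norm {m..<n} x < e)"
proof -
  have "summable (\<lambda>i. star (x i) * x i) \<longleftrightarrow>
      (\<forall>e>0. \<exists>N. \<forall>m\<ge>N. \<forall>n. (col_norm {m..<n} x)\<^sup>2 < e)"
    by (simp add: summable_Cauchy col_norm_squared)
  also have "\<dots> \<longleftrightarrow> (\<forall>e>0. \<exists>N. \<forall>m\<ge>N. \<forall>n. col_norm {m..<n} x < e)"
  proof safe
    fix e :: real assume *: "\<forall>e>0. \<exists>N. \<forall>m\<ge>N. \<forall>n. (col_norm {m..<n} x)\<^sup>2 < e" "e > 0"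
    then have "\<exists>N. \<forall>m\<ge>N. \<forall>n. (col_norm {m..<n} x)\<^sup>2 < e\<^sup>2" by simp
    then show "\<exists>N. \<forall>m\<ge>N. \<forall>n. col_norm {m..<n} x < e"
      using \<open>e > 0\<close> by (meson less_imp_le power2_less_imp_less)
  next
    fix e :: real assume *: "\<forall>e>0. \<exists>N. \<forall>m\<ge>N. \<forall>n. col_norm {m..<n} x < e" "e > 0"
    then have "\<exists>N. \<forall>m\<ge>N. \<forall>n. col_norm {m..<n} x < sqrt e" by simp
    moreover have "(col_norm {m..<n} x)\<^sup>2 < e" if "col_norm {m..<n} x < sqrt e" for m n
      using that \<open>e > 0\<close> by (metis col_norm_nonneg real_less_rsqrt real_sqrt_abs real_sqrt_less_iff abs_of_nonneg)
    ultimately show "\<exists>N. \<forall>m\<ge>N. \<forall>n. (col_norm {m..<n} x)\<^sup>2 < e" by meson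
  qed
  finally show ?thesis by (simp add: HA_def)
qed

lemma HA_add: "x \<in> HA \<Longrightarrow> y \<in> HA \<Longrightarrow> x + y \<in> HA"
  unfolding HA_iff_col_norm
proof safe
  fix e :: real
  assume *: "\<forall>e>0. \<exists>N. \<forall>m\<ge>N. \<forall>n. col_norm {m..<n} x < e" "\<forall>e>0. \<exists>N. \<forall>m\<ge>N. \<forall>n. col_norm {m..<n} y < e" "e > 0"
  then obtain N1 N2 where N: "\<And>m n. m \<ge> N1 \<Longrightarrow> col_norm {m..<n} x < e/2" "\<And>m n. m \<ge> N2 \<Longrightarrow> col_norm {m..<n} y < e/2"
    by (meson half_gt_zero)
  have "col_norm {m..<n} (x + y) < e" if "m \<ge> max N1 N2" for m n
    using N(1)[of m n] N(2)[of m n] that col_norm_add[of "{m..<n}" x y] by simp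
  then show "\<exists>N. \<forall>m\<ge>N. \<forall>n. col_norm {m..<n} (x + y) < e" by blast
qed

lemma HA_ract: "x \<in> HA \<Longrightarrow> ract x a \<in> HA"
  unfolding HA_def
proof safe
  assume "summable (\<lambda>i. star (x i) * x i)"
  then have "summable (\<lambda>i. star a * (star (x i) * x i) * a)"
    by (intro summable_mult summable_mult2)
  then show "summable (\<lambda>i. star (ract x a i) * ract x a i)"
    by (simp add: ract_def star_mult mult.assoc)
qed

lemma HA_zero [simp]: "0 \<in> HA"
  by (simp add: HA_def)

lemma ract_of_real: "ract x (of_real r) = (\<lambda>i. r *\<^sub>R x i)"
  by (simp add: ract_def of_real_def)

lemma ract_minus_one: "ract x (-1) = - x"
  by (simp add: ract_def fun_eq_iff)

lemma HA_uminus: "x \<in> HA \<Longrightarrow> - x \<in> HA"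
  using HA_ract[of x "-1"] by (simp add: ract_minus_one)

lemma HA_diff: "x \<in> HA \<Longrightarrow> y \<in> HA \<Longrightarrow> x - y \<in> HA"
  using HA_add[of x "- y"] HA_uminus[of y] by simp

lemma HA_if_finite_support:
  assumes "\<And>i. i \<ge> n \<Longrightarrow> x i = 0" shows "x \<in> HA"
proof -
  have "star (x i) * x i = 0" if "i \<notin> {..<n}" for i using assms[of i] that by simp
  then show ?thesis unfolding HA_def by (auto intro: summable_finite[of "{..<n}"])
qed

lemma col_norm_tendsto_hnorm:
  assumes "x \<in> HA" shows "(\<lambda>n. col_norm {..<n} x) \<longlonglongrightarrow> hnorm x"
proof -
  have "(\<lambda>n. \<Sum>i<n. star (x i) * x i) \<longlonglongrightarrow> hinner x x"
    using assms unfolding HA_def hinner_def by (auto intro: summable_LIMSEQ)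
  then show ?thesis unfolding col_norm_def hnorm_def by (intro tendsto_intros)
qed

lemma col_norm_le_hnorm:
  assumes "x \<in> HA" "finite I" shows "col_norm I x \<le> hnorm x"
proof -
  obtain N where N: "I \<subseteq> {..<N}" using finite_nat_bounded[OF assms(2)] by auto
  have "col_norm I x \<le> col_norm {..<n} x" if "n \<ge> N" for n
    using N that by (intro col_norm_mono) auto
  then show ?thesis
    by (intro tendsto_lowerbound[OF col_norm_tendsto_hnorm[OF assms(1)]])
      (auto simp: eventually_sequentially)
qed

lemma hnorm_le_iff:
  assumes "x \<in> HA" shows "hnorm x \<le> C \<longleftrightarrow> (\<forall>n. col_norm {..<n} x \<le> C)"
  using col_norm_le_hnorm[OF assms] tendsto_upperbound[OF col_norm_tendsto_hnorm[OF assms], of C]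
  by (auto intro: order.trans)

lemma hnorm_nonneg [simp]: "0 \<le> hnorm x"
  by (simp add: hnorm_def)

lemma hnorm_zero [simp]: "hnorm 0 = 0"
  by (simp add: hnorm_def hinner_def)

lemma hnorm_add: "x \<in> HA \<Longrightarrow> y \<in> HA \<Longrightarrow> hnorm (x + y) \<le> hnorm x + hnorm y"
  unfolding hnorm_le_iff[OF HA_add]
  by (meson add_mono col_norm_add col_norm_le_hnorm finite_lessThan order.trans)

lemma hnorm_ract: "x \<in> HA \<Longrightarrow> hnorm (ract x a) \<le> hnorm x * norm a"
  unfolding hnorm_le_iff[OF HA_ract]
  by (meson col_norm_ract col_norm_le_hnorm finite_lessThan order.trans mult_right_mono norm_ge_zero)

lemma norm_coord_le_hnorm: "x \<in> HA \<Longrightarrow> norm (x i) \<le> hnorm x"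
  using col_norm_le_hnorm[of x "{i}"] by (simp add: col_norm_singleton)

lemma hnorm_eq_zero_iff: "x \<in> HA \<Longrightarrow> hnorm x = 0 \<longleftrightarrow> x = 0"
proof
  assume "x \<in> HA" "hnorm x = 0"
  then have "norm (x i) \<le> 0" for i using norm_coord_le_hnorm[of x i] by simp
  then show "x = 0" by (simp add: fun_eq_iff)
qed simp

lemma hnorm_scaleR: "hnorm (\<lambda>i. r *\<^sub>R x i) = \<bar>r\<bar> * hnorm x" if "x \<in> HA"
proof -
  have "hinner (\<lambda>i. r *\<^sub>R x i) (\<lambda>i. r *\<^sub>R x i) = (\<Sum>i. (r * r) *\<^sub>R (star (x i) * x i))"
    by (simp add: hinner_def star_scaleR)
  also have "\<dots> = (r * r) *\<^sub>R hinner x x"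
    using that by (simp add: hinner_def HA_def suminf_scaleR_right)
  finally show ?thesis by (simp add: hnorm_def real_sqrt_mult)
qed

text \<open>
  With the carrier turned into a type, the notions of Banach spaces apply to it.
\<close>

typedef (overloaded) 'a std_module = "HA :: (nat \<Rightarrow> 'a::cstar_algebra) set"
  morphisms coords of_coords
  by (rule exI[of _ 0]) simp

lemma coords_HA [simp]: "coords x \<in> HA"
  by (rule coords)

lemma coords_eq_iff: "coords x = coords y \<longleftrightarrow> x = y"
  by (rule coords_inject)

instantiation std_module :: (cstar_algebra) real_normed_vector
begin

definition zero_std_module :: "'a std_module"
  where "0 = of_coords 0"
definition plus_std_module :: "'a std_module \<Rightarrow> 'a std_module \<Rightarrow> 'a std_module"
  where "x + y = of_coords (coords x + coords y)"
definition minus_std_module :: "'a std_module \<Rightarrow> 'a std_module \<Rightarrow> 'a std_module"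
  where "x - y = of_coords (coords x - coords y)"
definition uminus_std_module :: "'a std_module \<Rightarrow> 'a std_module"
  where "- x = of_coords (- coords x)"
definition scaleR_std_module :: "real \<Rightarrow> 'a std_module \<Rightarrow> 'a std_module"
  where "r *\<^sub>R x = of_coords (ract (coords x) (of_real r))"
definition norm_std_module :: "'a std_module \<Rightarrow> real"
  where "norm x = hnorm (coords x)"
definition sgn_std_module :: "'a std_module \<Rightarrow> 'a std_module"
  where "sgn x = scaleR (inverse (norm x)) (x :: 'a std_module)"
definition dist_std_module :: "'a std_module \<Rightarrow> 'a std_module \<Rightarrow> real"
  where "dist x y = norm (x - y :: 'a std_module)"
definition uniformity_std_module :: "('a std_module \<times> 'a std_module) filter"
  where "uniformity = (INF e\<in>{0 <..}. principal {(x, y). dist x (y :: 'a std_module) < e})"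
definition open_std_module :: "'a std_module set \<Rightarrow> bool"
  where "open U = (\<forall>x\<in>U. eventually (\<lambda>(x', y). x' = x \<longrightarrow> y \<in> U) (uniformity :: ('a std_module \<times> 'a std_module) filter))"

lemma coords_zero [simp]: "coords 0 = 0"
  by (simp add: zero_std_module_def of_coords_inverse)

lemma coords_add [simp]: "coords (x + y) = coords x + coords y"
  by (simp add: plus_std_module_def of_coords_inverse HA_add)

lemma coords_diff [simp]: "coords (x - y) = coords x - coords y"
  by (simp add: minus_std_module_def of_coords_inverse HA_diff)

lemma coords_uminus [simp]: "coords (- x) = - coords x"
  by (simp add: uminus_std_module_def of_coords_inverse HA_uminus)

lemma coords_scaleR [simp]: "coords (r *\<^sub>R x) = (\<lambda>i. r *\<^sub>R coords x i)"
  using HA_ract[of "coords x" "of_real r"]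
  by (simp add: scaleR_std_module_def of_coords_inverse ract_of_real)

instance
proof
  fix x y z :: "'a std_module" and r s :: real
  show "x + y + z = x + (y + z)" "x + y = y + x" "0 + x = x" "- x + x = 0" "x - y = x + - y"
    "scaleR r (x + y) = scaleR r x + scaleR r y" "scaleR (r + s) x = scaleR r x + scaleR s x"
    "scaleR r (scaleR s x) = scaleR (r * s) x" "scaleR 1 x = x"
    by (simp_all add: coords_eq_iff[symmetric] fun_eq_iff algebra_simps)
  show "dist x y = norm (x - y)" by (rule dist_std_module_def)
  show "sgn x = scaleR (inverse (norm x)) x" by (rule sgn_std_module_def)
  show "uniformity = (INF e\<in>{0 <..}. principal {(x, y). dist x (y :: 'a std_module) < e})"
    by (rule uniformity_std_module_def)
  show "open U = (\<forall>x\<in>U. \<forall>\<^sub>F (x', y) in uniformity. x' = x \<longrightarrow> y \<in> U)" for U :: "'a std_module set"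
    by (rule open_std_module_def)
  show "norm x = 0 \<longleftrightarrow> x = 0"
    by (simp add: norm_std_module_def hnorm_eq_zero_iff coords_eq_iff[symmetric])
  show "norm (x + y) \<le> norm x + norm y"
    by (simp add: norm_std_module_def hnorm_add)
  show "norm (scaleR r x) = \<bar>r\<bar> * norm x"
    by (simp add: norm_std_module_def hnorm_scaleR)
qed

end

text \<open>
  In a Cauchy sequence all coordinates converge, and estimates that hold for every finite block pass
  to the limit. They give both that the limit lies in \<open>HA\<close> and that it is a limit in norm.
\<close>

instance std_module :: (cstar_algebra) banach
proof
  fix X :: "nat \<Rightarrow> 'a std_module"
  assume X: "Cauchy X"
  have coord: "norm (coords x i) \<le> norm x" for x :: "'a std_module" and i
    by (simp add: norm_std_module_def norm_coord_le_hnorm)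
  have "Cauchy (\<lambda>n. coords (X n) i)" for i
    unfolding Cauchy_iff
  proof safe
    fix e :: real assume "e > 0"
    then obtain M where M: "\<And>m n. m \<ge> M \<Longrightarrow> n \<ge> M \<Longrightarrow> norm (X m - X n) < e"
      using X unfolding Cauchy_iff by blast
    have "norm (coords (X m) i - coords (X n) i) < e" if "m \<ge> M" "n \<ge> M" for m n
      using coord[of "X m - X n" i] M[OF that] by simp
    then show "\<exists>M. \<forall>m\<ge>M. \<forall>n\<ge>M. norm (coords (X m) i - coords (X n) i) < e" by blast
  qed
  then have "\<exists>x. \<forall>i. (\<lambda>n. coords (X n) i) \<longlonglongrightarrow> x i"
    by (meson Cauchy_convergent_iff convergent_def)
  then obtain x where x: "\<And>i. (\<lambda>n. coords (X n) i) \<longlonglongrightarrow> x i" by blast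
  have close: "\<exists>M. \<forall>m\<ge>M. \<forall>I. finite I \<longrightarrow> col_norm I (coords (X m) - x) \<le> e" if "e > 0" for e
  proof -
    obtain M where M: "\<And>m n. m \<ge> M \<Longrightarrow> n \<ge> M \<Longrightarrow> norm (X m - X n) < e"
      using X \<open>e > 0\<close> unfolding Cauchy_iff by blast
    have "col_norm I (coords (X m) - x) \<le> e" if m: "m \<ge> M" and I: "finite I" for m I
    proof (rule tendsto_upperbound)
      show "(\<lambda>n. col_norm I (coords (X m) - coords (X n))) \<longlonglongrightarrow> col_norm I (coords (X m) - x)"
        unfolding col_norm_def by (auto intro!: tendsto_intros x)
      have "col_norm I (coords (X m) - coords (X n)) \<le> e" if "n \<ge> M" for n
        using M[OF m that] col_norm_le_hnorm[OF coords_HA I, of "X m - X n"]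
        by (simp add: norm_std_module_def)
      then show "\<forall>\<^sub>F n in sequentially. col_norm I (coords (X m) - coords (X n)) \<le> e"
        by (auto simp: eventually_sequentially)
    qed simp
    then show ?thesis by blast
  qed
  have "x \<in> HA"
    unfolding HA_iff_col_norm
  proof safe
    fix e :: real assume e: "e > 0"
    then obtain m where m: "\<And>I. finite I \<Longrightarrow> col_norm I (coords (X m) - x) \<le> e/2"
      using close[of "e/2"] by auto
    obtain N where N: "\<And>k n. k \<ge> N \<Longrightarrow> col_norm {k..<n} (coords (X m)) < e/2"
      using coords_HA[of "X m"] e unfolding HA_iff_col_norm by (meson half_gt_zero)
    have "col_norm {k..<n} x < e" if "k \<ge> N" for k n
      using col_norm_add[of "{k..<n}" "x - coords (X m)" "coords (X m)"] m[of "{k..<n}"] N[OF that, of n]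
      by (simp add: col_norm_minus_commute[of _ x])
    then show "\<exists>N. \<forall>k\<ge>N. \<forall>n. col_norm {k..<n} x < e" by blast
  qed
  then have x': "coords (of_coords x) = x" by (simp add: of_coords_inverse)
  have "X \<longlonglongrightarrow> of_coords x"
  proof (rule LIMSEQ_I)
    fix e :: real assume e: "e > 0"
    then obtain M where M: "\<And>m I. m \<ge> M \<Longrightarrow> finite I \<Longrightarrow> col_norm I (coords (X m) - x) \<le> e/2"
      using close[of "e/2"] by auto
    have "norm (X m - of_coords x) \<le> e/2" if "m \<ge> M" for m
      unfolding norm_std_module_def coords_diff x' hnorm_le_iff[OF HA_diff[OF coords_HA \<open>x \<in> HA\<close>]]
      using M[OF that] by blast
    then show "\<exists>no. \<forall>n\<ge>no. norm (X n - of_coords x) < e"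
      using e by (intro exI[of _ M]) fastforce
  qed
  then show "convergent X" by (auto simp: convergent_def)
qed

definition act :: "'a::cstar_algebra std_module \<Rightarrow> 'a \<Rightarrow> 'a std_module"
  where "act x a = of_coords (ract (coords x) a)"

lemma coords_act [simp]: "coords (act x a) = ract (coords x) a"
  by (simp add: act_def of_coords_inverse HA_ract)

lemma norm_act_le: "norm (act x a) \<le> norm x * norm a"
  by (simp add: norm_std_module_def hnorm_ract)

lemma ract_add_left: "ract (x + y) a = ract x a + ract y a"
  by (simp add: ract_def fun_eq_iff algebra_simps)

lemma ract_diff_left: "ract (x - y) a = ract x a - ract y (a::'a::cstar_algebra)"
  by (simp add: ract_def fun_eq_iff algebra_simps)

lemma ract_zero_left [simp]: "ract 0 a = 0"
  by (simp add: ract_def fun_eq_iff)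

lemma ract_ract: "ract (ract x a) b = ract x (a * b)"
  by (simp add: ract_def fun_eq_iff algebra_simps)

lemma act_add: "act (x + y) a = act x a + act y a"
  by (simp add: coords_eq_iff[symmetric] ract_add_left)

lemma act_diff: "act (x - y) a = act x a - act y a"
  by (simp add: coords_eq_iff[symmetric] ract_diff_left)

lemma act_zero [simp]: "act 0 a = 0"
  by (simp add: coords_eq_iff[symmetric])

lemma act_of_real: "act x (of_real r) = r *\<^sub>R x"
  by (simp add: coords_eq_iff[symmetric] ract_of_real)

section \<open>The open mapping theorem\<close>

text \<open>
  The Baire category step. The range is the union of the closures \<open>K n\<close> of the images of balls, so one
  of them has interior; by symmetry and scaling every \<open>z\<close> in the range is approximated, with error half
  its norm, by the image of a vector of size comparable to \<open>z\<close>.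
\<close>

lemma image_ball_approximates:
  fixes T :: "'x::banach \<Rightarrow> 'y::banach"
  assumes T: "bounded_linear T" and S: "subspace S" and cl: "closed (T ` S)"
  obtains c where "0 \<le> c" "\<And>z. z \<in> T ` S \<Longrightarrow> \<exists>x\<in>S. norm x \<le> c * norm z \<and> norm (z - T x) \<le> norm z / 2"
proof -
  interpret T: bounded_linear T by fact
  define R where "R = T ` S"
  have R: "subspace R" unfolding R_def by (rule linear_subspace_image[OF T.linear_axioms S])
  define K where "K n = closure (T ` (S \<inter> cball 0 (real n)))" for n
  have KR: "K n \<subseteq> R" for n
    unfolding K_def R_def using cl by (intro closure_minimal) auto
  have UK: "\<Union>(range K) = R"
  proof
    show "R \<subseteq> \<Union>(range K)"
    proof
      fix y assume "y \<in> R"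
      then obtain x where x: "x \<in> S" "y = T x" by (auto simp: R_def)
      obtain n where "norm x \<le> real n" using real_arch_simple by blast
      then have "y \<in> K n" using x unfolding K_def by (intro subsetD[OF closure_subset]) auto
      then show "y \<in> \<Union>(range K)" by blast
    qed
  qed (use KR in blast)
  have "\<exists>n. top_of_set R interior_of K n \<noteq> {}"
  proof (rule ccontr)
    assume "\<not> ?thesis"
    moreover have "closedin (top_of_set R) (K n)" for n
      using KR unfolding K_def by (intro closed_subset) auto
    moreover have "completely_metrizable_space (top_of_set R)"
      using cl unfolding R_def
      by (intro completely_metrizable_space_closedin completely_metrizable_space_euclidean) simp
    ultimately have "top_of_set R interior_of \<Union>(range K) = {}"
      by (intro Baire_category_alt) auto
    then have "R = {}" unfolding UK by (metis interior_of_topspace topspace_euclidean_subtopology)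
    then show False using subspace_0[OF R] by blast
  qed
  then obtain n y0 where y0: "y0 \<in> top_of_set R interior_of K n" by blast
  then obtain U where U: "openin (top_of_set R) U" "y0 \<in> U" "U \<subseteq> K n"
    by (auto simp: interior_of_def)
  then obtain r where r: "r > 0" "\<And>y. y \<in> R \<Longrightarrow> dist y y0 < r \<Longrightarrow> y \<in> K n"
    unfolding openin_euclidean_subtopology_iff by blast
  have y0R: "y0 \<in> R" using U KR by blast
  \<comment> \<open>A small \<open>z\<close> is the difference of \<open>y0 + z\<close> and \<open>y0\<close>, both in \<open>K n\<close>; hence the factor 2.\<close>
  have dense: "\<exists>x\<in>S. norm x \<le> 2 * real n \<and> norm (z - T x) < e"
    if z: "z \<in> R" "norm z < r" and e: "e > 0" for z e
  proof -
    have "y0 + z \<in> K n" using z y0R R by (intro r(2)) (auto intro: subspace_add simp: dist_norm)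
    then obtain a where a: "a \<in> S" "norm a \<le> real n" "dist (T a) (y0 + z) < e/2"
      using e unfolding K_def closure_approachable by (auto dest!: spec[of _ "e/2"])
    have "y0 \<in> K n" using U by blast
    then obtain b where b: "b \<in> S" "norm b \<le> real n" "dist (T b) y0 < e/2"
      using e unfolding K_def closure_approachable by (auto dest!: spec[of _ "e/2"])
    have "z - T (a - b) = (T b - y0) - (T a - (y0 + z))" by (simp add: T.diff)
    then have "norm (z - T (a - b)) \<le> norm (T b - y0) + norm (T a - (y0 + z))"
      by (simp only: norm_triangle_ineq4)
    then have "norm (z - T (a - b)) < e" using a b by (simp add: dist_norm)
    moreover have "a - b \<in> S" using a b S by (intro subspace_diff)
    moreover have "norm (a - b) \<le> 2 * real n" using norm_triangle_ineq4[of a b] a b by simp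
    ultimately show ?thesis by blast
  qed
  show thesis
  proof (rule that[of "4 * real n / r"])
    fix z assume z: "z \<in> T ` S"
    show "\<exists>x\<in>S. norm x \<le> 4 * real n / r * norm z \<and> norm (z - T x) \<le> norm z / 2"
    proof (cases "z = 0")
      case True
      then show ?thesis using subspace_0[OF S] by (intro bexI[of _ 0]) (auto simp: T.zero)
    next
      case False
      define t where "t = 2 * norm z / r"
      have t: "t > 0" using False r by (simp add: t_def)
      have "norm ((1/t) *\<^sub>R z) < r" using False r by (simp add: t_def)
      moreover have "(1/t) *\<^sub>R z \<in> R" using z R by (auto simp: R_def[symmetric] intro: subspace_scale)
      ultimately obtain x where x: "x \<in> S" "norm x \<le> 2 * real n" "norm ((1/t) *\<^sub>R z - T x) < r/4"
        using dense[of "(1/t) *\<^sub>R z" "r/4"] r by auto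
      have "z - T (t *\<^sub>R x) = t *\<^sub>R ((1/t) *\<^sub>R z - T x)" using t by (simp add: T.scaleR scaleR_diff_right)
      then have "norm (z - T (t *\<^sub>R x)) = t * norm ((1/t) *\<^sub>R z - T x)" using t by simp
      also have "\<dots> \<le> t * (r/4)" using t x by (intro mult_left_mono) auto
      also have "\<dots> = norm z / 2" using r by (simp add: t_def)
      finally have "norm (z - T (t *\<^sub>R x)) \<le> norm z / 2" .

      have "norm (t *\<^sub>R x) \<le> t * (2 * real n)" using t x by (simp add: mult_left_mono)
      also have "t * (2 * real n) = 4 * real n / r * norm z" by (simp add: t_def)
      finally have "norm (t *\<^sub>R x) \<le> 4 * real n / r * norm z" .
      with \<open>norm (z - T (t *\<^sub>R x)) \<le> norm z / 2\<close> have
        "norm (z - T (t *\<^sub>R x)) \<le> norm z / 2 \<and> norm (t *\<^sub>R x) \<le> 4 * real n / r * norm z" by blast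
      moreover have "t *\<^sub>R x \<in> S" using x S by (intro subspace_scale)
      ultimately show ?thesis by blast
    qed
  qed (use r in auto)
qed

text \<open>
  The open mapping theorem for a map from a closed subspace onto a closed subspace. Repeated
  approximation leaves errors that halve in each step, so the corrections sum up to an exact
  preimage. It provides the boundedness of projections and of coefficients with respect to generators.
\<close>

theorem bounded_preimages:
  fixes T :: "'x::banach \<Rightarrow> 'y::banach"
  assumes T: "bounded_linear T" and S: "subspace S" "closed S" and cl: "closed (T ` S)"
  obtains C where "0 \<le> C" "\<And>y. y \<in> T ` S \<Longrightarrow> \<exists>x\<in>S. T x = y \<and> norm x \<le> C * norm y"
proof -
  interpret T: bounded_linear T by fact
  obtain c where c: "0 \<le> c"
    "\<And>z. z \<in> T ` S \<Longrightarrow> \<exists>x\<in>S. norm x \<le> c * norm z \<and> norm (z - T x) \<le> norm z / 2"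
    using image_ball_approximates[OF T S(1) cl] by blast
  then obtain f where f: "\<And>z. z \<in> T ` S \<Longrightarrow> f z \<in> S" "\<And>z. z \<in> T ` S \<Longrightarrow> norm (f z) \<le> c * norm z"
    "\<And>z. z \<in> T ` S \<Longrightarrow> norm (z - T (f z)) \<le> norm z / 2"
    by metis
  show thesis
  proof (rule that[of "2 * c"])
    fix y assume y: "y \<in> T ` S"
    define z where "z k = ((\<lambda>z. z - T (f z)) ^^ k) y" for k
    have zS: "z k \<in> T ` S" for k
    proof (induction k)
      case (Suc k)
      then have "z k - T (f (z k)) \<in> T ` S"
        by (intro subspace_diff[OF linear_subspace_image[OF T.linear_axioms S(1)]]) (auto intro: f)
      then show ?case by (simp add: z_def)
    qed (use y in \<open>simp add: z_def\<close>)
    have zb: "norm (z k) \<le> norm y * (1/2) ^ k" for k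
    proof (induction k)
      case (Suc k)
      have "norm (z (Suc k)) \<le> norm (z k) / 2" using f(3)[OF zS, of k] by (simp add: z_def)
      then show ?case using Suc by simp
    qed (simp add: z_def)
    have fb: "norm (f (z k)) \<le> c * norm y * (1/2) ^ k" for k
      using mult_left_mono[OF zb[of k] c(1)] f(2)[OF zS, of k] by (simp add: mult.assoc)
    have sg: "(\<lambda>k. c * norm y * (1/2) ^ k) sums (2 * (c * norm y))"
      using sums_mult[OF geometric_sums[of "1/2::real"], of "c * norm y"] by (simp add: mult.commute)
    have sm: "summable (\<lambda>k. norm (f (z k)))"
      by (rule summable_comparison_test'[OF sums_summable[OF sg], of 0]) (simp add: fb)
    define x where "x = (\<Sum>k. f (z k))"
    have xs: "(\<lambda>k. f (z k)) sums x"
      unfolding x_def using summable_norm_cancel[OF sm] by (rule summable_sums)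
    have "norm x \<le> (\<Sum>k. norm (f (z k)))" unfolding x_def by (rule summable_norm[OF sm])
    also have "\<dots> \<le> (\<Sum>k. c * norm y * (1/2) ^ k)"
      using fb sm sums_summable[OF sg] by (intro suminf_le) auto
    also have "\<dots> = 2 * c * norm y" using sg by (simp add: sums_iff)
    finally have 1: "norm x \<le> 2 * c * norm y" .
    have "(\<lambda>n. \<Sum>k<n. f (z k)) \<longlonglongrightarrow> x" using xs by (simp add: sums_def)
    moreover have "(\<Sum>k<n. f (z k)) \<in> S" for n by (intro subspace_sum[OF S(1)] f zS)
    ultimately have 2: "x \<in> S" 
      using closed_sequentially[OF S(2), of "\<lambda>n. \<Sum>k<n. f (z k)" x] by simp
    have "(\<lambda>k. T (f (z k))) sums T x" by (rule T.sums[OF xs])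
    moreover have "(\<lambda>k. T (f (z k))) sums y"
    proof -
      have "z \<longlonglongrightarrow> 0"
      proof (rule Lim_null_comparison[where g = "\<lambda>k. norm y * (1/2) ^ k"])
        show "(\<lambda>k. norm y * (1/2) ^ k) \<longlonglongrightarrow> 0"
          by (rule tendsto_mult_right_zero) (simp add: LIMSEQ_realpow_zero)
      qed (simp add: zb)
      from telescope_sums'[OF this] have "(\<lambda>k. z k - z (Suc k)) sums z 0" by simp
      moreover have "z k - z (Suc k) = T (f (z k))" for k by (simp add: z_def)
      moreover have "z 0 = y" by (simp add: z_def)
      ultimately show ?thesis by simp
    qed
    ultimately have "T x = y" by (rule sums_unique2)
    with 1 2 show "\<exists>x\<in>S. T x = y \<and> norm x \<le> 2 * c * norm y" by blast
  qed (use c in simp)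
qed

section \<open>Closed submodules and direct sums\<close>

definition module_map :: "('a::cstar_algebra std_module \<Rightarrow> 'a std_module) \<Rightarrow> bool"
  where "module_map T \<longleftrightarrow> bounded_linear T \<and> (\<forall>x a. T (act x a) = act (T x) a)"

text \<open>
  Real scalars act as multiples of the unit, so real linearity is a consequence of linearity over the
  algebra.
\<close>

lemma module_mapI:
  assumes "\<And>x y. T (x + y) = T x + T y" "\<And>x a. T (act x a) = act (T x) a"
    "\<And>x. norm (T x) \<le> C * norm x"
  shows "module_map T"
proof -
  have "T (r *\<^sub>R x) = r *\<^sub>R T x" for r x
    using assms(2)[of x "of_real r"] by (simp add: act_of_real)
  then have "bounded_linear T"
    using assms by (intro bounded_linear_intro[of T C]) (auto simp: mult.commute)
  then show ?thesis using assms(2) by (simp add: module_map_def)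
qed

lemma module_map_bounded_linear: "module_map T \<Longrightarrow> bounded_linear T"
  by (simp add: module_map_def)

lemma module_map_act: "module_map T \<Longrightarrow> T (act x a) = act (T x) a"
  by (simp add: module_map_def)

lemma module_map_simps:
  assumes "module_map T"
  shows "T 0 = 0" "T (x + y) = T x + T y" "T (x - y) = T x - T y" "T (- x) = - T x"
  using linear_simps[OF module_map_bounded_linear[OF assms]]
    linear_0[OF bounded_linear.linear[OF module_map_bounded_linear[OF assms]]]
    linear_neg[OF bounded_linear.linear[OF module_map_bounded_linear[OF assms]]] by auto

lemma module_map_bounded:
  assumes "module_map T" obtains C where "0 \<le> C" "\<And>x. norm (T x) \<le> C * norm x"
  using bounded_linear.nonneg_bounded[OF module_map_bounded_linear[OF assms]]
  by (metis mult.commute)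

lemma module_map_comp: "module_map S \<Longrightarrow> module_map T \<Longrightarrow> module_map (\<lambda>x. S (T x))"
  unfolding module_map_def by (auto intro: bounded_linear_compose)

lemma module_map_diff: "module_map S \<Longrightarrow> module_map T \<Longrightarrow> module_map (\<lambda>x. S x - T x)"
  unfolding module_map_def by (auto intro: bounded_linear_sub simp: act_diff)

lemma module_map_add: "module_map S \<Longrightarrow> module_map T \<Longrightarrow> module_map (\<lambda>x. S x + T x)"
  unfolding module_map_def by (auto intro: bounded_linear_add simp: act_add)

lemma module_map_ident: "module_map (\<lambda>x. x)"
  unfolding module_map_def by (auto intro: bounded_linear_ident)

text \<open>
  This and \<open>sub_sum\<close> below are \<open>closed_submodule\<close> and \<open>direct_sum\<close> for subsets of the type.
\<close>

definition closed_sub :: "'a::cstar_algebra std_module set \<Rightarrow> bool"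
  where "closed_sub S \<longleftrightarrow> closed S \<and> 0 \<in> S \<and> (\<forall>x\<in>S. \<forall>y\<in>S. x + y \<in> S) \<and> (\<forall>x\<in>S. \<forall>a. act x a \<in> S)"

lemma closed_sub_subspace: "closed_sub S \<Longrightarrow> subspace S"
  unfolding closed_sub_def subspace_def by (metis act_of_real)

lemma coords_image_inter: "coords ` A \<inter> coords ` B = coords ` (A \<inter> B)"
  by (auto simp: coords_eq_iff)

lemma inj_coords: "inj coords"
  by (simp add: inj_def coords_eq_iff)

lemma coords_image_eq_iff: "coords ` A = coords ` B \<longleftrightarrow> A = B"
  by (rule inj_image_eq_iff[OF inj_coords])

lemma coords_UNIV: "coords ` UNIV = HA"
  by (rule type_definition.Rep_range[OF type_definition_std_module])

lemma closed_submodule_coords: "closed_submodule (coords ` S) \<longleftrightarrow> closed_sub S"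
proof -
  have cl: "(\<forall>s x. (\<forall>n::nat. s n \<in> coords ` S) \<and> x \<in> HA \<and> (\<lambda>n. hnorm (s n - x)) \<longlonglongrightarrow> 0 \<longrightarrow> x \<in> coords ` S)
    \<longleftrightarrow> closed S" (is "?L \<longleftrightarrow> _")
  proof
    assume L: ?L
    show "closed S" unfolding closed_sequential_limits
    proof safe
      fix s x assume s: "\<forall>n::nat. s n \<in> S" "s \<longlonglongrightarrow> x"
      have "(\<lambda>n. hnorm (coords (s n) - coords x)) \<longlonglongrightarrow> 0"
        using tendsto_norm_zero[OF LIM_zero[OF s(2)]] by (simp add: norm_std_module_def)
      then have "coords x \<in> coords ` S" using spec[OF spec[OF L, where x = "\<lambda>n. coords (s n)"], where x = "coords x"] s(1) by auto
      then show "x \<in> S" by (auto simp: coords_eq_iff)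
    qed
  next
    assume S: "closed S"
    show ?L
    proof safe
      fix s x assume s: "\<forall>n::nat. s n \<in> coords ` S" "x \<in> HA" "(\<lambda>n. hnorm (s n - x)) \<longlonglongrightarrow> 0"
      define u where "u n = of_coords (s n)" for n
      have "u n \<in> S \<and> s n = coords (u n)" for n
      proof -
        have "s n \<in> coords ` S" using s(1) by blast
        then show ?thesis by (auto simp: u_def coords_inverse)
      qed
      then have u: "\<And>n. u n \<in> S" "\<And>n. s n = coords (u n)" by auto
      have x: "x = coords (of_coords x)" using s(2) by (simp add: of_coords_inverse)
      have "(\<lambda>n. norm (u n - of_coords x)) \<longlonglongrightarrow> 0"
        using s(3) x[symmetric] by (simp add: u norm_std_module_def)
      then have "u \<longlonglongrightarrow> of_coords x" by (rule LIM_zero_cancel[OF tendsto_norm_zero_cancel])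
      then have "of_coords x \<in> S" using closed_sequentially[OF S, of u] u(1) by simp
      then show "x \<in> coords ` S" by (subst x) (rule imageI)
    qed
  qed
  have "0 \<in> coords ` S \<longleftrightarrow> 0 \<in> S"
    using inj_image_mem_iff[OF inj_coords, of 0 S] by simp
  moreover have "(\<forall>x\<in>coords ` S. \<forall>y\<in>coords ` S. x + y \<in> coords ` S) \<longleftrightarrow> (\<forall>x\<in>S. \<forall>y\<in>S. x + y \<in> S)"
    by (simp add: coords_add[symmetric] inj_image_mem_iff[OF inj_coords] del: coords_add)
  moreover have "(\<forall>x\<in>coords ` S. \<forall>a. ract x a \<in> coords ` S) \<longleftrightarrow> (\<forall>x\<in>S. \<forall>a. act x a \<in> S)"
    by (simp add: coords_act[symmetric] inj_image_mem_iff[OF inj_coords] del: coords_act)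
  moreover have "coords ` S \<subseteq> HA" by auto
  ultimately show ?thesis unfolding closed_submodule_def closed_sub_def cl by auto
qed

lemma closed_submodule_obtain:
  assumes "closed_submodule M" obtains S where "M = coords ` S" "closed_sub S"
proof -
  have "M = coords ` (of_coords ` M)"
  proof -
    have "coords (of_coords x) = x" if "x \<in> M" for x
      using assms that by (auto simp: closed_submodule_def intro: of_coords_inverse)
    then show ?thesis by (simp add: image_image)
  qed
  moreover from this have "closed_sub (of_coords ` M)"
    using assms closed_submodule_coords[of "of_coords ` M"] by simp
  ultimately show thesis by (rule that)
qed

definition sub_sum :: "'a::cstar_algebra std_module set \<Rightarrow> 'a std_module set \<Rightarrow> 'a std_module set \<Rightarrow> bool"
  where "sub_sum H S T \<longleftrightarrow> closed_sub S \<and> closed_sub T \<and> S \<inter> T = {0} \<and> H = {x + y | x y. x \<in> S \<and> y \<in> T}"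

lemma direct_sum_coords: "direct_sum (coords ` H) (coords ` S) (coords ` T) \<longleftrightarrow> sub_sum H S T"
proof -
  have "{x + y | x y. x \<in> coords ` S \<and> y \<in> coords ` T} = coords ` {x + y | x y. x \<in> S \<and> y \<in> T}"
    by (auto simp: image_def) (metis coords_add)+
  then have "(coords ` H = {x + y | x y. x \<in> coords ` S \<and> y \<in> coords ` T}) \<longleftrightarrow> H = {x + y | x y. x \<in> S \<and> y \<in> T}"
    by (simp only: coords_image_eq_iff)
  moreover have "coords ` S \<inter> coords ` T = {0} \<longleftrightarrow> S \<inter> T = {0}"
    unfolding coords_image_inter by (metis coords_image_eq_iff coords_zero image_empty image_insert)
  ultimately show ?thesis
    unfolding direct_sum_def sub_sum_def closed_submodule_coords by simp
qed

lemma direct_sum_obtain: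
  assumes "direct_sum (coords ` H) M N"
  obtains S T where "M = coords ` S" "N = coords ` T" "sub_sum H S T"
proof -
  have "closed_submodule M" "closed_submodule N" using assms by (auto simp: direct_sum_def)
  then obtain S T where "M = coords ` S" "N = coords ` T" using closed_submodule_obtain by metis
  then show thesis using assms that direct_sum_coords by blast
qed

lemma sub_sum_unique:
  assumes "sub_sum H S T" "x \<in> S" "y \<in> T" "x' \<in> S" "y' \<in> T" "x + y = x' + y'"
  shows "x = x' \<and> y = y'"
proof -
  have "subspace S" "subspace T" using assms(1) by (auto simp: sub_sum_def closed_sub_subspace)
  then have "x - x' \<in> S" "y' - y \<in> T" using assms(2-5) by (simp_all add: subspace_diff)
  moreover have "x - x' = y' - y"
  proof -
    have "x = x' + y' - y" using assms(6) by (metis add_diff_cancel_right')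
    then show ?thesis by simp
  qed
  ultimately have "x - x' \<in> S \<inter> T" "y' - y \<in> S \<inter> T" by simp_all
  then have "x - x' = 0" "y' - y = 0" using assms(1) unfolding sub_sum_def by blast+
  then show ?thesis by simp
qed

text \<open>
  Addition maps \<open>S \<times> T\<close> bijectively onto the Banach space \<open>H\<close>.
\<close>

lemma sub_sum_bound:
  assumes S: "sub_sum H S T" and H: "closed H"
  obtains C where "0 \<le> C" "\<And>x y. x \<in> S \<Longrightarrow> y \<in> T \<Longrightarrow> norm x \<le> C * norm (x + y)"
proof -
  have c: "closed_sub S" "closed_sub T" and H': "H = {x + y | x y. x \<in> S \<and> y \<in> T}"
    using S by (auto simp: sub_sum_def)
  define A where "A = (\<lambda>p::'a std_module \<times> 'a std_module. fst p + snd p)"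
  have A: "bounded_linear A" unfolding A_def by (intro bounded_linear_add bounded_linear_fst bounded_linear_snd)
  have im: "A ` (S \<times> T) = H" unfolding H' A_def by force
  have "subspace (S \<times> T)" using c by (intro subspace_Times closed_sub_subspace)
  moreover have "closed (S \<times> T)" using c by (intro closed_Times) (auto simp: closed_sub_def)
  ultimately obtain C where C: "0 \<le> C"
      "\<And>z. z \<in> H \<Longrightarrow> \<exists>p\<in>S \<times> T. A p = z \<and> norm p \<le> C * norm z"
    using bounded_preimages[OF A, of "S \<times> T"] H unfolding im by metis
  show thesis
  proof (rule that[OF C(1)])
    fix x y assume xy: "x \<in> S" "y \<in> T"
    then have "x + y \<in> H" by (auto simp: H')
    then obtain p where p: "p \<in> S \<times> T" "A p = x + y" "norm p \<le> C * norm (x + y)" using C(2) by blast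
    have "fst p = x" using sub_sum_unique[OF S, of "fst p" "snd p" x y] p xy by (auto simp: A_def)
    then show "norm x \<le> C * norm (x + y)" using p(3) norm_fst_le[of "fst p" "snd p"] by (metis order.trans prod.collapse)
  qed
qed

lemma idempotent_of_sub_sum:
  assumes S: "sub_sum UNIV S T"
  obtains e where "module_map e" "\<And>x. e (e x) = e x" "range e = S" "{x. e x = 0} = T"
proof -
  have c: "closed_sub S" "closed_sub T" and H: "UNIV = {x + y | x y. x \<in> S \<and> y \<in> T}"
    using S by (auto simp: sub_sum_def)
  obtain C where C: "\<And>x y. x \<in> S \<Longrightarrow> y \<in> T \<Longrightarrow> norm x \<le> C * norm (x + y)"
    using sub_sum_bound[OF S closed_UNIV] by blast
  have "\<exists>x y. z = x + y \<and> x \<in> S \<and> y \<in> T" for z using H by blast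
  then obtain e d where ed: "\<And>z. z = e z + d z" "\<And>z. e z \<in> S" "\<And>z. d z \<in> T" by metis

  have e: "e (x + y) = x" if "x \<in> S" "y \<in> T" for x y
    using sub_sum_unique[OF S ed(2) ed(3) that ed(1)[symmetric]] by blast
  have zero: "0 \<in> S" "0 \<in> T" using c by (auto simp: closed_sub_def)
  have eS: "e x = x" if "x \<in> S" for x using e[OF that zero(2)] by simp
  have eT: "e y = 0" if "y \<in> T" for y using e[OF zero(1) that] by simp
  have "module_map e"
  proof (rule module_mapI)
    show "e (x + y) = e x + e y" for x y
    proof -
      have "(e x + e y) + (d x + d y) = (e x + d x) + (e y + d y)" by (simp only: add_ac)
      also have "\<dots> = x + y" by (simp only: ed(1)[symmetric])
      finally have "(e x + e y) + (d x + d y) = x + y" .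
      moreover have "e x + e y \<in> S" "d x + d y \<in> T" using c ed(2,3) by (auto simp: closed_sub_def)
      ultimately show ?thesis using e[of "e x + e y" "d x + d y"] by simp
    qed
    show "e (act x a) = act (e x) a" for x a
    proof -
      have "act (e x) a + act (d x) a = act x a" by (simp only: act_add[symmetric] ed(1)[symmetric])
      moreover have "act (e x) a \<in> S" "act (d x) a \<in> T" using c ed(2,3) by (auto simp: closed_sub_def)
      ultimately show ?thesis using e[of "act (e x) a" "act (d x) a"] by simp
    qed
    show "norm (e x) \<le> C * norm x" for x
      using C[OF ed(2) ed(3), of x x] by (simp only: ed(1)[symmetric])
  qed
  moreover have "e (e x) = e x" for x by (rule eS[OF ed(2)])
  moreover have "range e = S"
  proof
    show "S \<subseteq> range e" using eS by (metis rangeI subsetI)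
  qed (use ed(2) in blast)
  moreover have "{x. e x = 0} = T"
  proof safe
    fix x assume "e x = 0"
    then have "x = d x" using ed(1)[of x] by (metis add_0)
    then show "x \<in> T" using ed(3)[of x] by metis
  qed (rule eT)
  ultimately show thesis by (rule that)
qed

lemma closed_sub_kernel:
  assumes T: "module_map T" shows "closed_sub {x. T x = 0}"
proof -
  have "continuous_on UNIV T" by (intro linear_continuous_on module_map_bounded_linear T)
  then have "closed {x. T x = 0}" by (intro closed_Collect_eq continuous_on_const)
  then show ?thesis
    by (simp add: closed_sub_def module_map_simps[OF T] module_map_act[OF T])
qed

lemma sub_sum_of_idempotent:
  assumes e: "module_map e" and ee: "\<And>x. e (e x) = e x"
  shows "sub_sum UNIV (range e) {x. e x = 0}"
proof -
  have "range e = {x. x - e x = 0}"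
  proof safe
    fix x assume "x - e x = 0"
    then show "x \<in> range e" by (metis eq_iff_diff_eq_0 rangeI)
  qed (simp add: ee)
  moreover have "module_map (\<lambda>x. x - e x)" by (rule module_map_diff[OF module_map_ident e])
  ultimately have "closed_sub (range e)" using closed_sub_kernel by metis
  moreover have "range e \<inter> {x. e x = 0} = {0}" 
  proof safe
    fix x assume "e (e x) = 0"
    then show "e x = 0" by (simp add: ee)
  qed (metis module_map_simps(1)[OF e] rangeI, simp add: module_map_simps(1)[OF e])
  moreover have "z \<in> {x + y | x y. x \<in> range e \<and> y \<in> {x. e x = 0}}" for z
  proof -
    have "z = e z + (z - e z)" "e (z - e z) = 0" using ee by (auto simp: module_map_simps[OF e])
    then show ?thesis by blast
  qed
  ultimately show ?thesis unfolding sub_sum_def using closed_sub_kernel[OF e] by blast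
qed

section \<open>Decompositions as outer inverses\<close>

definition op_map :: "((nat \<Rightarrow> 'a::cstar_algebra) \<Rightarrow> nat \<Rightarrow> 'a) \<Rightarrow> 'a std_module \<Rightarrow> 'a std_module"
  where "op_map F x = of_coords (F (coords x))"

lemma coords_op_map: "F \<in> adjointable_ops \<Longrightarrow> coords (op_map F x) = F (coords x)"
  unfolding op_map_def adjointable_ops_def by (auto intro!: of_coords_inverse)

lemma module_map_op_map:
  assumes "F \<in> adjointable_ops" shows "module_map (op_map F)"
proof -
  have lin: "module_linear_on HA F" using assms by (simp add: adjointable_ops_def)
  obtain C where C: "\<And>x. x \<in> HA \<Longrightarrow> hnorm (F x) \<le> C * hnorm x"
    using assms by (auto simp: adjointable_ops_def bounded_on_def)
  show ?thesis
  proof (rule module_mapI)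
    show "op_map F (x + y) = op_map F x + op_map F y" for x y
      using lin by (simp add: coords_eq_iff[symmetric] coords_op_map[OF assms] module_linear_on_def)
    show "op_map F (act x a) = act (op_map F x) a" for x a
      using lin by (simp add: coords_eq_iff[symmetric] coords_op_map[OF assms] module_linear_on_def)
    show "norm (op_map F x) \<le> C * norm x" for x
      using C by (simp add: norm_std_module_def coords_op_map[OF assms])
  qed
qed

text \<open>
  A decomposition of \<open>F\<close> is the same thing as a module map \<open>G\<close> with \<open>G F G = G\<close>. Given the decomposition,
  \<open>G\<close> inverts \<open>F\<close> from \<open>M2\<close> back to \<open>M1\<close> and vanishes on \<open>N2\<close>. Given \<open>G\<close>, the maps \<open>G F\<close> and \<open>F G\<close> are
  idempotents with ranges \<open>M1\<close> and \<open>M2\<close> and with kernels \<open>N1\<close> and \<open>N2\<close>. These kernels are the defects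
  below; the kernel of \<open>F G\<close> is that of \<open>G\<close>.
\<close>

definition outer_inverse ::
  "('a::cstar_algebra std_module \<Rightarrow> 'a std_module) \<Rightarrow> ('a std_module \<Rightarrow> 'a std_module) \<Rightarrow> bool"
  where "outer_inverse F G \<longleftrightarrow> module_map G \<and> (\<forall>x. G (F (G x)) = G x)"

definition domain_defect ::
  "('a::cstar_algebra std_module \<Rightarrow> 'a std_module) \<Rightarrow> ('a std_module \<Rightarrow> 'a std_module) \<Rightarrow> 'a std_module set"
  where "domain_defect F G = {x. G (F x) = 0}"

definition codomain_defect ::
  "('a::cstar_algebra std_module \<Rightarrow> 'a std_module) \<Rightarrow> 'a std_module set"
  where "codomain_defect G = {x. G x = 0}"

text \<open>
  \<open>G\<close> projects onto \<open>M2\<close> along \<open>N2\<close> and then inverts the isomorphism. It is bounded because the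
  projection is, by the open mapping theorem.
\<close>

lemma outer_inverse_of_fredholm_decomp:
  fixes F :: "(nat \<Rightarrow> 'a::cstar_algebra) \<Rightarrow> nat \<Rightarrow> 'a"
  assumes F: "F \<in> adjointable_ops" and dec: "fredholm_decomp F M1 N1 M2 N2"
  obtains G where "outer_inverse (op_map F) G"
    "N1 = coords ` domain_defect (op_map F) G" "N2 = coords ` codomain_defect G"
proof -
  have "direct_sum (coords ` UNIV) M1 N1" "direct_sum (coords ` UNIV) M2 N2"
    using dec by (simp_all add: fredholm_decomp_def coords_UNIV)
  then obtain S1 T1 S2 T2 where
    M: "M1 = coords ` S1" "N1 = coords ` T1" "sub_sum UNIV S1 T1"
      "M2 = coords ` S2" "N2 = coords ` T2" "sub_sum UNIV S2 T2"
    using direct_sum_obtain by metis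
  obtain f where f: "module_map f" "\<And>x. f (f x) = f x" "range f = S2" "{x. f x = 0} = T2"
    using idempotent_of_sub_sum[OF M(6)] by blast
  define F' where "F' = op_map F"
  have mF: "module_map F'" unfolding F'_def by (rule module_map_op_map[OF F])
  have cF: "coords (F' x) = F (coords x)" for x unfolding F'_def by (rule coords_op_map[OF F])
  have iso: "module_iso F M1 M2" using dec by (simp add: fredholm_decomp_def)
  then have bij: "bij_betw F M1 M2" by (simp add: module_iso_def)
  obtain C where C: "\<And>y. y \<in> M2 \<Longrightarrow> hnorm (inv_into M1 F y) \<le> C * hnorm y"
    using iso by (auto simp: module_iso_def bounded_on_def)
  have "inj_on F' S1"
  proof (rule inj_onI)
    fix x y assume xy: "x \<in> S1" "y \<in> S1" "F' x = F' y"
    then have "F (coords x) = F (coords y)" by (metis cF)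
    then have "coords x = coords y" using bij xy M(1) by (auto simp: bij_betw_def dest: inj_onD)
    then show "x = y" by (simp add: coords_eq_iff)
  qed
  have "F' ` S1 = S2"
  proof -
    have "coords ` (F' ` S1) = F ` M1" by (simp add: image_image cF M(1))
    also have "\<dots> = coords ` S2" using bij M(4) by (simp add: bij_betw_def)
    finally show ?thesis by (simp add: coords_image_eq_iff)
  qed
  have f2: "f z \<in> S2" for z using f(3) by blast
  define G where "G z = of_coords (inv_into M1 F (coords (f z)))" for z
  have inM2: "coords (f z) \<in> M2" for z using f2 M(4) by simp
  have GS: "G z \<in> S1" and cG: "coords (G z) = inv_into M1 F (coords (f z))" for z
  proof -
    have "inv_into M1 F (coords (f z)) \<in> M1"
      using bij inM2 by (metis bij_betw_def inv_into_into)
    then obtain w where w: "w \<in> S1" "inv_into M1 F (coords (f z)) = coords w" using M(1) by blast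
    then show "G z \<in> S1" "coords (G z) = inv_into M1 F (coords (f z))"
      by (auto simp: G_def coords_inverse)
  qed
  have FG: "F' (G z) = f z" for z
  proof -
    have "coords (F' (G z)) = coords (f z)"
      unfolding cF cG using inM2[of z] bij by (simp add: bij_betw_def f_inv_into_f)
    then show ?thesis by (simp add: coords_eq_iff)
  qed
  have S1: "closed_sub S1" using M(3) by (simp add: sub_sum_def)
  have Geq: "G z = w" if "w \<in> S1" "F' w = f z" for w z
    using inj_onD[OF \<open>inj_on F' S1\<close>, of "G z" w] GS that FG by simp
  obtain B where B: "0 \<le> B" "\<And>x. norm (f x) \<le> B * norm x" using module_map_bounded[OF f(1)] by blast
  have mG: "module_map G"
  proof (rule module_mapI)
    show "G (x + y) = G x + G y" for x y
      using GS S1 by (intro Geq) (auto simp: closed_sub_def module_map_simps[OF mF] module_map_simps[OF f(1)] FG)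
    show "G (act x a) = act (G x) a" for x a
      using GS S1 by (intro Geq) (auto simp: closed_sub_def module_map_act[OF mF] module_map_act[OF f(1)] FG)
    show "norm (G x) \<le> (\<bar>C\<bar> * B) * norm x" for x
    proof -
      have "norm (G x) \<le> C * norm (f x)"
        using C[OF inM2, of x] by (simp add: norm_std_module_def cG)
      also have "\<dots> \<le> \<bar>C\<bar> * norm (f x)" by (intro mult_right_mono) auto
      also have "\<dots> \<le> \<bar>C\<bar> * (B * norm x)" by (intro mult_left_mono B) auto
      finally show ?thesis by (simp add: mult.assoc)
    qed
  qed
  have GF: "G (F' x) = x" if "x \<in> S1" for x
  proof -
    have "F' x \<in> S2" using \<open>F' ` S1 = S2\<close> that by blast
    then have "f (F' x) = F' x" using f(2,3) by (metis imageE)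
    then show ?thesis using Geq[OF that] by metis
  qed
  have kerG: "codomain_defect G = T2"
  proof -
    have "G z = 0 \<longleftrightarrow> f z = 0" for z
      using FG[of z] Geq[of 0 z] S1 module_map_simps(1)[OF mF] by (auto simp: closed_sub_def)
    then show ?thesis using f(4) by (simp add: codomain_defect_def)
  qed
  have "domain_defect F' G = T1"
  proof -
    have T: "G (F' y) = 0" if "y \<in> T1" for y
    proof -
      have "F (coords y) \<in> N2" using dec that M(2) by (auto simp: fredholm_decomp_def)
      then have "F' y \<in> T2" unfolding M(5) cF[symmetric] by (simp add: inj_image_mem_iff[OF inj_coords])
      then show ?thesis using kerG by (auto simp: codomain_defect_def)
    qed
    show ?thesis
    proof
      show "domain_defect F' G \<subseteq> T1"
      proof
        fix z assume z: "z \<in> domain_defect F' G"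
        obtain x y where xy: "z = x + y" "x \<in> S1" "y \<in> T1" using M(3) unfolding sub_sum_def by blast
        then have "G (F' z) = x"
          by (simp add: module_map_simps[OF mF] module_map_simps[OF mG] GF T)
        then have "z = y" using z xy(1) by (simp add: domain_defect_def)
        then show "z \<in> T1" using xy(3) by simp
      qed
    qed (auto simp: domain_defect_def T)
  qed
  moreover have "outer_inverse F' G" unfolding outer_inverse_def using mG GF[OF GS] by simp
  ultimately show thesis using that[of G] kerG M(2,5) unfolding F'_def by simp
qed

lemma fredholm_decomp_of_outer_inverse:
  fixes F :: "(nat \<Rightarrow> 'a::cstar_algebra) \<Rightarrow> nat \<Rightarrow> 'a"
  assumes F: "F \<in> adjointable_ops" and G: "outer_inverse (op_map F) G"
  shows "\<exists>M1 M2. fredholm_decomp F M1 (coords ` domain_defect (op_map F) G) M2 (coords ` codomain_defect G)"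
proof -
  define F' where "F' = op_map F"
  have mF: "module_map F'" unfolding F'_def by (rule module_map_op_map[OF F])
  have cF: "coords (F' x) = F (coords x)" for x unfolding F'_def by (rule coords_op_map[OF F])
  have mG: "module_map G" and GFG: "\<And>x. G (F' (G x)) = G x" using G by (auto simp: outer_inverse_def F'_def)
  define e f where "e = (\<lambda>x. G (F' x))" and "f = (\<lambda>x. F' (G x))"
  have me: "module_map e" and mf: "module_map f"
    unfolding e_def f_def by (rule module_map_comp[OF mG mF] module_map_comp[OF mF mG])+
  have ee: "e (e x) = e x" "f (f x) = f x" for x by (simp_all add: e_def f_def GFG)
  define M1 M2 where "M1 = coords ` range e" and "M2 = coords ` range f"
  have re: "range e = range G"
  proof
    show "range G \<subseteq> range e"
    proof
      fix x assume "x \<in> range G"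
      then obtain y where "x = G y" by blast
      then have "x = e (G y)" by (simp add: e_def GFG)
      then show "x \<in> range e" by blast
    qed
  qed (auto simp: e_def)
  have ke: "{x. e x = 0} = domain_defect F' G" by (simp add: e_def domain_defect_def)
  have kf: "{x. f x = 0} = codomain_defect G"
  proof safe
    fix x assume "f x = 0"
    then have "G (F' (G x)) = 0" by (simp add: f_def module_map_simps(1)[OF mG])
    then show "x \<in> codomain_defect G" by (simp add: codomain_defect_def GFG)
  qed (simp add: codomain_defect_def f_def module_map_simps(1)[OF mF])
  have "direct_sum HA M1 (coords ` domain_defect F' G)"
    unfolding M1_def ke[symmetric] coords_UNIV[symmetric] direct_sum_coords
    by (rule sub_sum_of_idempotent[OF me ee(1)])
  moreover have "direct_sum HA M2 (coords ` codomain_defect G)"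
    unfolding M2_def kf[symmetric] coords_UNIV[symmetric] direct_sum_coords
    by (rule sub_sum_of_idempotent[OF mf ee(2)])
  moreover have img: "F ` M1 = M2"
  proof -
    have "F ` M1 = coords ` F' ` range G" by (simp add: M1_def re image_image cF)
    also have "F' ` range G = range f" by (simp add: f_def image_image)
    finally show ?thesis by (simp add: M2_def)
  qed
  moreover have "F ` coords ` domain_defect F' G \<subseteq> coords ` codomain_defect G"
  proof -
    have "F ` coords ` domain_defect F' G = coords ` F' ` domain_defect F' G" by (simp add: image_image cF)
    moreover have "F' ` domain_defect F' G \<subseteq> codomain_defect G"
      by (auto simp: domain_defect_def codomain_defect_def)
    ultimately show ?thesis by auto
  qed
  moreover have "module_iso F M1 M2"
  proof -
    have inv: "of_coords x \<in> range G \<and> coords (G (F' (of_coords x))) = x" if x: "x \<in> M1" for x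
    proof -
      obtain y where "x = coords (G y)" using x unfolding M1_def re by blast
      then show ?thesis by (simp add: coords_inverse GFG)
    qed
    have inj: "inj_on F M1"
    proof (rule inj_onI)
      fix x y assume xy: "x \<in> M1" "y \<in> M1" "F x = F y"
      obtain u v where uv: "x = coords (G u)" "y = coords (G v)" using xy unfolding M1_def re by blast
      have "F' (G u) = F' (G v)" using xy(3) by (simp add: coords_eq_iff[symmetric] cF uv)
      then have "G u = G v" by (metis GFG)
      then show "x = y" by (simp add: uv)
    qed
    have "bij_betw F M1 M2" using inj img by (simp add: bij_betw_def)
    moreover have sub: "M1 \<subseteq> HA" "M2 \<subseteq> HA" by (auto simp: M1_def M2_def)
    moreover have "module_linear_on HA F" "bounded_on HA F" using F by (simp_all add: adjointable_ops_def)
    then have "module_linear_on M1 F" "bounded_on M1 F"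
      using sub(1) unfolding module_linear_on_def bounded_on_def by (meson subsetD)+
    moreover have "bounded_on M2 (inv_into M1 F)"
    proof -
      obtain C where C: "\<And>x. norm (G x) \<le> C * norm x" using module_map_bounded[OF mG] by blast
      have "hnorm (inv_into M1 F y) \<le> C * hnorm y" if y: "y \<in> M2" for y
      proof -
        obtain z where z: "y = coords (F' (G z))" using y unfolding M2_def f_def by blast
        have "F (coords (G z)) = y" by (simp add: z cF)
        moreover have "coords (G z) \<in> M1" unfolding M1_def re by simp
        ultimately have "inv_into M1 F y = coords (G z)" using inj by (metis inv_into_f_eq)
        then show ?thesis using C[of "F' (G z)"] by (simp add: norm_std_module_def z GFG)
      qed
      then show ?thesis unfolding bounded_on_def by blast
    qed
    ultimately show ?thesis by (simp add: module_iso_def)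
  qed
  ultimately show ?thesis unfolding fredholm_decomp_def F'_def by blast
qed

section \<open>Perturbation of outer inverses\<close>

text \<open>
  The equation \<open>x = y - K x\<close> has a unique solution by the contraction principle; uniqueness makes the
  solution linear in \<open>y\<close>.
\<close>

lemma neumann_inverse:
  fixes K :: "'a::cstar_algebra std_module \<Rightarrow> 'a std_module"
  assumes K: "module_map K" and c: "c < 1" "\<And>x. norm (K x) \<le> c * norm x"
  obtains R where "module_map R" "\<And>x. R (x + K x) = x" "\<And>y. R y + K (R y) = y"
proof -
  define c' where "c' = max c 0"
  have c': "0 \<le> c'" "c' < 1" "\<And>x. norm (K x) \<le> c' * norm x"
    using c(1) by (auto simp: c'_def intro!: order.trans[OF c(2)] mult_right_mono)
  have "\<exists>!x. y - K x = x" for y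
  proof (rule banach_fix_type[OF c'(1,2)], safe)
    fix x z
    have "(y - K x) - (y - K z) = K (z - x)" by (simp add: module_map_simps[OF K])
    then show "dist (y - K x) (y - K z) \<le> c' * dist x z"
      using c'(3)[of "z - x"] by (simp add: dist_norm norm_minus_commute)
  qed
  then obtain R where R: "\<And>y. y - K (R y) = R y" "\<And>y x. y - K x = x \<Longrightarrow> x = R y" by metis
  have R1: "R y + K (R y) = y" for y using R(1)[of y] by (metis add.commute diff_add_cancel)
  have R2: "R y = x" if "x + K x = y" for x y using R(2)[of y x] that by (metis add_diff_cancel_right')
  have "module_map R"
  proof (rule module_mapI)
    show "R (x + y) = R x + R y" for x y
    proof (rule R2)
      have "R x + R y + K (R x + R y) = (R x + K (R x)) + (R y + K (R y))"
        by (simp add: module_map_simps[OF K])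
      then show "R x + R y + K (R x + R y) = x + y" by (simp only: R1)
    qed
    show "R (act x a) = act (R x) a" for x a
      by (rule R2) (simp add: module_map_act[OF K] act_add[symmetric] R1)
    show "norm (R y) \<le> (1 / (1 - c')) * norm y" for y
    proof -
      have "norm (R y) \<le> norm y + norm (K (R y))"
        using R(1)[of y] by (metis norm_triangle_ineq4)
      also have "\<dots> \<le> norm y + c' * norm (R y)" using c'(3) by simp
      finally have "(1 - c') * norm (R y) \<le> norm y" by (simp add: algebra_simps)
      then show ?thesis using c' by (simp add: field_simps)
    qed
  qed
  then show thesis using that[of R] R1 R2 by blast
qed

text \<open>
  With \<open>K = G (D - F)\<close> the map \<open>G' = (1 + K)\<^sup>-\<^sup>1 G\<close> is an outer inverse of \<open>D\<close>. It has the kernel of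
  \<open>G\<close>, and \<open>G D = G F (1 + K)\<close> shows that \<open>1 + K\<close> maps the kernel of \<open>G' D\<close> onto that of \<open>G F\<close>.
\<close>

lemma outer_inverse_perturbation:
  fixes F D G :: "'a::cstar_algebra std_module \<Rightarrow> 'a std_module"
  assumes F: "module_map F" and D: "module_map D" and G: "outer_inverse F G"
    and c: "c < 1" "\<And>x. norm (G (D x - F x)) \<le> c * norm x"
  obtains G' R Q where "outer_inverse D G'" "codomain_defect G' = codomain_defect G"
    "module_map R" "module_map Q" "R ` domain_defect F G \<subseteq> domain_defect D G'"
    "Q ` domain_defect D G' \<subseteq> domain_defect F G" "\<And>x. R (Q x) = x" "\<And>x. Q (R x) = x"
proof -
  have mG: "module_map G" and GFG: "\<And>x. G (F (G x)) = G x"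
    using G by (auto simp: outer_inverse_def)
  define K where "K = (\<lambda>x. G (D x - F x))"
  have mK: "module_map K" unfolding K_def by (rule module_map_comp[OF mG module_map_diff[OF D F]])
  have cK: "norm (K x) \<le> c * norm x" for x unfolding K_def by (rule c(2))
  obtain R where R: "module_map R" "\<And>x. R (x + K x) = x" "\<And>y. R y + K (R y) = y"
    using neumann_inverse[OF mK c(1) cK] by blast
  have inj: "x = y" if "R x = R y" for x y using that R(3) by metis
  define G' where "G' = (\<lambda>x. R (G x))"
  have mG': "module_map G'" unfolding G'_def by (rule module_map_comp[OF R(1) mG])
  define Q where "Q = (\<lambda>x. x + K x)"
  have mQ: "module_map Q" unfolding Q_def by (rule module_map_add[OF module_map_ident mK])
  have GD: "G (D x) = G (F (Q x))" for x
    by (simp add: Q_def K_def module_map_simps[OF mG] module_map_simps[OF F] GFG)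
  have QR: "Q (R x) = x" and RQ: "R (Q x) = x" for x unfolding Q_def by (rule R(3) R(2))+
  have R0: "R x = 0 \<longleftrightarrow> x = 0" for x using inj[of x 0] module_map_simps(1)[OF R(1)] by auto
  have "outer_inverse D G'"
    unfolding outer_inverse_def using mG' by (simp add: G'_def GD QR GFG)
  moreover have "codomain_defect G' = codomain_defect G"
    by (simp add: codomain_defect_def G'_def R0)
  moreover have "R ` domain_defect F G \<subseteq> domain_defect D G'" "Q ` domain_defect D G' \<subseteq> domain_defect F G"
    by (auto simp: domain_defect_def G'_def R0 GD QR)
  ultimately show thesis using that[of G' R Q] R(1) mQ RQ QR by blast
qed

section \<open>Splitting the standard module into two copies of itself\<close>

lemma interleave_simps [simp]:
  "interleave x y (2 * i) = x i" "interleave x y (Suc (2 * i)) = y i"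
  by (simp_all add: interleave_def)

lemma col_norm_interleave:
  fixes x y :: "nat \<Rightarrow> 'a::cstar_algebra"
  shows "col_norm {2 * m..<2 * n} (interleave x y) \<le> col_norm {m..<n} x + col_norm {m..<n} y"
    and "col_norm {m..<n} x \<le> col_norm {2 * m..<2 * n} (interleave x y)"
    and "col_norm {m..<n} y \<le> col_norm {2 * m..<2 * n} (interleave x y)"
proof -
  let ?g = "\<lambda>k. star (interleave x y k) * interleave x y k"
  have inj: "inj_on (\<lambda>i. 2 * i) I" "inj_on (\<lambda>i. Suc (2 * i)) I" for I :: "nat set" by (auto simp: inj_on_def)
  have un: "{2 * m..<2 * n} = (\<lambda>i. 2 * i) ` {m..<n} \<union> (\<lambda>i. Suc (2 * i)) ` {m..<n}"
  proof
    show "{2 * m..<2 * n} \<subseteq> (\<lambda>i. 2 * i) ` {m..<n} \<union> (\<lambda>i. Suc (2 * i)) ` {m..<n}"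
    proof
      fix k assume k: "k \<in> {2 * m..<2 * n}"
      show "k \<in> (\<lambda>i. 2 * i) ` {m..<n} \<union> (\<lambda>i. Suc (2 * i)) ` {m..<n}"
      proof (cases "even k")
        case True
        then obtain i where "k = 2 * i" by blast
        then show ?thesis using k by auto
      next
        case False
        then obtain i where "k = Suc (2 * i)" by (metis oddE Suc_eq_plus1)
        then show ?thesis using k by auto
      qed
    qed
  qed auto
  have "(\<Sum>k = 2 * m..<2 * n. ?g k) = (\<Sum>k\<in>(\<lambda>i. 2 * i) ` {m..<n}. ?g k) + (\<Sum>k\<in>(\<lambda>i. Suc (2 * i)) ` {m..<n}. ?g k)"
    unfolding un by (rule sum.union_disjoint) (auto, presburger)
  also have "\<dots> = (\<Sum>i = m..<n. star (x i) * x i) + (\<Sum>i = m..<n. star (y i) * y i)"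
    by (simp add: sum.reindex[OF inj(1)] sum.reindex[OF inj(2)] o_def)
  finally have eq: "(\<Sum>k = 2 * m..<2 * n. ?g k) = (\<Sum>i = m..<n. star (x i) * x i) + (\<Sum>i = m..<n. star (y i) * y i)" .
  have pos: "cstar_pos (\<Sum>i = m..<n. star (x i) * x i)" "cstar_pos (\<Sum>i = m..<n. star (y i) * y i)"
    by (auto intro!: cstar_pos_sum cstar_pos_star_mult_self)
  show "col_norm {m..<n} x \<le> col_norm {2 * m..<2 * n} (interleave x y)"
    using norm_le_norm_add_pos[OF pos] by (simp add: col_norm_def eq)
  show "col_norm {m..<n} y \<le> col_norm {2 * m..<2 * n} (interleave x y)"
    using norm_le_norm_add_pos[OF pos(2,1)] by (simp add: col_norm_def eq add.commute)
  show "col_norm {2 * m..<2 * n} (interleave x y) \<le> col_norm {m..<n} x + col_norm {m..<n} y"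
  proof (rule power2_le_imp_le)
    have "(col_norm {2 * m..<2 * n} (interleave x y))\<^sup>2 \<le> (col_norm {m..<n} x)\<^sup>2 + (col_norm {m..<n} y)\<^sup>2"
      unfolding col_norm_squared eq by (rule norm_triangle_ineq)
    also have "\<dots> \<le> (col_norm {m..<n} x + col_norm {m..<n} y)\<^sup>2" by (simp add: power2_sum)
    finally show "(col_norm {2 * m..<2 * n} (interleave x y))\<^sup>2 \<le> (col_norm {m..<n} x + col_norm {m..<n} y)\<^sup>2" .
  qed simp
qed

lemma interleave_HA_iff:
  fixes x y :: "nat \<Rightarrow> 'a::cstar_algebra"
  shows "interleave x y \<in> HA \<longleftrightarrow> x \<in> HA \<and> y \<in> HA"
proof safe
  assume H: "interleave x y \<in> HA"
  have *: "z \<in> HA" if z: "\<And>m n. col_norm {m..<n} z \<le> col_norm {2 * m..<2 * n} (interleave x y)" for z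
    unfolding HA_iff_col_norm
  proof safe
    fix e :: real assume "e > 0"
    then obtain N where N: "\<And>m n. m \<ge> N \<Longrightarrow> col_norm {m..<n} (interleave x y) < e"
      using H unfolding HA_iff_col_norm by blast
    have "col_norm {m..<n} z < e" if "m \<ge> N" for m n
      using z[of m n] N[of "2 * m" "2 * n"] that by simp
    then show "\<exists>N. \<forall>m\<ge>N. \<forall>n. col_norm {m..<n} z < e" by blast
  qed
  show "x \<in> HA" "y \<in> HA" by (rule *, rule col_norm_interleave)+
next
  assume xy: "x \<in> HA" "y \<in> HA"
  show "interleave x y \<in> HA"
    unfolding HA_iff_col_norm
  proof safe
    fix e :: real assume "e > 0"
    then obtain N1 N2 where N: "\<And>m n. m \<ge> N1 \<Longrightarrow> col_norm {m..<n} x < e/2" "\<And>m n. m \<ge> N2 \<Longrightarrow> col_norm {m..<n} y < e/2"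
      using xy unfolding HA_iff_col_norm by (meson half_gt_zero)
    have "col_norm {m..<n} (interleave x y) < e" if "m \<ge> 2 * max N1 N2" for m n
    proof -
      have "col_norm {m..<n} (interleave x y) \<le> col_norm {2 * (m div 2)..<2 * n} (interleave x y)"
        by (rule col_norm_mono) auto
      also have "\<dots> \<le> col_norm {m div 2..<n} x + col_norm {m div 2..<n} y" by (rule col_norm_interleave)
      also have "\<dots> < e"
      proof -
        have "N1 \<le> m div 2" "N2 \<le> m div 2" using that by linarith+
        then show ?thesis using N(1)[of "m div 2" n] N(2)[of "m div 2" n] by linarith
      qed
      finally show ?thesis .
    qed
    then show "\<exists>N. \<forall>m\<ge>N. \<forall>n. col_norm {m..<n} (interleave x y) < e" by blast
  qed
qed

lemma hnorm_interleave:
  fixes x y :: "nat \<Rightarrow> 'a::cstar_algebra"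
  assumes "x \<in> HA" "y \<in> HA"
  shows "hnorm (interleave x y) \<le> hnorm x + hnorm y"
    and "hnorm x \<le> hnorm (interleave x y)" and "hnorm y \<le> hnorm (interleave x y)"
proof -
  have H: "interleave x y \<in> HA" using assms by (simp add: interleave_HA_iff)
  show "hnorm (interleave x y) \<le> hnorm x + hnorm y"
    unfolding hnorm_le_iff[OF H]
  proof
    fix n
    have "col_norm {..<n} (interleave x y) \<le> col_norm {2 * 0..<2 * n} (interleave x y)"
      by (rule col_norm_mono) auto
    also have "\<dots> \<le> col_norm {0..<n} x + col_norm {0..<n} y" by (rule col_norm_interleave)
    also have "\<dots> \<le> hnorm x + hnorm y" by (intro add_mono col_norm_le_hnorm assms) auto
    finally show "col_norm {..<n} (interleave x y) \<le> hnorm x + hnorm y" .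
  qed
  show "hnorm x \<le> hnorm (interleave x y)"
    unfolding hnorm_le_iff[OF assms(1)]
    using col_norm_interleave(2)[of 0 _ x y] col_norm_le_hnorm[OF H]
    by (metis atLeast0LessThan finite_lessThan mult_0_right order.trans)
  show "hnorm y \<le> hnorm (interleave x y)"
    unfolding hnorm_le_iff[OF assms(2)]
    using col_norm_interleave(3)[of 0 _ y x] col_norm_le_hnorm[OF H]
    by (metis atLeast0LessThan finite_lessThan mult_0_right order.trans)
qed

lemma interleave_split: "interleave (\<lambda>i. z (2 * i)) (\<lambda>i. z (Suc (2 * i))) = z"
  by (auto simp: interleave_def fun_eq_iff elim!: evenE oddE)

text \<open>
  Interleaving identifies the module with the sum of two copies of itself. The two injections and the
  two projections are module maps, so that maps between external sums are composed from them without
  any computation with coordinates.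
\<close>

definition inl :: "'a::cstar_algebra std_module \<Rightarrow> 'a std_module"
  where "inl x = of_coords (interleave (coords x) 0)"

definition inr :: "'a::cstar_algebra std_module \<Rightarrow> 'a std_module"
  where "inr x = of_coords (interleave 0 (coords x))"

definition outl :: "'a::cstar_algebra std_module \<Rightarrow> 'a std_module"
  where "outl z = of_coords (\<lambda>i. coords z (2 * i))"

definition outr :: "'a::cstar_algebra std_module \<Rightarrow> 'a std_module"
  where "outr z = of_coords (\<lambda>i. coords z (Suc (2 * i)))"

lemma coords_inl: "coords (inl x) = interleave (coords x) 0"
  by (simp add: inl_def of_coords_inverse interleave_HA_iff)

lemma coords_inr: "coords (inr x) = interleave 0 (coords x)"
  by (simp add: inr_def of_coords_inverse interleave_HA_iff)

lemma coords_outl: "coords (outl z) = (\<lambda>i. coords z (2 * i))"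
  and coords_outr: "coords (outr z) = (\<lambda>i. coords z (Suc (2 * i)))"
proof -
  have "interleave (\<lambda>i. coords z (2 * i)) (\<lambda>i. coords z (Suc (2 * i))) \<in> HA"
    unfolding interleave_split by simp
  then show "coords (outl z) = (\<lambda>i. coords z (2 * i))" "coords (outr z) = (\<lambda>i. coords z (Suc (2 * i)))"
    unfolding interleave_HA_iff outl_def outr_def by (simp_all add: of_coords_inverse)
qed

lemma interleave_add: "interleave (x + x') (y + y') = interleave x y + interleave x' y'"
  by (simp add: interleave_def fun_eq_iff)

lemma coords_inl_inr: "coords (inl x + inr y) = interleave (coords x) (coords y)"
  by (simp add: coords_inl coords_inr interleave_add[symmetric])

lemma outl_inl [simp]: "outl (inl x) = x"
  by (simp add: coords_eq_iff[symmetric] coords_outl coords_inl)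

lemma outr_inr [simp]: "outr (inr x) = x"
  by (simp add: coords_eq_iff[symmetric] coords_outr coords_inr)

lemma outl_inr [simp]: "outl (inr x) = 0"
  by (simp add: coords_eq_iff[symmetric] coords_outl coords_inr zero_fun_def)

lemma outr_inl [simp]: "outr (inl x) = 0"
  by (simp add: coords_eq_iff[symmetric] coords_outr coords_inl zero_fun_def)

lemma inl_outl_inr_outr [simp]: "inl (outl z) + inr (outr z) = z"
  by (simp add: coords_eq_iff[symmetric] coords_inl_inr coords_outl coords_outr interleave_split del: coords_add)

lemma module_map_inl: "module_map inl"
  by (rule module_mapI[where C = 1])
    (use hnorm_interleave(1)[OF coords_HA HA_zero] in \<open>auto simp: coords_eq_iff[symmetric] coords_inl
      fun_eq_iff interleave_def ract_def norm_std_module_def\<close>)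

lemma module_map_inr: "module_map inr"
  by (rule module_mapI[where C = 1])
    (use hnorm_interleave(1)[OF HA_zero coords_HA] in \<open>auto simp: coords_eq_iff[symmetric] coords_inr
      fun_eq_iff interleave_def ract_def norm_std_module_def\<close>)

lemma norm_outl_le: "norm (outl z) \<le> norm z" and norm_outr_le: "norm (outr w) \<le> norm w"
proof -
  show "norm (outl z) \<le> norm z"
    using hnorm_interleave(2)[OF coords_HA[of "outl z"] coords_HA[of "outr z"]]
    by (simp add: norm_std_module_def coords_outl coords_outr interleave_split)
  show "norm (outr w) \<le> norm w"
    using hnorm_interleave(3)[OF coords_HA[of "outl w"] coords_HA[of "outr w"]]
    by (simp add: norm_std_module_def coords_outl coords_outr interleave_split)
qed

lemma module_map_outl: "module_map outl"
  by (rule module_mapI[where C = 1])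
    (auto simp: coords_eq_iff[symmetric] coords_outl fun_eq_iff ract_def norm_outl_le)

lemma module_map_outr: "module_map outr"
  by (rule module_mapI[where C = 1])
    (auto simp: coords_eq_iff[symmetric] coords_outr fun_eq_iff ract_def norm_outr_le)

lemmas split_simps = module_map_simps(1)[OF module_map_inl] module_map_simps(1)[OF module_map_inr]
  module_map_simps[OF module_map_outl] module_map_simps[OF module_map_outr]
  module_map_act[OF module_map_outl] module_map_act[OF module_map_outr]

lemma split_eq_iff: "z = w \<longleftrightarrow> outl z = outl w \<and> outr z = outr w"
  by (metis inl_outl_inr_outr)

text \<open>
  The set \<open>ext_sum A B\<close> for subsets of the type.
\<close>

definition split_sum :: "'a::cstar_algebra std_module set \<Rightarrow> 'a std_module set \<Rightarrow> 'a std_module set"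
  where "split_sum A B = {z. outl z \<in> A \<and> outr z \<in> B}"

lemma ext_sum_coords: "ext_sum (coords ` A) (coords ` B) = coords ` split_sum A B"
proof -
  have "ext_sum (coords ` A) (coords ` B) = {coords (inl x + inr y) | x y. x \<in> A \<and> y \<in> B}"
    unfolding ext_sum_def coords_inl_inr by blast
  also have "\<dots> = coords ` split_sum A B"
  proof safe
    fix x y assume "x \<in> A" "y \<in> B"
    then have "inl x + inr y \<in> split_sum A B" by (simp add: split_sum_def split_simps)
    then show "coords (inl x + inr y) \<in> coords ` split_sum A B" by (rule imageI)
  next
    fix z assume "z \<in> split_sum A B"
    then show "\<exists>x y. coords z = coords (inl x + inr y) \<and> x \<in> A \<and> y \<in> B"
      by (intro exI[of _ "outl z"] exI[of _ "outr z"]) (simp add: split_sum_def del: coords_add)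
  qed
  finally show ?thesis .
qed

lemma closed_sub_split_sum: "closed_sub A \<Longrightarrow> closed_sub B \<Longrightarrow> closed_sub (split_sum A B)"
proof -
  assume AB: "closed_sub A" "closed_sub B"
  have "closed (outl -` A)" "closed (outr -` B)"
    using AB by (auto intro!: closed_vimage linear_continuous_on module_map_bounded_linear module_map_outl
        module_map_outr simp: closed_sub_def)
  then have "closed (outl -` A \<inter> outr -` B)" by (rule closed_Int)
  also have "outl -` A \<inter> outr -` B = split_sum A B" by (auto simp: split_sum_def)
  finally show ?thesis using AB by (auto simp: closed_sub_def split_sum_def split_simps)
qed

section \<open>Isomorphisms of submodules\<close>

text \<open>
  Isomorphisms between submodules are defined on the submodules only and need not extend to the
  whole module.
\<close>

definition map_on :: "'a::cstar_algebra std_module set \<Rightarrow> ('a std_module \<Rightarrow> 'a std_module) \<Rightarrow> bool"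
  where "map_on S f \<longleftrightarrow> (\<forall>x\<in>S. \<forall>y\<in>S. f (x + y) = f x + f y) \<and> (\<forall>x\<in>S. \<forall>a. f (act x a) = act (f x) a)
    \<and> (\<exists>C. \<forall>x\<in>S. norm (f x) \<le> C * norm x)"

lemma map_on_module_map: "module_map f \<Longrightarrow> map_on S f"
  unfolding map_on_def by (metis module_map_bounded module_map_simps(2) module_map_act)

lemma map_on_UNIV: "map_on UNIV f \<longleftrightarrow> module_map f"
proof
  assume "map_on UNIV f"
  then show "module_map f" unfolding map_on_def by (auto intro: module_mapI)
qed (rule map_on_module_map)

lemma map_on_comp:
  assumes g: "map_on S g" and f: "map_on T f" and sub: "g ` S \<subseteq> T"
  shows "map_on S (\<lambda>x. f (g x))"
proof -
  obtain C D where C: "\<And>x. x \<in> S \<Longrightarrow> norm (g x) \<le> C * norm x" and D: "\<And>x. x \<in> T \<Longrightarrow> norm (f x) \<le> D * norm x"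
    using f g unfolding map_on_def by blast
  have "norm (f (g x)) \<le> (\<bar>D\<bar> * C) * norm x" if "x \<in> S" for x
  proof -
    have "norm (f (g x)) \<le> D * norm (g x)" using D sub that by blast
    also have "\<dots> \<le> \<bar>D\<bar> * norm (g x)" by (intro mult_right_mono) auto
    also have "\<dots> \<le> \<bar>D\<bar> * (C * norm x)" by (intro mult_left_mono C that) auto
    finally show ?thesis by (simp add: mult.assoc)
  qed
  moreover have gT: "g x \<in> T" if "x \<in> S" for x using sub that by blast
  ultimately show ?thesis using f g unfolding map_on_def by (auto simp: gT)
qed

lemma map_on_add:
  assumes "map_on S f" "map_on S g" shows "map_on S (\<lambda>x. f x + g x)"
proof -
  obtain C D where C: "\<And>x. x \<in> S \<Longrightarrow> norm (f x) \<le> C * norm x" and D: "\<And>x. x \<in> S \<Longrightarrow> norm (g x) \<le> D * norm x"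
    using assms unfolding map_on_def by blast
  have "norm (f x + g x) \<le> (C + D) * norm x" if "x \<in> S" for x
    using C[OF that] D[OF that] norm_triangle_ineq[of "f x" "g x"] by (simp add: algebra_simps)
  then have "\<exists>C. \<forall>x\<in>S. norm (f x + g x) \<le> C * norm x" by blast
  then show ?thesis using assms unfolding map_on_def by (simp add: act_add add_ac)
qed

definition iso_sub :: "'a::cstar_algebra std_module set \<Rightarrow> 'a std_module set \<Rightarrow> bool"
  where "iso_sub S T \<longleftrightarrow> (\<exists>f g. map_on S f \<and> map_on T g \<and> f ` S \<subseteq> T \<and> g ` T \<subseteq> S
    \<and> (\<forall>x\<in>S. g (f x) = x) \<and> (\<forall>y\<in>T. f (g y) = y))"

lemma iso_sub_refl: "iso_sub S S"
  unfolding iso_sub_def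
  by (intro exI[of _ "\<lambda>x. x"]) (simp add: map_on_module_map[OF module_map_ident])

lemma iso_sub_sym: "iso_sub S T \<Longrightarrow> iso_sub T S"
  unfolding iso_sub_def by blast

lemma iso_sub_trans: "iso_sub S T \<Longrightarrow> iso_sub T U \<Longrightarrow> iso_sub S U"
proof -
  assume "iso_sub S T" "iso_sub T U"
  then obtain f g f' g' where m: "map_on S f" "map_on T g" "map_on T f'" "map_on U g'"
    and s: "f ` S \<subseteq> T" "g ` T \<subseteq> S" "f' ` T \<subseteq> U" "g' ` U \<subseteq> T"
    and i: "\<And>x. x \<in> S \<Longrightarrow> g (f x) = x" "\<And>y. y \<in> T \<Longrightarrow> f (g y) = y"
      "\<And>x. x \<in> T \<Longrightarrow> g' (f' x) = x" "\<And>y. y \<in> U \<Longrightarrow> f' (g' y) = y"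
    unfolding iso_sub_def by metis
  have s': "\<And>x. x \<in> S \<Longrightarrow> f x \<in> T" "\<And>x. x \<in> T \<Longrightarrow> f' x \<in> U" "\<And>x. x \<in> U \<Longrightarrow> g' x \<in> T" "\<And>x. x \<in> T \<Longrightarrow> g x \<in> S"
    using s by auto
  show ?thesis unfolding iso_sub_def
    by (intro exI[of _ "\<lambda>x. f' (f x)"] exI[of _ "\<lambda>x. g (g' x)"] conjI
        map_on_comp[OF m(1,3) s(1)] map_on_comp[OF m(4,2) s(4)]) (auto simp: s' i)
qed

lemma isomorphic_coords:
  assumes S: "closed_sub S" and T: "closed_sub T"
  shows "isomorphic (coords ` S) (coords ` T) \<longleftrightarrow> iso_sub S T"
proof
  assume "isomorphic (coords ` S) (coords ` T)"
  then obtain f where f: "module_iso f (coords ` S) (coords ` T)" by (auto simp: isomorphic_def)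
  define g where "g = inv_into (coords ` S) f"
  have bij: "bij_betw f (coords ` S) (coords ` T)" and lin: "module_linear_on (coords ` S) f"
    and b: "bounded_on (coords ` S) f" "bounded_on (coords ` T) g"
    using f by (auto simp: module_iso_def g_def)
  define f' where "f' x = of_coords (f (coords x))" for x
  define g' where "g' x = of_coords (g (coords x))" for x
  have fc: "coords (f' x) = f (coords x)" "f' x \<in> T" if "x \<in> S" for x
  proof -
    have "f (coords x) \<in> coords ` T" using bij that by (auto simp: bij_betw_def)
    then show "coords (f' x) = f (coords x)" "f' x \<in> T" by (auto simp: f'_def coords_inverse)
  qed
  have gc: "coords (g' y) = g (coords y)" "g' y \<in> S" if "y \<in> T" for y
  proof -
    have "g (coords y) \<in> coords ` S"
      unfolding g_def using bij that by (intro inv_into_into) (auto simp: bij_betw_def)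
    then show "coords (g' y) = g (coords y)" "g' y \<in> S" by (auto simp: g'_def coords_inverse)
  qed
  have gf: "g' (f' x) = x" if "x \<in> S" for x
  proof -
    have "coords (g' (f' x)) = coords x"
      using bij that by (simp add: gc fc g_def bij_betw_def inv_into_f_f)
    then show ?thesis by (simp add: coords_eq_iff)
  qed
  have fg: "f' (g' y) = y" if "y \<in> T" for y
  proof -
    have "coords (f' (g' y)) = coords y"
      using bij that by (simp add: gc fc g_def bij_betw_def f_inv_into_f)
    then show ?thesis by (simp add: coords_eq_iff)
  qed
  have Sa: "\<And>x y. x \<in> S \<Longrightarrow> y \<in> S \<Longrightarrow> x + y \<in> S" "\<And>x a. x \<in> S \<Longrightarrow> act x a \<in> S"
    and Ta: "\<And>x y. x \<in> T \<Longrightarrow> y \<in> T \<Longrightarrow> x + y \<in> T" "\<And>x a. x \<in> T \<Longrightarrow> act x a \<in> T"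
    using S T by (auto simp: closed_sub_def)
  have fadd: "f' (x + y) = f' x + f' y" if "x \<in> S" "y \<in> S" for x y
    using lin that by (simp add: coords_eq_iff[symmetric] fc Sa module_linear_on_def)
  have fact: "f' (act x a) = act (f' x) a" if "x \<in> S" for x a
    using lin that by (simp add: coords_eq_iff[symmetric] fc Sa module_linear_on_def)
  have gadd: "g' (x + y) = g' x + g' y" if "x \<in> T" "y \<in> T" for x y
  proof -
    have "f' (g' x + g' y) = x + y" using that by (simp add: fadd gc fg)
    then show ?thesis using gf[OF Sa(1)[OF gc(2)[OF that(1)] gc(2)[OF that(2)]]] by simp
  qed
  have gact: "g' (act x a) = act (g' x) a" if "x \<in> T" for x a
  proof -
    have "f' (act (g' x) a) = act x a" using that by (simp add: fact gc fg)
    then show ?thesis using gf[OF Sa(2)[OF gc(2)[OF that]]] by metis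
  qed
  obtain C D where C: "\<And>x. x \<in> S \<Longrightarrow> norm (f' x) \<le> C * norm x" and D: "\<And>y. y \<in> T \<Longrightarrow> norm (g' y) \<le> D * norm y"
    using b unfolding bounded_on_def by (auto simp: norm_std_module_def fc gc)
  have "map_on S f'" unfolding map_on_def using fadd fact C by blast
  moreover have "map_on T g'" unfolding map_on_def using gadd gact D by blast
  moreover have "f' ` S \<subseteq> T" "g' ` T \<subseteq> S" using fc(2) gc(2) by auto
  ultimately show "iso_sub S T" unfolding iso_sub_def using gf fg by blast
next
  assume "iso_sub S T"
  then obtain f g where m: "map_on S f" "map_on T g" and s: "f ` S \<subseteq> T" "g ` T \<subseteq> S"
    and i: "\<And>x. x \<in> S \<Longrightarrow> g (f x) = x" "\<And>y. y \<in> T \<Longrightarrow> f (g y) = y" unfolding iso_sub_def by blast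
  define F where "F x = coords (f (of_coords x))" for x
  have F: "F (coords x) = coords (f x)" for x by (simp add: F_def coords_inverse)
  have bij: "bij_betw F (coords ` S) (coords ` T)"
  proof (rule bij_betw_imageI)
    show "inj_on F (coords ` S)"
    proof (rule inj_onI)
      fix x y assume xy: "x \<in> coords ` S" "y \<in> coords ` S" "F x = F y"
      then obtain u v where uv: "x = coords u" "y = coords v" "u \<in> S" "v \<in> S" by blast
      then have "f u = f v" using xy(3) by (simp add: F coords_eq_iff)
      then have "u = v" using i(1)[OF uv(3)] i(1)[OF uv(4)] by metis
      then show "x = y" by (simp add: uv)
    qed
    show "F ` coords ` S = coords ` T"
    proof -
      have "f ` S = T"
      proof
        show "T \<subseteq> f ` S"
        proof
          fix y assume y: "y \<in> T"
          then have "g y \<in> S" using s by blast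
          then show "y \<in> f ` S" using i(2)[OF y] by (metis imageI)
        qed
      qed (rule s)
      then show ?thesis by (simp add: image_image F flip: \<open>f ` S = T\<close>)
    qed
  qed
  have inv: "inv_into (coords ` S) F (coords y) = coords (g y)" if "y \<in> T" for y
  proof -
    have "g y \<in> S" using s that by blast
    moreover have "F (coords (g y)) = coords y" using that by (simp add: F i)
    ultimately show ?thesis using bij by (metis bij_betw_def imageI inv_into_f_eq)
  qed
  have "module_linear_on (coords ` S) F"
    using m(1) unfolding module_linear_on_def map_on_def
    by (auto simp: F coords_add[symmetric] coords_act[symmetric] simp del: coords_add coords_act)
  moreover have "bounded_on (coords ` S) F"
    using m(1) unfolding bounded_on_def map_on_def by (auto simp: F norm_std_module_def)
  moreover have "bounded_on (coords ` T) (inv_into (coords ` S) F)"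
    using m(2) unfolding bounded_on_def map_on_def by (auto simp: inv norm_std_module_def)
  ultimately show "isomorphic (coords ` S) (coords ` T)"
    using bij unfolding isomorphic_def module_iso_def by blast
qed

lemma iso_sub_split_sum_cong:
  assumes "iso_sub A A'" "iso_sub B B'" shows "iso_sub (split_sum A B) (split_sum A' B')"
proof -
  obtain f g f' g' where m: "map_on A f" "map_on A' g" "map_on B f'" "map_on B' g'"
    and s: "f ` A \<subseteq> A'" "g ` A' \<subseteq> A" "f' ` B \<subseteq> B'" "g' ` B' \<subseteq> B"
    and i: "\<And>x. x \<in> A \<Longrightarrow> g (f x) = x" "\<And>y. y \<in> A' \<Longrightarrow> f (g y) = y"
      "\<And>x. x \<in> B \<Longrightarrow> g' (f' x) = x" "\<And>y. y \<in> B' \<Longrightarrow> f' (g' y) = y"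
    using assms unfolding iso_sub_def by metis
  have s': "\<And>x. x \<in> A \<Longrightarrow> f x \<in> A'" "\<And>x. x \<in> A' \<Longrightarrow> g x \<in> A" "\<And>x. x \<in> B \<Longrightarrow> f' x \<in> B'" "\<And>x. x \<in> B' \<Longrightarrow> g' x \<in> B"
    using s by auto
  have mm: "map_on (split_sum U V) (\<lambda>z. inl (h (outl z)) + inr (k (outr z)))" if "map_on U h" "map_on V k" for U V h k
  proof (rule map_on_add)
    show "map_on (split_sum U V) (\<lambda>z. inl (h (outl z)))"
      by (rule map_on_comp[OF map_on_comp[OF map_on_module_map[OF module_map_outl] that(1)]
            map_on_module_map[OF module_map_inl, of UNIV]]) (auto simp: split_sum_def)
    show "map_on (split_sum U V) (\<lambda>z. inr (k (outr z)))"
      by (rule map_on_comp[OF map_on_comp[OF map_on_module_map[OF module_map_outr] that(2)]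
            map_on_module_map[OF module_map_inr, of UNIV]]) (auto simp: split_sum_def)
  qed
  define \<phi> where "\<phi> = (\<lambda>z. inl (f (outl z)) + inr (f' (outr z)))"
  define \<psi> where "\<psi> = (\<lambda>z. inl (g (outl z)) + inr (g' (outr z)))"
  have "map_on (split_sum A B) \<phi>" "map_on (split_sum A' B') \<psi>"
    unfolding \<phi>_def \<psi>_def by (rule mm[OF m(1,3)], rule mm[OF m(2,4)])
  moreover have "\<phi> ` split_sum A B \<subseteq> split_sum A' B'" "\<psi> ` split_sum A' B' \<subseteq> split_sum A B"
    by (auto simp: \<phi>_def \<psi>_def split_sum_def split_simps s')
  moreover have "\<psi> (\<phi> z) = z" if "z \<in> split_sum A B" for z
    using that by (simp add: \<phi>_def \<psi>_def split_sum_def split_simps i)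
  moreover have "\<phi> (\<psi> z) = z" if "z \<in> split_sum A' B'" for z
    using that by (simp add: \<phi>_def \<psi>_def split_sum_def split_simps i)
  ultimately show ?thesis unfolding iso_sub_def by (intro exI[of _ \<phi>] exI[of _ \<psi>]) simp
qed

lemma iso_subI_module_maps:
  assumes "module_map f" "module_map g" "f ` S \<subseteq> T" "g ` T \<subseteq> S"
    "\<And>x. x \<in> S \<Longrightarrow> g (f x) = x" "\<And>y. y \<in> T \<Longrightarrow> f (g y) = y"
  shows "iso_sub S T"
  unfolding iso_sub_def
  by (intro exI[of _ f] exI[of _ g]) (simp add: assms map_on_module_map)

lemmas module_map_intros = module_map_add module_map_diff
  module_map_comp[OF module_map_inl] module_map_comp[OF module_map_inr]
  module_map_comp[OF module_map_outl] module_map_comp[OF module_map_outr]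
  module_map_inl module_map_inr module_map_outl module_map_outr module_map_ident

lemma iso_sub_split_sum_commute: "iso_sub (split_sum A B) (split_sum B A)"
  by (rule iso_subI_module_maps[where f = "\<lambda>z. inl (outr z) + inr (outl z)" and g = "\<lambda>z. inl (outr z) + inr (outl z)"])
    (auto intro!: module_map_intros simp: split_sum_def split_simps add.commute[of "inr _"])

lemma iso_sub_split_sum_assoc: "iso_sub (split_sum (split_sum A B) C) (split_sum A (split_sum B C))"
  by (rule iso_subI_module_maps[where f = "\<lambda>z. inl (outl (outl z)) + inr (inl (outr (outl z)) + inr (outr z))"
        and g = "\<lambda>z. inl (inl (outl z) + inr (outl (outr z))) + inr (outr (outr z))"])
    (auto intro!: module_map_intros simp: split_sum_def split_simps)

lemma iso_sub_split_sum_zero: "iso_sub (split_sum A {0}) A"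
proof (rule iso_subI_module_maps[where f = outl and g = inl])
  fix z assume "z \<in> split_sum A {0}"
  then show "inl (outl z) = z" using inl_outl_inr_outr[of z] by (simp add: split_sum_def split_simps)
qed (auto simp: split_sum_def module_map_inl module_map_outl)

section \<open>Finitely generated submodules\<close>

definition right_submodule :: "(nat \<Rightarrow> 'a::cstar_algebra) set \<Rightarrow> bool"
  where "right_submodule N \<longleftrightarrow> 0 \<in> N \<and> (\<forall>x\<in>N. \<forall>y\<in>N. x + y \<in> N) \<and> (\<forall>x\<in>N. \<forall>a. ract x a \<in> N)"

text \<open>
  For finite \<open>S\<close> this is the least submodule containing \<open>S\<close> (\<open>module_span_least\<close>). Arguments by
  minimality replace the manipulation of coefficients.
\<close>

definition module_span :: "(nat \<Rightarrow> 'a::cstar_algebra) set \<Rightarrow> (nat \<Rightarrow> 'a) set"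
  where "module_span S = {\<Sum>s\<in>S. ract s (c s) | c. True}"

lemma ract_add_right: "ract x (a + b) = ract x a + ract x (b::'a::cstar_algebra)"
  by (simp add: ract_def fun_eq_iff algebra_simps)

lemma ract_zero_right [simp]: "ract x 0 = (0 :: nat \<Rightarrow> 'a::cstar_algebra)"
  by (simp add: ract_def fun_eq_iff)

lemma ract_one [simp]: "ract x 1 = (x :: nat \<Rightarrow> 'a::cstar_algebra)"
  by (simp add: ract_def)

lemma ract_sum_left: "ract (\<Sum>s\<in>S. f s) a = (\<Sum>s\<in>S. ract (f s) (a::'a::cstar_algebra))"
  by (induction S rule: infinite_finite_induct)
    (simp_all only: sum.infinite sum.empty sum.insert ract_zero_left ract_add_left simp_thms)

lemma right_submodule_sum:
  "right_submodule N \<Longrightarrow> (\<And>s. s \<in> S \<Longrightarrow> f s \<in> N) \<Longrightarrow> (\<Sum>s\<in>S. f s) \<in> N"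
  by (induction S rule: infinite_finite_induct) (auto simp: right_submodule_def)

lemma right_submodule_span: "right_submodule (module_span S)"
  unfolding right_submodule_def
proof (intro conjI ballI allI)
  show "0 \<in> module_span S" unfolding module_span_def by (auto intro!: exI[of _ "\<lambda>_. 0"])
next
  fix x y assume "x \<in> module_span S" "y \<in> module_span S"
  then obtain c d where "x = (\<Sum>s\<in>S. ract s (c s))" "y = (\<Sum>s\<in>S. ract s (d s))" by (auto simp: module_span_def)
  then have "x + y = (\<Sum>s\<in>S. ract s (c s + d s))" by (simp add: ract_add_right sum.distrib)
  then show "x + y \<in> module_span S" unfolding module_span_def
    by (intro CollectI exI[of _ "\<lambda>s. c s + d s"] conjI TrueI)
next
  fix x a assume "x \<in> module_span S"
  then obtain c where "x = (\<Sum>s\<in>S. ract s (c s))" by (auto simp: module_span_def)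
  then have "ract x a = (\<Sum>s\<in>S. ract s (c s * a))" by (simp add: ract_sum_left ract_ract)
  then show "ract x a \<in> module_span S" unfolding module_span_def
    by (intro CollectI exI[of _ "\<lambda>s. c s * a"] conjI TrueI)
qed

lemma module_span_superset:
  assumes "finite S" shows "S \<subseteq> module_span S"
proof
  fix s assume s: "s \<in> S"
  have "(\<Sum>t\<in>S. ract t (if t = s then 1 else 0)) = (\<Sum>t\<in>S. if t = s then t else 0)"
    by (rule sum.cong) auto
  also have "\<dots> = s" using assms s by simp
  finally show "s \<in> module_span S" unfolding module_span_def
    by (intro CollectI exI[of _ "\<lambda>t. if t = s then 1 else 0"] conjI TrueI) (rule sym)
qed

lemma module_span_least:
  assumes "right_submodule N" "S \<subseteq> N" shows "module_span S \<subseteq> N"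
proof
  fix x assume "x \<in> module_span S"
  then obtain c where c: "x = (\<Sum>s\<in>S. ract s (c s))" by (auto simp: module_span_def)
  show "x \<in> N" unfolding c
    by (rule right_submodule_sum[OF assms(1)]) (use assms in \<open>auto simp: right_submodule_def\<close>)
qed

lemma finitely_generated_iff: "finitely_generated M \<longleftrightarrow> (\<exists>S. finite S \<and> S \<subseteq> HA \<and> M = module_span S)"
  by (simp add: finitely_generated_def module_span_def)

lemma finitely_generated_submodule: "finitely_generated M \<Longrightarrow> right_submodule M"
  by (auto simp: finitely_generated_iff right_submodule_span)

lemma finitely_generated_image:
  assumes M: "finitely_generated M" and f: "module_linear_on M f" and sub: "f ` M \<subseteq> HA"
  shows "finitely_generated (f ` M)"
proof -
  obtain S where S: "finite S" "S \<subseteq> HA" "M = module_span S" using M by (auto simp: finitely_generated_iff)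
  have SM: "S \<subseteq> M" using module_span_superset[OF S(1)] S(3) by simp
  have M': "right_submodule M" using M by (rule finitely_generated_submodule)
  have fadd: "\<And>x y. x \<in> M \<Longrightarrow> y \<in> M \<Longrightarrow> f (x + y) = f x + f y"
    and fact: "\<And>x a. x \<in> M \<Longrightarrow> f (ract x a) = ract (f x) a"
    using f by (auto simp: module_linear_on_def)
  have zero: "0 \<in> M" using M' by (simp add: right_submodule_def)
  have f0: "f 0 = 0" using fact[OF zero, of 0] by simp
  have "f ` M = module_span (f ` S)"
  proof
    have "right_submodule (f ` M)"
      unfolding right_submodule_def
    proof (intro conjI ballI allI)
      show "0 \<in> f ` M" using f0 zero by (metis imageI)
      fix u v a assume "u \<in> f ` M" "v \<in> f ` M"
      then obtain x y where xy: "u = f x" "v = f y" "x \<in> M" "y \<in> M" by blast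
      then show "u + v \<in> f ` M" using M' fadd by (metis imageI right_submodule_def)
    next
      fix u a assume "u \<in> f ` M"
      then obtain x where "u = f x" "x \<in> M" by blast
      then show "ract u a \<in> f ` M" using M' fact by (metis imageI right_submodule_def)
    qed
    then show "module_span (f ` S) \<subseteq> f ` M" by (rule module_span_least) (use SM in blast)
    have "M \<subseteq> {x \<in> M. f x \<in> module_span (f ` S)}"
      unfolding S(3)
    proof (rule module_span_least)
      have N: "right_submodule (module_span (f ` S))" by (rule right_submodule_span)
      show "right_submodule {x \<in> module_span S. f x \<in> module_span (f ` S)}"
        using M' N f0 fadd fact unfolding right_submodule_def S(3) by simp
      have "f ` S \<subseteq> module_span (f ` S)" using S(1) by (intro module_span_superset) simp
      then show "S \<subseteq> {x \<in> module_span S. f x \<in> module_span (f ` S)}" using SM S(3) by auto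
    qed
    then show "f ` M \<subseteq> module_span (f ` S)" by blast
  qed
  moreover have "finite (f ` S)" "f ` S \<subseteq> HA" using S(1) SM sub by auto
  ultimately show ?thesis unfolding finitely_generated_iff by blast
qed

lemma finitely_generated_image_coords:
  assumes "finitely_generated (coords ` A)" "map_on A f"
  shows "finitely_generated (coords ` f ` A)"
proof -
  have "finitely_generated ((\<lambda>x. coords (f (of_coords x))) ` coords ` A)"
  proof (rule finitely_generated_image[OF assms(1)])
    show "module_linear_on (coords ` A) (\<lambda>x. coords (f (of_coords x)))"
      using assms(2) unfolding module_linear_on_def map_on_def
      by (auto simp: coords_add[symmetric] coords_act[symmetric] coords_inverse simp del: coords_add coords_act)
  qed auto
  also have "(\<lambda>x. coords (f (of_coords x))) ` coords ` A = coords ` f ` A"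
    by (simp add: image_image coords_inverse)
  finally show ?thesis .
qed

lemma finitely_generated_iso_sub:
  assumes "finitely_generated (coords ` A)" "iso_sub A B" shows "finitely_generated (coords ` B)"
proof -
  obtain f g where "map_on A f" and s: "f ` A \<subseteq> B" "g ` B \<subseteq> A" "\<And>y. y \<in> B \<Longrightarrow> f (g y) = y"
    using assms(2) unfolding iso_sub_def by blast
  moreover have "f ` A = B"
  proof
    show "B \<subseteq> f ` A"
    proof
      fix y assume y: "y \<in> B"
      then have "g y \<in> A" using s by blast
      then show "y \<in> f ` A" using s(3)[OF y] by (metis imageI)
    qed
  qed (rule s)
  ultimately show ?thesis using finitely_generated_image_coords[OF assms(1)] by metis
qed

lemma right_submodule_coords: "right_submodule (coords ` A) \<longleftrightarrow>
    0 \<in> A \<and> (\<forall>x\<in>A. \<forall>y\<in>A. x + y \<in> A) \<and> (\<forall>x\<in>A. \<forall>a. act x a \<in> A)"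
  unfolding right_submodule_def
  by (simp add: coords_zero[symmetric] coords_add[symmetric] coords_act[symmetric] inj_image_mem_iff[OF inj_coords]
      del: coords_zero coords_add coords_act)

lemma finitely_generated_split_sum:
  fixes A B :: "'a::cstar_algebra std_module set"
  assumes A: "finitely_generated (coords ` A)" and B: "finitely_generated (coords ` B)"
  shows "finitely_generated (coords ` split_sum A B)"
proof -
  have "finitely_generated (coords ` inl ` A)" "finitely_generated (coords ` inr ` B)"
    by (intro finitely_generated_image_coords A B map_on_module_map module_map_inl module_map_inr)+
  then obtain S T where S: "finite S" "S \<subseteq> HA" "coords ` inl ` A = module_span S"
    and T: "finite T" "T \<subseteq> HA" "coords ` inr ` B = module_span T"
    unfolding finitely_generated_iff by blast
  have zero: "0 \<in> A" "0 \<in> B"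
    using finitely_generated_submodule[OF A] finitely_generated_submodule[OF B]
    by (simp_all add: right_submodule_coords)
  have sub: "coords ` inl ` A \<subseteq> coords ` split_sum A B" "coords ` inr ` B \<subseteq> coords ` split_sum A B"
    using zero by (auto simp: split_sum_def)
  have "coords ` split_sum A B = module_span (S \<union> T)"
  proof
    have ST: "S \<union> T \<subseteq> module_span (S \<union> T)" using S(1) T(1) by (intro module_span_superset) simp
    have "module_span S \<subseteq> module_span (S \<union> T)" "module_span T \<subseteq> module_span (S \<union> T)"
      using ST by (simp_all add: module_span_least[OF right_submodule_span])
    then have inc: "\<And>x. x \<in> A \<Longrightarrow> coords (inl x) \<in> module_span (S \<union> T)" "\<And>x. x \<in> B \<Longrightarrow> coords (inr x) \<in> module_span (S \<union> T)"
      unfolding S(3)[symmetric] T(3)[symmetric] by auto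
    show "coords ` split_sum A B \<subseteq> module_span (S \<union> T)"
    proof
      fix u assume "u \<in> coords ` split_sum A B"
      then obtain z where z: "u = coords z" "outl z \<in> A" "outr z \<in> B" by (auto simp: split_sum_def)
      have "u = coords (inl (outl z)) + coords (inr (outr z))"
        unfolding z(1) coords_add[symmetric] by simp
      then show "u \<in> module_span (S \<union> T)"
        using inc(1)[OF z(2)] inc(2)[OF z(3)] right_submodule_span[of "S \<union> T"] by (simp add: right_submodule_def)
    qed
    have "right_submodule (coords ` split_sum A B)"
    proof -
      have "right_submodule (coords ` A)" "right_submodule (coords ` B)"
        using A B by (simp_all add: finitely_generated_submodule)
      then show ?thesis
        unfolding right_submodule_coords by (simp add: split_sum_def split_simps)
    qed
    moreover have "S \<union> T \<subseteq> coords ` split_sum A B"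
      using module_span_superset[OF S(1)] module_span_superset[OF T(1)] sub
      unfolding S(3)[symmetric] T(3)[symmetric] by auto
    ultimately show "module_span (S \<union> T) \<subseteq> coords ` split_sum A B" by (rule module_span_least)
  qed
  moreover have "finite (S \<union> T)" "S \<union> T \<subseteq> HA" using S T by auto
  ultimately show ?thesis unfolding finitely_generated_iff by blast
qed

lemma finitely_generated_split_sumD:
  assumes AB: "finitely_generated (coords ` split_sum A B)" and zero: "0 \<in> A" "0 \<in> B"
  shows "finitely_generated (coords ` A)" "finitely_generated (coords ` B)"
proof -
  have "outl ` split_sum A B = A"
  proof
    show "A \<subseteq> outl ` split_sum A B"
    proof
      fix x assume "x \<in> A"
      then have "inl x \<in> split_sum A B" using zero by (simp add: split_sum_def)
      then show "x \<in> outl ` split_sum A B" by (metis imageI outl_inl)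
    qed
  qed (auto simp: split_sum_def)
  then show "finitely_generated (coords ` A)"
    using finitely_generated_image_coords[OF AB map_on_module_map[OF module_map_outl]] by simp
  have "outr ` split_sum A B = B"
  proof
    show "B \<subseteq> outr ` split_sum A B"
    proof
      fix x assume "x \<in> B"
      then have "inr x \<in> split_sum A B" using zero by (simp add: split_sum_def)
      then show "x \<in> outr ` split_sum A B" by (metis imageI outr_inr)
    qed
  qed (auto simp: split_sum_def)
  then show "finitely_generated (coords ` B)"
    using finitely_generated_image_coords[OF AB map_on_module_map[OF module_map_outr]] by simp
qed

section \<open>Finitely generated projective modules\<close>

definition initial_part :: "nat \<Rightarrow> 'a::cstar_algebra std_module set"
  where "initial_part n = {x. \<forall>i\<ge>n. coords x i = 0}"

definition cut_off :: "nat \<Rightarrow> 'a::cstar_algebra std_module \<Rightarrow> 'a std_module"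
  where "cut_off n x = of_coords (\<lambda>i. if i < n then coords x i else 0)"

lemma coords_cut_off: "coords (cut_off n x) = (\<lambda>i. if i < n then coords x i else 0)"
  unfolding cut_off_def by (rule of_coords_inverse, rule HA_if_finite_support[of n]) simp

lemma free_module_coords: "free_module n = coords ` (initial_part n :: 'a::cstar_algebra std_module set)"
proof
  show "(free_module n :: (nat \<Rightarrow> 'a) set) \<subseteq> coords ` initial_part n"
  proof
    fix x :: "nat \<Rightarrow> 'a" assume x: "x \<in> free_module n"
    then have "x \<in> HA" by (intro HA_if_finite_support[of n]) (simp add: free_module_def)
    then have c: "coords (of_coords x) = x" by (rule of_coords_inverse)
    then have "of_coords x \<in> initial_part n" using x by (simp add: initial_part_def free_module_def)
    then show "x \<in> coords ` initial_part n" using c by (metis imageI)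
  qed
qed (auto simp: free_module_def initial_part_def)

lemma col_norm_cut_off_le: "col_norm I (coords (cut_off n x)) \<le> col_norm I (coords x)" if "finite I"
proof -
  have "col_norm I (coords (cut_off n x)) = col_norm {i \<in> I. i < n} (coords x)"
    using that by (auto simp: col_norm_def coords_cut_off sum.inter_filter intro!: arg_cong[where f = norm] sum.cong)
  also have "\<dots> \<le> col_norm I (coords x)" by (rule col_norm_mono) (use that in auto)
  finally show ?thesis .
qed

lemma module_map_cut_off: "module_map (cut_off n)"
proof (rule module_mapI[where C = 1])
  show "norm (cut_off n x) \<le> 1 * norm x" for x :: "'a std_module"
  proof -
    have "col_norm {..<k} (coords (cut_off n x)) \<le> hnorm (coords x)" for k
      using col_norm_cut_off_le[of "{..<k}" n x] col_norm_le_hnorm[OF coords_HA, of "{..<k}" x] by simp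
    then show ?thesis by (simp add: norm_std_module_def hnorm_le_iff)
  qed
qed (auto simp: coords_eq_iff[symmetric] coords_cut_off fun_eq_iff ract_def)

lemma cut_off_in [simp]: "cut_off n x \<in> initial_part n"
  by (simp add: initial_part_def coords_cut_off)

lemma cut_off_id: "x \<in> initial_part n \<Longrightarrow> cut_off n x = x"
  by (auto simp: initial_part_def coords_eq_iff[symmetric] coords_cut_off fun_eq_iff)

lemma cut_off_tendsto: "(\<lambda>n. cut_off n x) \<longlonglongrightarrow> x"
proof (rule LIMSEQ_I)
  fix e :: real assume e: "e > 0"
  then obtain N where N: "\<And>m n. m \<ge> N \<Longrightarrow> col_norm {m..<n} (coords x) < e/2"
    using coords_HA[of x] unfolding HA_iff_col_norm by (meson half_gt_zero)
  have "norm (cut_off n x - x) \<le> e/2" if "n \<ge> N" for n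
  proof -
    have "col_norm {..<k} (coords (cut_off n x - x)) \<le> e/2" for k
    proof -
      have "star (coords (cut_off n x - x) i) * coords (cut_off n x - x) i
          = (if i < n then 0 else star (coords x i) * coords x i)" for i
        by (simp add: coords_cut_off star_minus)
      then have "(\<Sum>i<k. star (coords (cut_off n x - x) i) * coords (cut_off n x - x) i)
          = (\<Sum>i = n..<k. star (coords x i) * coords x i)"
        by (intro sum.mono_neutral_cong_right) auto
      then have "col_norm {..<k} (coords (cut_off n x - x)) = col_norm {n..<k} (coords x)"
        by (simp only: col_norm_def)
      then show ?thesis using N[OF that, of k] by simp
    qed
    then show ?thesis unfolding norm_std_module_def hnorm_le_iff[OF coords_HA] by blast
  qed
  then show "\<exists>no. \<forall>n\<ge>no. norm (cut_off n x - x) < e"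
    using e by (intro exI[of _ N]) fastforce
qed

lemma closed_sub_initial_part: "closed_sub (initial_part n :: 'a::cstar_algebra std_module set)"
proof -
  have "(initial_part n :: 'a std_module set) = {x. x - cut_off n x = 0}"
  proof (rule equalityI; rule subsetI)
    fix x :: "'a std_module" assume "x \<in> initial_part n"
    then show "x \<in> {x. x - cut_off n x = 0}" by (simp add: cut_off_id)
  next
    fix x :: "'a std_module" assume "x \<in> {x. x - cut_off n x = 0}"
    then have "x = cut_off n x" by simp
    then show "x \<in> initial_part n" using cut_off_in[of n x] by simp
  qed
  then show ?thesis
    using closed_sub_kernel[OF module_map_diff[OF module_map_ident module_map_cut_off]] by simp
qed

text \<open>
  A direct summand of a free module, up to isomorphism, is described by a split injection \<open>i\<close>. Its left
  inverse \<open>p\<close> can be required to be defined everywhere, because the free module is the range of a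
  bounded idempotent.
\<close>

definition projective_sub :: "'a::cstar_algebra std_module set \<Rightarrow> bool"
  where "projective_sub S \<longleftrightarrow> closed_sub S \<and> (\<exists>n i p. map_on S i \<and> i ` S \<subseteq> initial_part n
    \<and> module_map p \<and> range p \<subseteq> S \<and> (\<forall>x\<in>S. p (i x) = x))"

text \<open>
  From left to right, the complement \<open>B\<close> in the free module is enlarged by all coordinates beyond \<open>n\<close>.
  This yields a decomposition of the whole module, whose projection, followed by the isomorphism, is
  \<open>p\<close>. From right to left, \<open>i p\<close> preceded by the cut-off is an idempotent with range isomorphic to \<open>S\<close>.
\<close>

lemma fg_projective_coords:
  fixes S :: "'a::cstar_algebra std_module set"
  shows "fg_projective (coords ` S) \<longleftrightarrow> projective_sub S"
proof
  assume "fg_projective (coords ` S)"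
  then obtain n Q R where S: "closed_submodule (coords ` S)"
    and ds: "direct_sum (coords ` initial_part n) Q R" and iso: "isomorphic (coords ` S) Q"
    by (auto simp: fg_projective_def free_module_coords)
  obtain A B where AB: "Q = coords ` A" "R = coords ` B" "sub_sum (initial_part n) A B"
    using direct_sum_obtain[OF ds] by metis
  have cS: "closed_sub S" using S by (simp add: closed_submodule_coords)
  have c: "closed_sub A" "closed_sub B" and AB0: "A \<inter> B = {0}"
    and H: "initial_part n = {x + y | x y. x \<in> A \<and> y \<in> B}"
    using AB(3) by (auto simp: sub_sum_def)
  obtain f g where fg: "map_on S f" "map_on A g" "f ` S \<subseteq> A" "g ` A \<subseteq> S" "\<And>x. x \<in> S \<Longrightarrow> g (f x) = x"
    using iso unfolding AB(1) isomorphic_coords[OF cS c(1)] iso_sub_def by blast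
  \<comment> \<open>All vectors whose first \<open>n\<close> coordinates form an element of \<open>B\<close>.\<close>
  define T where "T = {x. cut_off n x \<in> B}"
  have A_sub: "A \<subseteq> initial_part n"
  proof
    fix x assume "x \<in> A"
    moreover have "0 \<in> B" using c by (simp add: closed_sub_def)
    ultimately have "x + 0 \<in> initial_part n" unfolding H by blast
    then show "x \<in> initial_part n" by simp
  qed
  have sum: "sub_sum UNIV A T"
    unfolding sub_sum_def
  proof (intro conjI c(1))
    have "closed (cut_off n -` B)"
      using c by (intro closed_vimage linear_continuous_on module_map_bounded_linear module_map_cut_off)
        (simp add: closed_sub_def)
    then show "closed_sub T"
      using c(2) by (simp add: T_def closed_sub_def vimage_def module_map_simps[OF module_map_cut_off]
          module_map_act[OF module_map_cut_off])
    show "A \<inter> T = {0}"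
    proof
      show "A \<inter> T \<subseteq> {0}"
      proof
        fix x assume "x \<in> A \<inter> T"
        then have "x \<in> A \<inter> B" using cut_off_id[of x n] A_sub by (auto simp: T_def)
        then show "x \<in> {0}" using AB0 by simp
      qed
    qed (use c in \<open>auto simp: T_def closed_sub_def module_map_simps(1)[OF module_map_cut_off]\<close>)
    have "z \<in> {x + y | x y. x \<in> A \<and> y \<in> T}" for z
    proof -
      have "cut_off n z \<in> initial_part n" by simp
      then obtain q r where qr: "cut_off n z = q + r" "q \<in> A" "r \<in> B" unfolding H by blast
      have "cut_off n q = q" using A_sub qr by (intro cut_off_id) auto
      moreover have "cut_off n (cut_off n z) = cut_off n z" by (intro cut_off_id) simp
      ultimately have "cut_off n (z - q) = r" using qr(1) by (simp add: module_map_simps[OF module_map_cut_off])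
      then have "z - q \<in> T" using qr by (simp add: T_def)
      then have "q \<in> A \<and> z - q \<in> T" using qr by simp
      moreover have "z = q + (z - q)" by simp
      ultimately show ?thesis by blast
    qed
    then show "UNIV = {x + y | x y. x \<in> A \<and> y \<in> T}" by blast
  qed
  obtain e where e: "module_map e" "\<And>x. e (e x) = e x" "range e = A"
    by (rule idempotent_of_sub_sum[OF sum], rule that)
  have "module_map (\<lambda>x. g (e x))"
    using map_on_comp[OF map_on_module_map[OF e(1), of UNIV] fg(2)] e(3) by (simp add: map_on_UNIV)
  moreover have "range (\<lambda>x. g (e x)) \<subseteq> S" using e(3) fg(4) by auto
  moreover have "g (e (f x)) = x" if "x \<in> S" for x
  proof -
    have "f x \<in> range e" using fg(3) that e(3) by auto
    then have "e (f x) = f x" using e(2) by auto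
    then show ?thesis using fg(5) that by simp
  qed
  moreover have "f ` S \<subseteq> initial_part n" using fg(3) A_sub by blast
  ultimately show "projective_sub S" unfolding projective_sub_def using cS fg(1) by blast
next
  assume "projective_sub S"
  then obtain n i p where cS: "closed_sub S" and ip: "map_on S i" "i ` S \<subseteq> initial_part n"
    "module_map p" "range p \<subseteq> S" "\<And>x. x \<in> S \<Longrightarrow> p (i x) = x"
    unfolding projective_sub_def by blast
  have pS: "p x \<in> S" for x using ip(4) by blast
  have iF: "i x \<in> initial_part n" if "x \<in> S" for x using ip(2) that by blast
  define q where "q = (\<lambda>x. i (p (cut_off n x)))"
  have mq: "module_map q"
    unfolding q_def map_on_UNIV[symmetric]
    by (rule map_on_comp[OF _ ip(1)])
      (auto simp: map_on_UNIV pS intro: module_map_comp[OF ip(3) module_map_cut_off])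
  have qi: "q (i x) = i x" if "x \<in> S" for x
    using that by (simp add: q_def cut_off_id iF ip(5))
  have qq: "q (q x) = q x" for x using qi[OF pS, of "cut_off n x"] by (simp add: q_def)
  have rq: "range q = i ` S"
  proof
    show "i ` S \<subseteq> range q" using qi by (metis image_subset_iff rangeI)
  qed (auto simp: q_def pS)
  have sum: "sub_sum UNIV (range q) {x. q x = 0}" by (rule sub_sum_of_idempotent[OF mq qq])
  define K where "K = {x. q x = 0} \<inter> initial_part n"
  have cI: "closed_sub (initial_part n :: 'a std_module set)" by (rule closed_sub_initial_part)
  have qF: "q x \<in> initial_part n" for x by (simp add: q_def iF pS)
  have "sub_sum (initial_part n) (range q) K"
    unfolding sub_sum_def
  proof (intro conjI)
    show "closed_sub (range q)" using sum by (simp add: sub_sum_def)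
    have "closed_sub {x. q x = 0}" using sum by (simp add: sub_sum_def)
    then show "closed_sub K" using cI unfolding K_def closed_sub_def by auto
    have "range q \<inter> {x. q x = 0} = {0}" using sum by (simp add: sub_sum_def)
    moreover have "0 \<in> initial_part n" by (simp add: initial_part_def)
    ultimately show "range q \<inter> K = {0}" unfolding K_def by blast
    show "initial_part n = {x + y | x y. x \<in> range q \<and> y \<in> K}"
    proof
      show "initial_part n \<subseteq> {x + y | x y. x \<in> range q \<and> y \<in> K}"
      proof
        fix z :: "'a std_module" assume z: "z \<in> initial_part n"
        have "z - q z \<in> K"
          using z qF[of z] by (simp add: K_def module_map_simps[OF mq] qq initial_part_def)
        moreover have "z = q z + (z - q z)" by simp
        ultimately show "z \<in> {x + y | x y. x \<in> range q \<and> y \<in> K}" by blast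
      qed
      show "{x + y | x y. x \<in> range q \<and> y \<in> K} \<subseteq> initial_part n"
      proof safe
        fix x y assume "y \<in> K"
        then show "q x + y \<in> initial_part n"
          using qF[of x] cI by (simp add: K_def closed_sub_def)
      qed
    qed
  qed
  then have "direct_sum (free_module n) (coords ` range q) (coords ` K)"
    by (simp add: free_module_coords direct_sum_coords)
  moreover have "iso_sub S (range q)"
    unfolding iso_sub_def
    by (intro exI[of _ i] exI[of _ p]) (auto simp: ip(1,5) rq pS map_on_module_map[OF ip(3)])
  then have "isomorphic (coords ` S) (coords ` range q)"
    using isomorphic_coords[OF cS] sum by (simp add: sub_sum_def)
  ultimately show "fg_projective (coords ` S)"
    unfolding fg_projective_def using cS closed_submodule_coords by blast
qed

lemma projective_sub_zero: "projective_sub {0}"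
proof -
  have "closed_sub {0}" by (simp add: closed_sub_def)
  moreover have "module_map (\<lambda>x. 0)" by (rule module_mapI[where C = 0]) auto
  ultimately show ?thesis
    unfolding projective_sub_def
    by (intro conjI exI[of _ 0] exI[of _ "\<lambda>x. x"] exI[of _ "\<lambda>x. 0"])
      (auto simp: initial_part_def intro: map_on_module_map module_map_ident)
qed

lemma projective_sub_split_sum:
  assumes "projective_sub A" "projective_sub B" shows "projective_sub (split_sum A B)"
proof -
  obtain n i p where A: "closed_sub A" "map_on A i" "i ` A \<subseteq> initial_part n"
    "module_map p" "range p \<subseteq> A" "\<And>x. x \<in> A \<Longrightarrow> p (i x) = x"
    using assms(1) unfolding projective_sub_def by blast
  obtain m j q where B: "closed_sub B" "map_on B j" "j ` B \<subseteq> initial_part m"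
    "module_map q" "range q \<subseteq> B" "\<And>x. x \<in> B \<Longrightarrow> q (j x) = x"
    using assms(2) unfolding projective_sub_def by blast
  have s: "\<And>x. x \<in> A \<Longrightarrow> i x \<in> initial_part n" "\<And>x. x \<in> B \<Longrightarrow> j x \<in> initial_part m"
    "\<And>x. p x \<in> A" "\<And>x. q x \<in> B" using A B by auto
  define f where "f = (\<lambda>z. inl (i (outl z)) + inr (j (outr z)))"
  define g where "g = (\<lambda>z. inl (p (outl z)) + inr (q (outr z)))"
  have "map_on (split_sum A B) f"
    unfolding f_def
  proof (rule map_on_add)
    show "map_on (split_sum A B) (\<lambda>z. inl (i (outl z)))"
      by (rule map_on_comp[OF map_on_comp[OF map_on_module_map[OF module_map_outl] A(2)]
            map_on_module_map[OF module_map_inl, of UNIV]]) (auto simp: split_sum_def)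
    show "map_on (split_sum A B) (\<lambda>z. inr (j (outr z)))"
      by (rule map_on_comp[OF map_on_comp[OF map_on_module_map[OF module_map_outr] B(2)]
            map_on_module_map[OF module_map_inr, of UNIV]]) (auto simp: split_sum_def)
  qed
  moreover have "f ` split_sum A B \<subseteq> initial_part (2 * max n m)"
  proof safe
    fix z assume z: "z \<in> split_sum A B"
    have "coords (i (outl z)) (k div 2) = 0" "coords (j (outr z)) (k div 2) = 0" if "k \<ge> 2 * max n m" for k
    proof -
      have "n \<le> k div 2" "m \<le> k div 2" using that by linarith+
      then show "coords (i (outl z)) (k div 2) = 0" "coords (j (outr z)) (k div 2) = 0"
        using z s(1)[of "outl z"] s(2)[of "outr z"] by (auto simp: split_sum_def initial_part_def)
    qed
    then show "f z \<in> initial_part (2 * max n m)"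
      by (simp add: initial_part_def f_def coords_inl_inr interleave_def del: coords_add)
  qed
  moreover have "module_map g"
    unfolding g_def
    by (rule module_map_add; rule module_map_comp[OF module_map_inl] module_map_comp[OF module_map_inr];
        rule module_map_comp[OF A(4) module_map_outl] module_map_comp[OF B(4) module_map_outr])
  moreover have "range g \<subseteq> split_sum A B" by (auto simp: g_def split_sum_def split_simps s)
  moreover have "g (f z) = z" if "z \<in> split_sum A B" for z
    using that by (simp add: f_def g_def split_sum_def split_simps A(6) B(6))
  ultimately show ?thesis
    unfolding projective_sub_def using closed_sub_split_sum[OF A(1) B(1)] by blast
qed

text \<open>
  The generators define a bounded map from a free module onto the Banach space \<open>A\<close>, to which the open
  mapping theorem applies.
\<close>

lemma bounded_coefficients:
  fixes A :: "'a::cstar_algebra std_module set"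
  assumes A: "closed_sub A" and fg: "finitely_generated (coords ` A)"
  shows "\<exists>(m::nat) s C. 0 \<le> C \<and> (\<forall>i<m. s i \<in> A) \<and>
    (\<forall>x\<in>A. \<exists>c. x = (\<Sum>i<m. act (s i) (c i)) \<and> (\<forall>i. norm (c i) \<le> C * norm x))"
proof -
  obtain S where S: "finite S" "S \<subseteq> HA" "coords ` A = module_span S"
    using fg by (auto simp: finitely_generated_iff)
  obtain t where t: "bij_betw t {..<card S} S"
    using ex_bij_betw_nat_finite[OF S(1)] by (auto simp: atLeast0LessThan)
  define m where "m = card S"
  define s where "s i = of_coords (t i)" for i
  have cs: "coords (s i) = t i" if "i < m" for i
    using t that S(2) by (auto simp: s_def m_def bij_betw_def intro!: of_coords_inverse)
  have sA: "s i \<in> A" if "i < m" for i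
  proof -
    have "t i \<in> S" using t that by (auto simp: m_def bij_betw_def)
    then have "coords (s i) \<in> coords ` A" using module_span_superset[OF S(1)] S(3) cs[OF that] by auto
    then show ?thesis by (simp add: inj_image_mem_iff[OF inj_coords])
  qed
  have coords_sum: "coords (\<Sum>i<m. f i) = (\<Sum>i<m. coords (f i))" for f :: "nat \<Rightarrow> 'a std_module"
    by (induction m) auto
  define T where "T c = (\<Sum>i<m. act (s i) (coords c i))" for c :: "'a std_module"
  have T: "bounded_linear T"
  proof (rule bounded_linear_intro)
    show "T (x + y) = T x + T y" for x y
      by (simp add: T_def sum.distrib[symmetric] coords_eq_iff[symmetric] coords_sum ract_add_right)
    show "T (r *\<^sub>R x) = r *\<^sub>R T x" for r x
    proof -
      have "act y (r *\<^sub>R a) = r *\<^sub>R act y a" for y :: "'a std_module" and a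
        by (simp add: coords_eq_iff[symmetric] ract_def)
      then show ?thesis by (simp add: T_def scaleR_sum_right)
    qed
    show "norm (T x) \<le> norm x * (\<Sum>i<m. norm (s i))" for x
    proof -
      have "norm (T x) \<le> (\<Sum>i<m. norm (s i) * norm (coords x i))"
        unfolding T_def by (intro sum_norm_le norm_act_le)
      also have "\<dots> \<le> (\<Sum>i<m. norm (s i) * norm x)"
        by (intro sum_mono mult_left_mono) (auto simp: norm_std_module_def norm_coord_le_hnorm)
      finally show ?thesis by (simp add: sum_distrib_left mult.commute)
    qed
  qed
  have im: "T ` initial_part m = A"
  proof
    have sub: "subspace A" by (rule closed_sub_subspace[OF A])
    show "T ` initial_part m \<subseteq> A"
      unfolding T_def using A sA by (auto intro!: subspace_sum[OF sub] simp: closed_sub_def)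
    show "A \<subseteq> T ` initial_part m"
    proof
      fix x assume "x \<in> A"
      then have "coords x \<in> module_span S" using S(3) by blast
      then obtain c where c: "coords x = (\<Sum>u\<in>S. ract u (c u))" by (auto simp: module_span_def)
      define d where "d = of_coords (\<lambda>i. if i < m then c (t i) else 0)"
      have cd: "coords d = (\<lambda>i. if i < m then c (t i) else 0)"
        unfolding d_def by (rule of_coords_inverse, rule HA_if_finite_support[of m]) simp
      have "coords (T d) = (\<Sum>i<m. ract (t i) (c (t i)))"
        by (simp add: T_def coords_sum cs cd)
      also have "\<dots> = coords x" unfolding c m_def by (rule sum.reindex_bij_betw[OF t])
      finally have "T d = x" by (simp add: coords_eq_iff)
      moreover have "d \<in> initial_part m" by (simp add: initial_part_def cd)
      ultimately show "x \<in> T ` initial_part m" by blast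
    qed
  qed
  have cI: "closed_sub (initial_part m :: 'a std_module set)" by (rule closed_sub_initial_part)
  then have "subspace (initial_part m :: 'a std_module set)" "closed (initial_part m :: 'a std_module set)"
    by (rule closed_sub_subspace) (use cI in \<open>simp add: closed_sub_def\<close>)
  moreover have "closed (T ` initial_part m)" unfolding im using A by (simp add: closed_sub_def)
  ultimately obtain C where C: "0 \<le> C" "\<And>y. y \<in> A \<Longrightarrow> \<exists>c\<in>initial_part m. T c = y \<and> norm c \<le> C * norm y"
    using bounded_preimages[OF T, of "initial_part m"] unfolding im by blast
  have "\<exists>c. x = (\<Sum>i<m. act (s i) (c i)) \<and> (\<forall>i. norm (c i) \<le> C * norm x)" if x: "x \<in> A" for x
  proof -
    obtain c where c: "T c = x" "norm c \<le> C * norm x" using C(2) x by blast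
    have "norm (coords c i) \<le> C * norm x" for i
      using norm_coord_le_hnorm[OF coords_HA, of c i] c(2) by (simp add: norm_std_module_def)
    then show ?thesis using c(1) unfolding T_def by (intro exI[of _ "coords c"]) simp
  qed
  then show ?thesis using C(1) sA by (intro exI[of _ m] exI[of _ s] exI[of _ C]) simp
qed

text \<open>
  The maps \<open>e (cut_off n x)\<close> tend to \<open>x\<close> for each of the finitely many generators \<open>x\<close>. As coefficients
  are bounded by the norm, the convergence is uniform on bounded parts of the range. For
  large \<open>n\<close> the map \<open>e\<close> after \<open>cut_off n\<close> is therefore invertible on the range of \<open>e\<close>, and the
  identity of the range factors through the first \<open>n\<close> coordinates.
\<close>

lemma projective_sub_of_finitely_generated:
  fixes e :: "'a::cstar_algebra std_module \<Rightarrow> 'a std_module"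
  assumes e: "module_map e" "\<And>x. e (e x) = e x" and fg: "finitely_generated (coords ` range e)"
  shows "projective_sub (range e)"
proof -
  have A: "closed_sub (range e)" using sub_sum_of_idempotent[OF e] by (simp add: sub_sum_def)
  have eid: "e x = x" if "x \<in> range e" for x using that e(2) by auto
  obtain m :: nat and s C where C: "0 \<le> C" and s: "\<forall>i<m. s i \<in> range e"
    and coeff: "\<forall>x\<in>range e. \<exists>c. x = (\<Sum>i<m. act (s i) (c i)) \<and> (\<forall>i. norm (c i) \<le> C * norm x)"
    by (insert bounded_coefficients[OF A fg], elim exE conjE, rule that)
  obtain B where B: "0 \<le> B" "\<And>x. norm (e x) \<le> B * norm x" using module_map_bounded[OF e(1)] by blast
  \<comment> \<open>The error of the approximation on the range of \<open>e\<close>.\<close>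
  define \<delta> where "\<delta> n = (\<lambda>x. e (cut_off n x) - e x)" for n
  have m\<delta>: "module_map (\<delta> n)" for n
    unfolding \<delta>_def by (rule module_map_diff[OF module_map_comp[OF e(1) module_map_cut_off] e(1)])
  have lim: "(\<lambda>n. (\<Sum>i<m. norm (\<delta> n (s i)) * C) * B) \<longlonglongrightarrow> 0"
  proof -
    have "(\<lambda>n. \<delta> n (s i)) \<longlonglongrightarrow> 0" for i
      using tendsto_diff[OF bounded_linear.tendsto[OF module_map_bounded_linear[OF e(1)] cut_off_tendsto] tendsto_const, of "s i" "e (s i)"]
      by (simp add: \<delta>_def)
    then show ?thesis by (intro tendsto_mult_left_zero tendsto_null_sum tendsto_norm_zero)
  qed
  then obtain n where n: "(\<Sum>i<m. norm (\<delta> n (s i)) * C) * B < 1/2"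
    using order_tendstoD(2)[OF lim, of "1/2"] by (auto simp: eventually_sequentially)
  define K where "K = (\<lambda>x. \<delta> n (e x))"
  have mK: "module_map K" unfolding K_def by (rule module_map_comp[OF m\<delta> e(1)])
  have K: "norm (K x) \<le> 1/2 * norm x" for x
  proof -
    obtain c where c: "e x = (\<Sum>i<m. act (s i) (c i))" "\<And>i. norm (c i) \<le> C * norm (e x)"
      using bspec[OF coeff rangeI, of x] by blast
    have "K x = (\<Sum>i<m. act (\<delta> n (s i)) (c i))"
    proof -
      interpret L: bounded_linear "\<delta> n" by (rule module_map_bounded_linear[OF m\<delta>])
      show ?thesis unfolding K_def c(1) L.sum by (simp add: module_map_act[OF m\<delta>])
    qed
    also have "norm \<dots> \<le> (\<Sum>i<m. norm (\<delta> n (s i)) * norm (c i))" by (intro sum_norm_le norm_act_le)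
    also have "\<dots> \<le> (\<Sum>i<m. norm (\<delta> n (s i)) * (C * norm (e x)))" by (intro sum_mono mult_left_mono c) auto
    also have "\<dots> = (\<Sum>i<m. norm (\<delta> n (s i)) * C) * norm (e x)" by (simp add: sum_distrib_right mult.assoc)
    also have "\<dots> \<le> (\<Sum>i<m. norm (\<delta> n (s i)) * C) * (B * norm x)"
      using C by (intro mult_left_mono B sum_nonneg) auto
    also have "\<dots> \<le> 1/2 * norm x" using mult_right_mono[OF less_imp_le[OF n] norm_ge_zero[of x]] by (simp add: mult.assoc)
    finally show ?thesis .
  qed
  obtain R where R: "module_map R" "\<And>x. R (x + K x) = x" "\<And>y. R y + K (R y) = y"
    using neumann_inverse[OF mK _ K] by auto
  have xK: "x + K x = e (cut_off n x)" if "x \<in> range e" for x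
    using eid[OF that] by (simp add: K_def \<delta>_def)
  have Ke: "K x \<in> range e" for x
  proof -
    have "K x = e (cut_off n (e x) - e x)" by (simp add: K_def \<delta>_def module_map_simps[OF e(1)])
    then show ?thesis by blast
  qed
  have Re: "R y \<in> range e" if "y \<in> range e" for y
  proof -
    have "y - K (R y) \<in> range e" using closed_sub_subspace[OF A] that Ke by (intro subspace_diff)
    moreover have "y - K (R y) = R y" using R(3)[of y] by (metis add_diff_cancel_right')
    ultimately show ?thesis by simp
  qed
  have "module_map (\<lambda>x. R (e x))" by (rule module_map_comp[OF R(1) e(1)])
  moreover have "range (\<lambda>x. R (e x)) \<subseteq> range e" using Re by blast
  moreover have "R (e (cut_off n x)) = x" if "x \<in> range e" for x
    using R(2)[of x] xK[OF that] by simp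
  moreover have "cut_off n ` range e \<subseteq> initial_part n" by auto
  ultimately show ?thesis
    unfolding projective_sub_def using A map_on_module_map[OF module_map_cut_off, of "range e" n]
    by (intro conjI exI[of _ n] exI[of _ "cut_off n"] exI[of _ "\<lambda>x. R (e x)"]) auto
qed

section \<open>The group $K_0$\<close>

lemma fg_projective_obtain:
  assumes "fg_projective P"
  obtains S where "P = coords ` S" "closed_sub S" "projective_sub S"
proof -
  have "closed_submodule P" using assms by (simp add: fg_projective_def)
  then obtain S where S: "P = coords ` S" "closed_sub S" using closed_submodule_obtain by blast
  then have "projective_sub S" using assms fg_projective_coords by blast
  with S show thesis by (rule that)
qed

lemma fg_projective_ext_sum:
  assumes "fg_projective P" "fg_projective Q" shows "fg_projective (ext_sum P Q)"
proof -
  obtain S T where S: "P = coords ` S" "projective_sub S" and T: "Q = coords ` T" "projective_sub T"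
    using assms fg_projective_obtain by metis
  then show ?thesis by (simp add: ext_sum_coords fg_projective_coords projective_sub_split_sum)
qed

lemma closed_sub_zero: "closed_sub {0}"
  by (simp add: closed_sub_def)

lemma fg_projective_zero: "fg_projective ({0} :: (nat \<Rightarrow> 'a::cstar_algebra) set)"
  using fg_projective_coords[of "{0} :: 'a std_module set"] by (simp add: projective_sub_zero)

lemma isomorphic_refl: "fg_projective P \<Longrightarrow> isomorphic P P"
  by (metis fg_projective_obtain isomorphic_coords iso_sub_refl)

lemma isomorphic_sym: "fg_projective P \<Longrightarrow> fg_projective Q \<Longrightarrow> isomorphic P Q \<Longrightarrow> isomorphic Q P"
  by (metis fg_projective_obtain isomorphic_coords iso_sub_sym)

lemma isomorphic_trans:
  assumes "fg_projective P" "fg_projective Q" "fg_projective R" "isomorphic P Q" "isomorphic Q R"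
  shows "isomorphic P R"
proof -
  obtain A B C where "P = coords ` A" "closed_sub A" "Q = coords ` B" "closed_sub B" "R = coords ` C" "closed_sub C"
    using assms(1-3) fg_projective_obtain by metis
  then show ?thesis using assms(4,5) iso_sub_trans[of A B C] by (simp add: isomorphic_coords)
qed

text \<open>
  Isomorphism classes as a type of class \<open>comm_monoid_add\<close>: the rearrangements of external sums in the
  Grothendieck construction become equations between sums.
\<close>

quotient_type (overloaded) 'a proj_class = "(nat \<Rightarrow> 'a::cstar_algebra) set" /
  partial: "\<lambda>P Q. fg_projective P \<and> fg_projective Q \<and> isomorphic P Q"
proof (rule part_equivpI)
  show "\<exists>P::(nat \<Rightarrow> 'a) set. fg_projective P \<and> fg_projective P \<and> isomorphic P P"
    using fg_projective_zero isomorphic_refl by blast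
  show "symp (\<lambda>P Q::(nat \<Rightarrow> 'a) set. fg_projective P \<and> fg_projective Q \<and> isomorphic P Q)"
    by (auto simp: symp_def intro: isomorphic_sym)
  show "transp (\<lambda>P Q::(nat \<Rightarrow> 'a) set. fg_projective P \<and> fg_projective Q \<and> isomorphic P Q)"
    unfolding transp_def using isomorphic_trans by blast
qed

instantiation proj_class :: (cstar_algebra) comm_monoid_add
begin

lift_definition zero_proj_class :: "'a proj_class" is "{0}"
  by (simp add: fg_projective_zero isomorphic_refl)

lift_definition plus_proj_class :: "'a proj_class \<Rightarrow> 'a proj_class \<Rightarrow> 'a proj_class" is ext_sum
proof -
  fix P P' Q Q' :: "(nat \<Rightarrow> 'a) set"
  assume P: "fg_projective P \<and> fg_projective P' \<and> isomorphic P P'"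
    and Q: "fg_projective Q \<and> fg_projective Q' \<and> isomorphic Q Q'"
  obtain A A' where A: "P = coords ` A" "closed_sub A" "P' = coords ` A'" "closed_sub A'"
    using P fg_projective_obtain by metis
  obtain B B' where B: "Q = coords ` B" "closed_sub B" "Q' = coords ` B'" "closed_sub B'"
    using Q fg_projective_obtain by metis
  have "iso_sub A A'" "iso_sub B B'" using P Q A B by (simp_all add: isomorphic_coords)
  then have "isomorphic (ext_sum P Q) (ext_sum P' Q')"
    using A B by (simp add: ext_sum_coords isomorphic_coords closed_sub_split_sum iso_sub_split_sum_cong)
  then show "fg_projective (ext_sum P Q) \<and> fg_projective (ext_sum P' Q') \<and> isomorphic (ext_sum P Q) (ext_sum P' Q')"
    using P Q by (simp add: fg_projective_ext_sum)
qed

instance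
proof
  fix a b c :: "'a proj_class"
  show "a + b + c = a + (b + c)"
  proof transfer
    fix P Q R :: "(nat \<Rightarrow> 'a) set"
    assume f: "fg_projective P \<and> fg_projective P \<and> isomorphic P P" "fg_projective Q \<and> fg_projective Q \<and> isomorphic Q Q"
      "fg_projective R \<and> fg_projective R \<and> isomorphic R R"
    obtain A B C where "P = coords ` A" "closed_sub A" "Q = coords ` B" "closed_sub B" "R = coords ` C" "closed_sub C"
      using f fg_projective_obtain by metis
    then have "isomorphic (ext_sum (ext_sum P Q) R) (ext_sum P (ext_sum Q R))"
      by (simp add: ext_sum_coords isomorphic_coords closed_sub_split_sum iso_sub_split_sum_assoc)
    then show "fg_projective (ext_sum (ext_sum P Q) R) \<and> fg_projective (ext_sum P (ext_sum Q R)) \<and>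
      isomorphic (ext_sum (ext_sum P Q) R) (ext_sum P (ext_sum Q R))"
      using f by (simp add: fg_projective_ext_sum)
  qed
  show comm: "a + b = b + a" for a b :: "'a proj_class"
  proof transfer
    fix P Q :: "(nat \<Rightarrow> 'a) set"
    assume f: "fg_projective P \<and> fg_projective P \<and> isomorphic P P" "fg_projective Q \<and> fg_projective Q \<and> isomorphic Q Q"
    obtain A B where "P = coords ` A" "closed_sub A" "Q = coords ` B" "closed_sub B"
      using f fg_projective_obtain by metis
    then have "isomorphic (ext_sum P Q) (ext_sum Q P)"
      by (simp add: ext_sum_coords isomorphic_coords closed_sub_split_sum iso_sub_split_sum_commute)
    then show "fg_projective (ext_sum P Q) \<and> fg_projective (ext_sum Q P) \<and> isomorphic (ext_sum P Q) (ext_sum Q P)"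
      using f by (simp add: fg_projective_ext_sum)
  qed
  have "a + 0 = a"
  proof transfer
    fix P :: "(nat \<Rightarrow> 'a) set"
    assume f: "fg_projective P \<and> fg_projective P \<and> isomorphic P P"
    then obtain A where A: "P = coords ` A" "closed_sub A" using fg_projective_obtain by metis
    have "isomorphic (ext_sum (coords ` A) (coords ` {0})) (coords ` A)"
      unfolding ext_sum_coords using A
      by (subst isomorphic_coords) (simp_all add: closed_sub_split_sum closed_sub_zero iso_sub_split_sum_zero)
    then show "fg_projective (ext_sum P {0}) \<and> fg_projective P \<and> isomorphic (ext_sum P {0}) P"
      using f by (simp add: fg_projective_ext_sum fg_projective_zero A)
  qed
  then show "0 + a = a" by (simp add: comm[of 0 a])
qed

end

definition proj_class :: "(nat \<Rightarrow> 'a::cstar_algebra) set \<Rightarrow> 'a proj_class"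
  where "proj_class P = abs_proj_class P"

lemma proj_class_eq_iff:
  assumes "fg_projective P" "fg_projective Q"
  shows "proj_class P = proj_class Q \<longleftrightarrow> isomorphic P Q"
  using Quotient_rel[OF Quotient_proj_class, of P Q] assms
  by (simp add: proj_class_def isomorphic_refl)

lemma proj_class_ext_sum:
  "fg_projective P \<Longrightarrow> fg_projective Q \<Longrightarrow> proj_class (ext_sum P Q) = proj_class P + proj_class Q"
  unfolding proj_class_def by (simp add: plus_proj_class.abs_eq isomorphic_refl)

lemma proj_class_zero: "proj_class {0} = 0"
  by (simp add: proj_class_def zero_proj_class_def)

lemma proj_class_surj: obtains P where "fg_projective P" "r = proj_class P"
proof -
  have "fg_projective (rep_proj_class r)" "abs_proj_class (rep_proj_class r) = r"
    using Quotient_rep_reflp[OF Quotient_proj_class, of r] Quotient_abs_rep[OF Quotient_proj_class, of r] by auto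
  then show thesis using that[of "rep_proj_class r"] by (simp add: proj_class_def)
qed

lemma k0_rel_iff:
  "((P, Q), (P', Q')) \<in> k0_rel \<longleftrightarrow> fg_projective P \<and> fg_projective Q \<and> fg_projective P' \<and> fg_projective Q' \<and>
    (\<exists>r. proj_class P + proj_class Q' + r = proj_class P' + proj_class Q + r)"
proof -
  have "(\<exists>R. fg_projective R \<and> isomorphic (ext_sum (ext_sum P Q') R) (ext_sum (ext_sum P' Q) R)) \<longleftrightarrow>
      (\<exists>r. proj_class P + proj_class Q' + r = proj_class P' + proj_class Q + r)" (is "?L \<longleftrightarrow> ?R")
    if f: "fg_projective P" "fg_projective Q" "fg_projective P'" "fg_projective Q'"
  proof -
    have *: "isomorphic (ext_sum (ext_sum P Q') R) (ext_sum (ext_sum P' Q) R) \<longleftrightarrow>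
      proj_class P + proj_class Q' + proj_class R = proj_class P' + proj_class Q + proj_class R" if "fg_projective R" for R
      using f that by (simp add: proj_class_eq_iff[symmetric] fg_projective_ext_sum proj_class_ext_sum)
    show ?thesis using * by (metis proj_class_surj)
  qed
  then show ?thesis unfolding k0_rel_def by auto
qed

lemma equiv_k0_rel: "equiv (Collect fg_projective \<times> Collect fg_projective) k0_rel"
proof (rule equivI)
  show "k0_rel \<subseteq> (Collect fg_projective \<times> Collect fg_projective) \<times> (Collect fg_projective \<times> Collect fg_projective)"
    by (auto simp: k0_rel_iff)
  show "refl_on (Collect fg_projective \<times> Collect fg_projective) k0_rel"
    by (auto simp: refl_on_def k0_rel_iff)
  show "sym k0_rel"
  proof (rule symI, clarify)
    fix P Q P' Q' assume "((P, Q), (P', Q')) \<in> k0_rel"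
    then show "((P', Q'), (P, Q)) \<in> k0_rel" unfolding k0_rel_iff by metis
  qed
  show "trans k0_rel"
  proof (rule transI, clarify)
    fix P Q P' Q' P'' Q''
    assume "((P, Q), (P', Q')) \<in> k0_rel" "((P', Q'), (P'', Q'')) \<in> k0_rel"
    then obtain r s where f: "fg_projective P" "fg_projective Q" "fg_projective P''" "fg_projective Q''"
      and r: "proj_class P + proj_class Q' + r = proj_class P' + proj_class Q + r"
      and s: "proj_class P' + proj_class Q'' + s = proj_class P'' + proj_class Q' + s"
      unfolding k0_rel_iff by blast
    \<comment> \<open>The witness for transitivity has to contain \<open>Q'\<close>, as cancellation is not possible in the monoid.\<close>
    have "proj_class P + proj_class Q'' + (proj_class Q' + r + s) = (proj_class P + proj_class Q' + r) + (proj_class Q'' + s)"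
      by (simp only: add_ac)
    also have "\<dots> = (proj_class P' + proj_class Q'' + s) + (proj_class Q + r)" unfolding r by (simp only: add_ac)
    also have "\<dots> = proj_class P'' + proj_class Q + (proj_class Q' + r + s)" unfolding s by (simp only: add_ac)
    finally show "((P, Q), (P'', Q'')) \<in> k0_rel" unfolding k0_rel_iff using f by blast
  qed
qed

definition formal_difference ::
  "(nat \<Rightarrow> 'a::cstar_algebra) set \<Rightarrow> (nat \<Rightarrow> 'a) set \<Rightarrow> ((nat \<Rightarrow> 'a) set \<times> (nat \<Rightarrow> 'a) set) set"
  where "formal_difference P Q = k0_rel `` {(P, Q)}"

lemma formal_difference_eq_iff:
  assumes "fg_projective P" "fg_projective Q" "fg_projective P'" "fg_projective Q'"
  shows "formal_difference P Q = formal_difference P' Q' \<longleftrightarrow>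
    (\<exists>r. proj_class P + proj_class Q' + r = proj_class P' + proj_class Q + r)"
  unfolding formal_difference_def
  using eq_equiv_class_iff[OF equiv_k0_rel, of "(P, Q)" "(P', Q')"] assms by (simp add: k0_rel_iff)

lemma formal_difference_carrier:
  "fg_projective P \<Longrightarrow> fg_projective Q \<Longrightarrow> formal_difference P Q \<in> carrier K0"
  unfolding K0_def formal_difference_def by (auto intro: quotientI)

lemma K0_carrier_obtain:
  assumes "X \<in> carrier K0"
  obtains P Q where "fg_projective P" "fg_projective Q" "X = formal_difference P Q"
  using assms unfolding K0_def formal_difference_def by (auto elim!: quotientE)

lemma K0_mult:
  assumes f: "fg_projective P" "fg_projective Q" "fg_projective P'" "fg_projective Q'"
  shows "formal_difference P Q \<otimes>\<^bsub>K0\<^esub> formal_difference P' Q' = formal_difference (ext_sum P P') (ext_sum Q Q')"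
proof -
  have 1: "formal_difference (ext_sum A A') (ext_sum B B') = formal_difference (ext_sum P P') (ext_sum Q Q')"
    if m: "(A, B) \<in> formal_difference P Q" "(A', B') \<in> formal_difference P' Q'" for A B A' B'
  proof -
    obtain r s where g: "fg_projective A" "fg_projective B" "fg_projective A'" "fg_projective B'"
      and r: "proj_class P + proj_class B + r = proj_class A + proj_class Q + r"
      and s: "proj_class P' + proj_class B' + s = proj_class A' + proj_class Q' + s"
      using m unfolding formal_difference_def by (auto simp: k0_rel_iff)
    have "(proj_class A + proj_class A') + (proj_class Q + proj_class Q') + (r + s)
        = (proj_class A + proj_class Q + r) + (proj_class A' + proj_class Q' + s)" by (simp only: add_ac)
    also have "\<dots> = (proj_class P + proj_class P') + (proj_class B + proj_class B') + (r + s)"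
      unfolding r[symmetric] s[symmetric] by (simp only: add_ac)
    finally show ?thesis
      using f g by (subst formal_difference_eq_iff) (auto simp: fg_projective_ext_sum proj_class_ext_sum)
  qed
  have mem: "(P, Q) \<in> formal_difference P Q" "(P', Q') \<in> formal_difference P' Q'"
    using f by (auto simp: formal_difference_def k0_rel_iff)
  have "formal_difference P Q \<otimes>\<^bsub>K0\<^esub> formal_difference P' Q' =
      (\<Union>(A, B)\<in>formal_difference P Q. \<Union>(A', B')\<in>formal_difference P' Q'. formal_difference (ext_sum A A') (ext_sum B B'))"
    by (simp add: K0_def formal_difference_def)
  also have "\<dots> = (\<Union>(A, B)\<in>formal_difference P Q. \<Union>(A', B')\<in>formal_difference P' Q'. formal_difference (ext_sum P P') (ext_sum Q Q'))"
    by (intro SUP_cong refl) (auto simp: 1)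
  also have "\<dots> = formal_difference (ext_sum P P') (ext_sum Q Q')" using mem by auto
  finally show ?thesis .
qed

lemma K0_one: "\<one>\<^bsub>K0\<^esub> = formal_difference {0} {0}"
  by (simp add: K0_def formal_difference_def)

text \<open>
  The inverse of a formal difference exchanges its two entries.
\<close>

theorem comm_group_K0: "comm_group (K0 :: ((nat \<Rightarrow> 'a::cstar_algebra) set \<times> (nat \<Rightarrow> 'a) set) set monoid)"
proof (rule comm_groupI)
  note simps = K0_mult K0_one formal_difference_eq_iff fg_projective_ext_sum fg_projective_zero
    proj_class_ext_sum proj_class_zero formal_difference_carrier
  show "\<one>\<^bsub>K0\<^esub> \<in> carrier (K0 :: ((nat \<Rightarrow> 'a) set \<times> (nat \<Rightarrow> 'a) set) set monoid)" by (simp add: simps)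
  fix X Y Z :: "((nat \<Rightarrow> 'a) set \<times> (nat \<Rightarrow> 'a) set) set"
  assume X: "X \<in> carrier K0"
  obtain P Q where P: "fg_projective P" "fg_projective Q" "X = formal_difference P Q"
    by (rule K0_carrier_obtain[OF X])
  show "\<one>\<^bsub>K0\<^esub> \<otimes>\<^bsub>K0\<^esub> X = X" using P by (simp add: simps add_ac)
  show "\<exists>y\<in>carrier K0. y \<otimes>\<^bsub>K0\<^esub> X = \<one>\<^bsub>K0\<^esub>"
    by (rule bexI[of _ "formal_difference Q P"]) (use P in \<open>simp_all add: simps add_ac\<close>)
  assume Y: "Y \<in> carrier K0"
  obtain P' Q' where P': "fg_projective P'" "fg_projective Q'" "Y = formal_difference P' Q'"
    by (rule K0_carrier_obtain[OF Y])
  show "X \<otimes>\<^bsub>K0\<^esub> Y \<in> carrier K0" using P P' by (simp add: simps)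
  show "X \<otimes>\<^bsub>K0\<^esub> Y = Y \<otimes>\<^bsub>K0\<^esub> X" using P P' by (simp add: simps add_ac)
  assume Z: "Z \<in> carrier K0"
  obtain P'' Q'' where P'': "fg_projective P''" "fg_projective Q''" "Z = formal_difference P'' Q''"
    by (rule K0_carrier_obtain[OF Z])
  show "X \<otimes>\<^bsub>K0\<^esub> Y \<otimes>\<^bsub>K0\<^esub> Z = X \<otimes>\<^bsub>K0\<^esub> (Y \<otimes>\<^bsub>K0\<^esub> Z)" using P P' P'' by (simp add: simps add_ac)
qed

lemma k0_class_difference:
  assumes "fg_projective P" "fg_projective Q"
  shows "k0_class P \<otimes>\<^bsub>K0\<^esub> inv\<^bsub>K0\<^esub> (k0_class Q) = formal_difference P Q"
proof -
  interpret comm_group "K0 :: ((nat \<Rightarrow> 'a) set \<times> (nat \<Rightarrow> 'a) set) set monoid" by (rule comm_group_K0)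
  have k: "k0_class N = formal_difference N {0}" for N :: "(nat \<Rightarrow> 'a) set"
    by (simp add: k0_class_def formal_difference_def)
  note simps = K0_mult K0_one formal_difference_eq_iff fg_projective_ext_sum fg_projective_zero
    proj_class_ext_sum proj_class_zero formal_difference_carrier
  have "inv\<^bsub>K0\<^esub> (k0_class Q) = formal_difference {0} Q"
    unfolding k by (rule inv_equality) (use assms in \<open>simp_all add: simps\<close>)
  then show ?thesis using assms by (simp add: k simps)
qed

section \<open>Semi-Fredholm operators and their index\<close>

abbreviation fg_sub :: "'a::cstar_algebra std_module set \<Rightarrow> bool"
  where "fg_sub S \<equiv> finitely_generated (coords ` S)"

lemma ex_fredholm_decomp_iff:
  assumes F: "F \<in> adjointable_ops"
  shows "(\<exists>M1 N1 M2 N2. fredholm_decomp F M1 N1 M2 N2 \<and> P N1 N2) \<longleftrightarrow>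
    (\<exists>G. outer_inverse (op_map F) G \<and> P (coords ` domain_defect (op_map F) G) (coords ` codomain_defect G))"
proof safe
  fix M1 N1 M2 N2 assume dec: "fredholm_decomp F M1 N1 M2 N2" and P: "P N1 N2"
  show "\<exists>G. outer_inverse (op_map F) G \<and> P (coords ` domain_defect (op_map F) G) (coords ` codomain_defect G)"
    by (rule outer_inverse_of_fredholm_decomp[OF F dec]) (use P in auto)
qed (use fredholm_decomp_of_outer_inverse[OF F] in blast)

lemma MPhi_plus_iff: "F \<in> MPhi_plus \<longleftrightarrow> F \<in> adjointable_ops \<and>
    (\<exists>G. outer_inverse (op_map F) G \<and> fg_sub (domain_defect (op_map F) G))"
  using ex_fredholm_decomp_iff[of F "\<lambda>N1 N2. finitely_generated N1"] by (auto simp: MPhi_plus_def)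

lemma MPhi_minus_iff: "F \<in> MPhi_minus \<longleftrightarrow> F \<in> adjointable_ops \<and>
    (\<exists>G. outer_inverse (op_map F) G \<and> fg_sub (codomain_defect G))"
  using ex_fredholm_decomp_iff[of F "\<lambda>N1 N2. finitely_generated N2"] by (auto simp: MPhi_minus_def)

lemma MPhi_iff: "F \<in> MPhi \<longleftrightarrow> F \<in> adjointable_ops \<and>
    (\<exists>G. outer_inverse (op_map F) G \<and> fg_sub (domain_defect (op_map F) G) \<and> fg_sub (codomain_defect G))"
  using ex_fredholm_decomp_iff[of F "\<lambda>N1 N2. finitely_generated N1 \<and> finitely_generated N2"]
  by (auto simp: MPhi_def)

lemma MPhi_subset: "MPhi \<subseteq> MPhi_plus" "MPhi \<subseteq> MPhi_minus" "MPhi_zero \<subseteq> MPhi"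
  by (auto simp: MPhi_plus_def MPhi_minus_def MPhi_def MPhi_zero_def)

lemma zero_in_defects:
  assumes "module_map F" "outer_inverse F G"
  shows "0 \<in> domain_defect F G" "0 \<in> codomain_defect G"
proof -
  have "module_map G" using assms(2) by (simp add: outer_inverse_def)
  then show "0 \<in> domain_defect F G" "0 \<in> codomain_defect G"
    using module_map_simps(1)[OF assms(1)] module_map_simps(1)[of G]
    by (simp_all add: domain_defect_def codomain_defect_def)
qed

text \<open>
  Consider the triples \<open>(x, y, y')\<close> with \<open>F x + y + y' = 0\<close>, where \<open>y\<close> lies in the kernel of \<open>G\<close> and
  \<open>y'\<close> in that of \<open>G'\<close>. Forgetting \<open>y\<close> and replacing \<open>x\<close> by its component in the kernel of \<open>G F\<close>
  identifies them with the first sum; the same with \<open>G\<close> and \<open>G'\<close> exchanged gives the second sum. The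
  map \<open>\<Phi>\<close> is the composition of these two identifications.
\<close>

lemma iso_sub_defects:
  assumes F: "module_map F" and G: "outer_inverse F G" and G': "outer_inverse F G'"
  shows "iso_sub (split_sum (domain_defect F G) (codomain_defect G'))
    (split_sum (domain_defect F G') (codomain_defect G))"
proof -
  have mm: "module_map H" "module_map (\<lambda>x. H (F x))" "module_map (\<lambda>x. F (H x))" if "outer_inverse F H" for H
    using that F by (auto simp: outer_inverse_def intro: module_map_comp)
  define \<Phi> where "\<Phi> H K z = inl (outl z - H (outr z) - K (F (outl z - H (outr z))))
      + inr (F (H (outr z)) - F (outl z) - outr z)" for H K z
  have m\<Phi>: "module_map (\<Phi> H K)" if H: "outer_inverse F H" and K: "outer_inverse F K" for H K
  proof -
    note ol = module_map_outl and orr = module_map_outr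
    have d: "module_map (\<lambda>z. outl z - H (outr z))"
      by (rule module_map_diff[OF ol module_map_comp[OF mm(1)[OF H] orr]])
    have l: "module_map (\<lambda>z. outl z - H (outr z) - K (F (outl z - H (outr z))))"
      by (rule module_map_diff[OF d module_map_comp[OF mm(2)[OF K] d]])
    have r: "module_map (\<lambda>z. F (H (outr z)) - F (outl z) - outr z)"
      by (rule module_map_diff[OF module_map_diff[OF module_map_comp[OF mm(3)[OF H] orr] module_map_comp[OF F ol]] orr])
    show ?thesis
      unfolding \<Phi>_def by (rule module_map_add[OF module_map_comp[OF module_map_inl l] module_map_comp[OF module_map_inr r]])
  qed
  have out: "outl (\<Phi> H K z) = outl z - H (outr z) - K (F (outl z - H (outr z)))"
    "outr (\<Phi> H K z) = F (H (outr z)) - F (outl z) - outr z" for H K z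
    by (simp_all add: \<Phi>_def split_simps)
  have inv: "\<Phi> H K z \<in> split_sum (domain_defect F K) (codomain_defect H) \<and> \<Phi> K H (\<Phi> H K z) = z"
    if H: "outer_inverse F H" and K: "outer_inverse F K"
      and z: "z \<in> split_sum (domain_defect F H) (codomain_defect K)" for H K z
  proof
    have HFH: "\<And>x. H (F (H x)) = H x" "\<And>x. K (F (K x)) = K x" using H K by (auto simp: outer_inverse_def)
    note simps = HFH module_map_simps[OF F] module_map_simps[OF mm(1)[OF H]] module_map_simps[OF mm(1)[OF K]]
      domain_defect_def codomain_defect_def
    have z': "H (F (outl z)) = 0" "K (outr z) = 0"
      using z by (auto simp: split_sum_def domain_defect_def codomain_defect_def)
    show "\<Phi> H K z \<in> split_sum (domain_defect F K) (codomain_defect H)"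
      by (simp add: split_sum_def out simps z')
    have "outl (\<Phi> K H (\<Phi> H K z)) = outl z" "outr (\<Phi> K H (\<Phi> H K z)) = outr z"
      by (simp_all add: out simps z')
    then show "\<Phi> K H (\<Phi> H K z) = z" using split_eq_iff by blast
  qed
  show ?thesis
  proof (rule iso_subI_module_maps[where f = "\<Phi> G G'" and g = "\<Phi> G' G"])
    show "module_map (\<Phi> G G')" "module_map (\<Phi> G' G)" by (rule m\<Phi>[OF G G'], rule m\<Phi>[OF G' G])
  qed (use inv[OF G G'] inv[OF G' G] in auto)
qed

text \<open>
  The isomorphism carries finite generation from one mixed sum to the other and so to its summands. Hence an
  operator that is upper semi-Fredholm by means of \<open>G\<close> and lower semi-Fredholm by means of \<open>G'\<close> is
  Fredholm by means of either.
\<close>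

lemma fg_sub_defects_exchange:
  assumes F: "module_map F" and G: "outer_inverse F G" and G': "outer_inverse F G'"
    and fg: "fg_sub (domain_defect F G)" "fg_sub (codomain_defect G')"
  shows "fg_sub (domain_defect F G')" "fg_sub (codomain_defect G)"
proof -
  have "fg_sub (split_sum (domain_defect F G') (codomain_defect G))"
    using finitely_generated_iso_sub[OF finitely_generated_split_sum[OF fg] iso_sub_defects[OF F G G']] .
  then show "fg_sub (domain_defect F G')" "fg_sub (codomain_defect G)"
    using finitely_generated_split_sumD zero_in_defects[OF F G] zero_in_defects[OF F G'] by blast+
qed

lemma projective_sub_defects:
  assumes F: "module_map F" and G: "outer_inverse F G"
  shows "fg_sub (domain_defect F G) \<Longrightarrow> projective_sub (domain_defect F G)"
    and "fg_sub (codomain_defect G) \<Longrightarrow> projective_sub (codomain_defect G)"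
proof -
  have m: "module_map G" and GFG: "\<And>x. G (F (G x)) = G x" using G by (auto simp: outer_inverse_def)
  note simps = GFG module_map_simps[OF F] module_map_simps[OF m]
  have "domain_defect F G = range (\<lambda>x. x - G (F x))"
  proof (rule equalityI; rule subsetI)
    fix x assume "x \<in> domain_defect F G"
    then have "x = x - G (F x)" by (simp add: domain_defect_def)
    then show "x \<in> range (\<lambda>x. x - G (F x))" by (rule range_eqI)
  qed (auto simp: domain_defect_def simps)
  then show "fg_sub (domain_defect F G) \<Longrightarrow> projective_sub (domain_defect F G)"
    using projective_sub_of_finitely_generated[OF module_map_diff[OF module_map_ident module_map_comp[OF m F]]]
    by (simp add: simps)
  have "codomain_defect G = range (\<lambda>x. x - F (G x))"
  proof (rule equalityI; rule subsetI)
    fix x assume "x \<in> codomain_defect G"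
    then have "x = x - F (G x)" by (simp add: codomain_defect_def simps)
    then show "x \<in> range (\<lambda>x. x - F (G x))" by (rule range_eqI)
  qed (auto simp: codomain_defect_def simps)
  then show "fg_sub (codomain_defect G) \<Longrightarrow> projective_sub (codomain_defect G)"
    using projective_sub_of_finitely_generated[OF module_map_diff[OF module_map_ident module_map_comp[OF F m]]]
    by (simp add: simps)
qed

lemma projective_sub_iff_class_eq:
  assumes "projective_sub A" "projective_sub B"
  shows "proj_class (coords ` A) = proj_class (coords ` B) \<longleftrightarrow> iso_sub A B"
proof -
  have "closed_sub A" "closed_sub B" using assms by (auto simp: projective_sub_def)
  then show ?thesis
    using assms by (simp add: proj_class_eq_iff fg_projective_coords isomorphic_coords)
qed

text \<open>
  By \<open>iso_sub_defects\<close>, two decompositions satisfy \<open>[N1] + [N2'] = [N1'] + [N2]\<close>, which is equality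
  of the formal differences. Hence the index can be computed from any decomposition.
\<close>

lemma fredholm_index_eq:
  fixes F :: "(nat \<Rightarrow> 'a::cstar_algebra) \<Rightarrow> nat \<Rightarrow> 'a"
  assumes F: "F \<in> adjointable_ops" and G: "outer_inverse (op_map F) G"
    and fg: "fg_sub (domain_defect (op_map F) G)" "fg_sub (codomain_defect G)"
  shows "fredholm_index F = formal_difference (coords ` domain_defect (op_map F) G) (coords ` codomain_defect G)"
proof -
  define F' where "F' = op_map F"
  have mF: "module_map F'" unfolding F'_def by (rule module_map_op_map[OF F])
  note G = G[folded F'_def] and fg = fg[folded F'_def]
  define P where "P k \<longleftrightarrow> (\<exists>M1 N1 M2 N2. fredholm_decomp F M1 N1 M2 N2 \<and> finitely_generated N1 \<and>
    finitely_generated N2 \<and> k = k0_class N1 \<otimes>\<^bsub>K0\<^esub> inv\<^bsub>K0\<^esub> (k0_class N2))" for k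
  have uniq: "k = formal_difference (coords ` domain_defect F' G) (coords ` codomain_defect G)" if k: "P k" for k
  proof -
    obtain M1 N1 M2 N2 where dec: "fredholm_decomp F M1 N1 M2 N2"
      and fN: "finitely_generated N1" "finitely_generated N2"
      and k: "k = k0_class N1 \<otimes>\<^bsub>K0\<^esub> inv\<^bsub>K0\<^esub> (k0_class N2)" using k unfolding P_def by blast
    obtain G' where G': "outer_inverse F' G'" and N: "N1 = coords ` domain_defect F' G'" "N2 = coords ` codomain_defect G'"
      unfolding F'_def by (rule outer_inverse_of_fredholm_decomp[OF F dec])
    have p: "projective_sub (domain_defect F' G)" "projective_sub (codomain_defect G)"
      "projective_sub (domain_defect F' G')" "projective_sub (codomain_defect G')"
      using projective_sub_defects[OF mF G] projective_sub_defects[OF mF G'] fg fN N by auto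
    then have f: "fg_projective N1" "fg_projective N2" "fg_projective (coords ` domain_defect F' G)"
      "fg_projective (coords ` codomain_defect G)" by (simp_all add: N fg_projective_coords)
    have "proj_class N1 + proj_class (coords ` codomain_defect G) = proj_class (coords ` domain_defect F' G) + proj_class N2"
      using iso_sub_defects[OF mF G' G] p f
      by (simp add: projective_sub_iff_class_eq[symmetric] projective_sub_split_sum proj_class_ext_sum[symmetric]
          ext_sum_coords N)
    then show ?thesis
      unfolding k k0_class_difference[OF f(1,2)] formal_difference_eq_iff[OF f(1,2,3,4)] by (intro exI[of _ 0]) simp
  qed
  have "\<exists>k. P k"
    using fredholm_decomp_of_outer_inverse[OF F G[unfolded F'_def]] fg unfolding P_def F'_def by blast
  then have "P (SOME k. P k)" by (rule someI_ex)
  then have "P (fredholm_index F)" unfolding fredholm_index_def P_def .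
  then show ?thesis unfolding F'_def[symmetric] by (rule uniq)
qed

section \<open>Central translates of an operator\<close>

lemma star_center: "z \<in> cstar_center \<Longrightarrow> star z \<in> cstar_center"
  unfolding cstar_center_def by (simp, metis star_mult star_star)


lemma summable_hinner:
  fixes x y :: "nat \<Rightarrow> 'a::cstar_algebra"
  assumes "x \<in> HA" "y \<in> HA" shows "summable (\<lambda>i. star (x i) * y i)"
  unfolding summable_Cauchy
proof (intro allI impI)
  fix e :: real assume e: "e > 0"
  obtain N where N: "\<And>m n. m \<ge> N \<Longrightarrow> col_norm {m..<n} x < sqrt e"
    using assms(1) e unfolding HA_iff_col_norm by (meson real_sqrt_gt_zero)
  obtain M where M: "\<And>m n. m \<ge> M \<Longrightarrow> col_norm {m..<n} y < sqrt e"
    using assms(2) e unfolding HA_iff_col_norm by (meson real_sqrt_gt_zero)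
  have "norm (\<Sum>i = m..<n. star (x i) * y i) < e" if "m \<ge> max N M" for m n
  proof -
    have "norm (\<Sum>i = m..<n. star (x i) * y i) \<le> col_norm {m..<n} x * col_norm {m..<n} y"
      by (rule norm_sum_star_mult_le)
    also have "\<dots> < sqrt e * sqrt e" using N[of m n] M[of m n] that by (intro mult_strict_mono') auto
    finally show ?thesis using e by simp
  qed
  then show "\<exists>N. \<forall>m\<ge>N. \<forall>n. norm (\<Sum>i = m..<n. star (x i) * y i) < e" by blast
qed

text \<open>
  Centrality of \<open>a\<close> is what makes \<open>scalar_op a\<close> linear over the algebra, and it provides the adjoint
  \<open>scalar_op (star a)\<close>.
\<close>

lemma translate_adjointable:
  fixes F :: "(nat \<Rightarrow> 'a::cstar_algebra) \<Rightarrow> nat \<Rightarrow> 'a"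
  assumes F: "F \<in> adjointable_ops" and a: "a \<in> cstar_center"
  shows "F - scalar_op a \<in> adjointable_ops"
proof -
  have lin: "module_linear_on HA F" and FH: "\<And>x. x \<in> HA \<Longrightarrow> F x \<in> HA"
    using F by (auto simp: adjointable_ops_def)
  obtain C where C: "\<And>x. x \<in> HA \<Longrightarrow> hnorm (F x) \<le> C * hnorm x"
    using F by (auto simp: adjointable_ops_def bounded_on_def)
  obtain G where "G ` HA \<subseteq> HA" "\<forall>x\<in>HA. \<forall>y\<in>HA. hinner (F x) y = hinner x (G y)"
    using F unfolding adjointable_ops_def by blast
  then have GH: "\<And>x. x \<in> HA \<Longrightarrow> G x \<in> HA"
    and G: "\<And>x y. x \<in> HA \<Longrightarrow> y \<in> HA \<Longrightarrow> hinner (F x) y = hinner x (G y)" by auto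
  have T: "(F - scalar_op a) x = F x - ract x a" for x by (simp add: scalar_op_def)
  have za: "z * a = a * z" and zs: "z * star a = star a * z" for z
    using a star_center[OF a] by (auto simp: cstar_center_def)
  have "(F - scalar_op a) ` HA \<subseteq> HA" using FH by (auto simp: scalar_op_def intro!: HA_diff HA_ract)
  moreover have "module_linear_on HA (F - scalar_op a)"
  proof -
    have "ract (ract x a) b = ract (ract x b) a" for x b by (simp add: ract_ract za)
    then show ?thesis using lin
      unfolding module_linear_on_def T by (simp add: ract_add_left ract_diff_left)
  qed
  moreover have "bounded_on HA (F - scalar_op a)"
    unfolding bounded_on_def T
  proof (intro exI[of _ "C + norm a"] ballI)
    fix x :: "nat \<Rightarrow> 'a" assume x: "x \<in> HA"
    have "hnorm (F x - ract x a) \<le> hnorm (F x) + hnorm (ract x (- a))"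
      using hnorm_add[OF FH[OF x] HA_ract[OF x, of "- a"]] by (simp add: ract_def fun_diff_def plus_fun_def)
    also have "\<dots> \<le> C * hnorm x + hnorm x * norm a"
      using C[OF x] hnorm_ract[OF x, of "- a"] by simp
    finally show "hnorm (F x - ract x a) \<le> (C + norm a) * hnorm x" by (simp add: algebra_simps)
  qed
  moreover have "hinner ((F - scalar_op a) x) y = hinner x ((G - scalar_op (star a)) y)" if "x \<in> HA" "y \<in> HA" for x y
  proof -
    have s: "summable (\<lambda>i. star (F x i) * y i)" "summable (\<lambda>i. star (x i) * y i)" "summable (\<lambda>i. star (x i) * G y i)"
      using that FH GH by (auto intro: summable_hinner)
    have "hinner ((F - scalar_op a) x) y = (\<Sum>i. star (F x i) * y i - star a * (star (x i) * y i))"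
      by (simp add: hinner_def scalar_op_def ract_def star_diff star_mult algebra_simps)
    also have "\<dots> = hinner (F x) y - star a * hinner x y"
      using s by (simp add: hinner_def suminf_diff[symmetric] summable_mult suminf_mult)
    also have "hinner (F x) y = hinner x (G y)" by (rule G[OF that])
    also have "hinner x (G y) - star a * hinner x y = (\<Sum>i. star (x i) * G y i - star a * (star (x i) * y i))"
      using s by (simp add: hinner_def suminf_diff[symmetric] summable_mult suminf_mult)
    also have "\<dots> = hinner x ((G - scalar_op (star a)) y)"
      by (simp add: hinner_def scalar_op_def ract_def right_diff_distrib mult.assoc[symmetric] zs)
    finally show ?thesis .
  qed
  moreover have "(G - scalar_op (star a)) ` HA \<subseteq> HA" using GH by (auto simp: scalar_op_def intro!: HA_diff HA_ract)
  ultimately show ?thesis unfolding adjointable_ops_def by blast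
qed

definition locally_in_center :: "'a::cstar_algebra \<Rightarrow> ('a \<Rightarrow> bool) \<Rightarrow> bool"
  where "locally_in_center a P \<longleftrightarrow> (\<exists>r>0. \<forall>b\<in>cstar_center. dist b a < r \<longrightarrow> P b)"

lemma locally_in_center_mono:
  "locally_in_center a P \<Longrightarrow> (\<And>b. b \<in> cstar_center \<Longrightarrow> P b \<Longrightarrow> Q b) \<Longrightarrow> locally_in_center a Q"
  unfolding locally_in_center_def by blast

lemma translate_outer_inverse_stable:
  fixes F :: "(nat \<Rightarrow> 'a::cstar_algebra) \<Rightarrow> nat \<Rightarrow> 'a"
  assumes F: "F \<in> adjointable_ops" and a: "a \<in> cstar_center"
    and G: "outer_inverse (op_map (F - scalar_op a)) G"
  shows "locally_in_center a (\<lambda>b. \<exists>G'. outer_inverse (op_map (F - scalar_op b)) G' \<and>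
    codomain_defect G' = codomain_defect G \<and>
    iso_sub (domain_defect (op_map (F - scalar_op a)) G) (domain_defect (op_map (F - scalar_op b)) G'))"
proof -
  have mG: "module_map G" using G by (simp add: outer_inverse_def)
  obtain C where C: "0 \<le> C" "\<And>x. norm (G x) \<le> C * norm x" using module_map_bounded[OF mG] by blast
  show ?thesis
    unfolding locally_in_center_def
  proof (intro exI[of _ "1 / (C + 1)"] conjI ballI impI)
    show "0 < 1 / (C + 1)" using C(1) by simp
    fix b assume b: "b \<in> cstar_center" "dist b a < 1 / (C + 1)"
    let ?Fa = "op_map (F - scalar_op a)" and ?Fb = "op_map (F - scalar_op b)"
    have m: "module_map ?Fa" "module_map ?Fb"
      using translate_adjointable[OF F] a b module_map_op_map by blast+
    have "?Fb x - ?Fa x = act x (a - b)" for x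
      by (simp add: coords_eq_iff[symmetric] coords_op_map translate_adjointable[OF F] a b(1))
        (simp add: scalar_op_def ract_def fun_eq_iff algebra_simps)
    then have "norm (G (?Fb x - ?Fa x)) \<le> (C * norm (a - b)) * norm x" for x
      using C(2)[of "act x (a - b)"] mult_left_mono[OF norm_act_le[of x "a - b"] C(1)] by (simp add: mult_ac)
    moreover have "C * norm (a - b) < 1"
    proof -
      have "C * norm (a - b) \<le> (C + 1) * norm (a - b)" by (simp add: mult_right_mono)
      also have "\<dots> < 1" using b(2) C(1) by (simp add: dist_norm norm_minus_commute field_simps)
      finally show ?thesis .
    qed
    ultimately obtain G' R Q where G': "outer_inverse ?Fb G'" "codomain_defect G' = codomain_defect G"
      "module_map R" "module_map Q" "R ` domain_defect ?Fa G \<subseteq> domain_defect ?Fb G'"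
      "Q ` domain_defect ?Fb G' \<subseteq> domain_defect ?Fa G" "\<And>x. R (Q x) = x" "\<And>x. Q (R x) = x"
      using outer_inverse_perturbation[OF m G] by metis
    have "iso_sub (domain_defect ?Fa G) (domain_defect ?Fb G')"
      by (rule iso_subI_module_maps[OF G'(3,4,5,6)]) (simp_all add: G'(7,8))
    then show "\<exists>G'. outer_inverse ?Fb G' \<and> codomain_defect G' = codomain_defect G \<and>
      iso_sub (domain_defect ?Fa G) (domain_defect ?Fb G')" using G' by blast
  qed
qed

context
  fixes F :: "(nat \<Rightarrow> 'a::cstar_algebra) \<Rightarrow> nat \<Rightarrow> 'a" and a :: 'a
  assumes F: "F \<in> adjointable_ops" and a: "a \<in> cstar_center"
begin

text \<open>
  The implication makes the difference \<open>MPhi_plus - MPhi\<close> open: a translate near one in this difference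
  has an outer inverse with the same codomain defect, which would have to be finitely generated if
  the translate belonged to \<open>MPhi_minus\<close>.
\<close>

lemma MPhi_plus_locally:
  assumes "F - scalar_op a \<in> MPhi_plus"
  shows "locally_in_center a (\<lambda>b. F - scalar_op b \<in> MPhi_plus \<and>
    (F - scalar_op b \<in> MPhi_minus \<longrightarrow> F - scalar_op a \<in> MPhi))"
proof -
  let ?D = "\<lambda>b. op_map (F - scalar_op b)"
  obtain G where G: "outer_inverse (?D a) G" "fg_sub (domain_defect (?D a) G)"
    using assms unfolding MPhi_plus_iff by blast
  show ?thesis
  proof (rule locally_in_center_mono[OF translate_outer_inverse_stable[OF F a G(1)]], elim exE conjE)
    fix b G' assume b: "b \<in> cstar_center" and G': "outer_inverse (?D b) G'" "codomain_defect G' = codomain_defect G"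
      and iso: "iso_sub (domain_defect (?D a) G) (domain_defect (?D b) G')"
    have adj: "F - scalar_op b \<in> adjointable_ops" by (rule translate_adjointable[OF F b])
    have fg: "fg_sub (domain_defect (?D b) G')" by (rule finitely_generated_iso_sub[OF G(2) iso])
    have "F - scalar_op a \<in> MPhi" if minus: "F - scalar_op b \<in> MPhi_minus"
    proof -
      obtain G'' where G'': "outer_inverse (?D b) G''" "fg_sub (codomain_defect G'')"
        using minus unfolding MPhi_minus_iff by blast
      have "fg_sub (codomain_defect G)"
        using fg_sub_defects_exchange(2)[OF module_map_op_map[OF adj] G'(1) G''(1) fg G''(2)] G'(2) by simp
      then show ?thesis using G translate_adjointable[OF F a] unfolding MPhi_iff by blast
    qed
    moreover have "F - scalar_op b \<in> MPhi_plus" unfolding MPhi_plus_iff using adj G'(1) fg by blast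
    ultimately show "F - scalar_op b \<in> MPhi_plus \<and> (F - scalar_op b \<in> MPhi_minus \<longrightarrow> F - scalar_op a \<in> MPhi)"
      by blast
  qed
qed

text \<open>
  As in the previous lemma; now it is the domain defect that is transported.
\<close>

lemma MPhi_minus_locally:
  assumes "F - scalar_op a \<in> MPhi_minus"
  shows "locally_in_center a (\<lambda>b. F - scalar_op b \<in> MPhi_minus \<and>
    (F - scalar_op b \<in> MPhi_plus \<longrightarrow> F - scalar_op a \<in> MPhi))"
proof -
  let ?D = "\<lambda>b. op_map (F - scalar_op b)"
  obtain G where G: "outer_inverse (?D a) G" "fg_sub (codomain_defect G)"
    using assms unfolding MPhi_minus_iff by blast
  show ?thesis
  proof (rule locally_in_center_mono[OF translate_outer_inverse_stable[OF F a G(1)]], elim exE conjE)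
    fix b G' assume b: "b \<in> cstar_center" and G': "outer_inverse (?D b) G'" "codomain_defect G' = codomain_defect G"
      and iso: "iso_sub (domain_defect (?D a) G) (domain_defect (?D b) G')"
    have adj: "F - scalar_op b \<in> adjointable_ops" by (rule translate_adjointable[OF F b])
    have fg: "fg_sub (codomain_defect G')" using G(2) G'(2) by simp
    have "F - scalar_op a \<in> MPhi" if plus: "F - scalar_op b \<in> MPhi_plus"
    proof -
      obtain G'' where G'': "outer_inverse (?D b) G''" "fg_sub (domain_defect (?D b) G'')"
        using plus unfolding MPhi_plus_iff by blast
      have "fg_sub (domain_defect (?D b) G')"
        by (rule fg_sub_defects_exchange(1)[OF module_map_op_map[OF adj] G''(1) G'(1) G''(2) fg])
      then have "fg_sub (domain_defect (?D a) G)"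
        by (rule finitely_generated_iso_sub[OF _ iso_sub_sym[OF iso]])
      then show ?thesis using G translate_adjointable[OF F a] unfolding MPhi_iff by blast
    qed
    moreover have "F - scalar_op b \<in> MPhi_minus" unfolding MPhi_minus_iff using adj G'(1) fg by blast
    ultimately show "F - scalar_op b \<in> MPhi_minus \<and> (F - scalar_op b \<in> MPhi_plus \<longrightarrow> F - scalar_op a \<in> MPhi)"
      by blast
  qed
qed

lemma fredholm_index_locally_constant:
  assumes "F - scalar_op a \<in> MPhi"
  shows "locally_in_center a (\<lambda>b. F - scalar_op b \<in> MPhi \<and>
    fredholm_index (F - scalar_op b) = fredholm_index (F - scalar_op a))"
proof -
  let ?D = "\<lambda>b. op_map (F - scalar_op b)"
  obtain G where G: "outer_inverse (?D a) G" "fg_sub (domain_defect (?D a) G)" "fg_sub (codomain_defect G)"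
    using assms unfolding MPhi_iff by blast
  have adja: "F - scalar_op a \<in> adjointable_ops" by (rule translate_adjointable[OF F a])
  show ?thesis
  proof (rule locally_in_center_mono[OF translate_outer_inverse_stable[OF F a G(1)]], elim exE conjE, rule conjI)
    fix b G' assume b: "b \<in> cstar_center" and G': "outer_inverse (?D b) G'" "codomain_defect G' = codomain_defect G"
      and iso: "iso_sub (domain_defect (?D a) G) (domain_defect (?D b) G')"
    have adj: "F - scalar_op b \<in> adjointable_ops" by (rule translate_adjointable[OF F b])
    have fg: "fg_sub (domain_defect (?D b) G')" "fg_sub (codomain_defect G')"
      using finitely_generated_iso_sub[OF G(2) iso] G(3) G'(2) by auto
    show "F - scalar_op b \<in> MPhi" unfolding MPhi_iff using adj G'(1) fg by blast
    have p: "projective_sub (domain_defect (?D a) G)" "projective_sub (codomain_defect G)"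
      "projective_sub (domain_defect (?D b) G')"
      using projective_sub_defects[OF module_map_op_map[OF adja] G(1)]
        projective_sub_defects[OF module_map_op_map[OF adj] G'(1)] G fg by auto
    have eq: "proj_class (coords ` domain_defect (?D a) G) = proj_class (coords ` domain_defect (?D b) G')"
      using projective_sub_iff_class_eq[OF p(1,3)] iso by simp
    have "formal_difference (coords ` domain_defect (?D b) G') (coords ` codomain_defect G)
        = formal_difference (coords ` domain_defect (?D a) G) (coords ` codomain_defect G)"
      using p by (subst formal_difference_eq_iff) (auto simp: fg_projective_coords eq)
    then show "fredholm_index (F - scalar_op b) = fredholm_index (F - scalar_op a)"
      using fredholm_index_eq[OF adja G] fredholm_index_eq[OF adj G'(1) fg] G'(2) by simp
  qed
qed

end

text \<open>
  Let \<open>x\<close> be a boundary point of the larger set. Openness of \<open>P\<close> excludes \<open>P x\<close>, since \<open>x\<close> is a limit of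
  points outside \<open>P\<close>. If \<open>Q x\<close> held, then \<open>P\<close> would fail in a neighbourhood and \<open>x\<close> would be an
  interior point of the larger set. So \<open>x\<close> lies in the smaller set, and not in its interior.
\<close>

lemma center_boundary_subset:
  assumes sub: "\<And>a. a \<in> cstar_center \<Longrightarrow> P a \<Longrightarrow> Q a"
    and P: "\<And>a. a \<in> cstar_center \<Longrightarrow> P a \<Longrightarrow> locally_in_center a P"
    and Q: "\<And>a. a \<in> cstar_center \<Longrightarrow> Q a \<Longrightarrow> \<not> P a \<Longrightarrow> locally_in_center a (\<lambda>b. \<not> P b)"
  shows "center_boundary {a \<in> cstar_center. \<not> P a} \<subseteq> center_boundary {a \<in> cstar_center. \<not> Q a}"
proof
  let ?X = "top_of_set (cstar_center :: 'a set)"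
  let ?S = "{a \<in> cstar_center. \<not> P a}" and ?T = "{a \<in> cstar_center. \<not> Q a}"
  have nbhd: "openin ?X (cstar_center \<inter> ball x r)" for x r by (simp add: openin_open_Int)
  fix x assume x: "x \<in> center_boundary ?S"
  then have cl: "x \<in> ?X closure_of ?S" and ni: "x \<notin> ?X interior_of ?S"
    by (auto simp: center_boundary_def frontier_of_def)
  have xZ: "x \<in> cstar_center" using cl by (auto simp: in_closure_of)
  have "\<not> P x"
  proof
    assume "P x"
    then obtain r where r: "r > 0" "\<And>b. b \<in> cstar_center \<Longrightarrow> dist b x < r \<Longrightarrow> P b"
      using P[OF xZ] unfolding locally_in_center_def by blast
    then obtain y where "y \<in> ?S" "y \<in> cstar_center \<inter> ball x r"
      using cl nbhd[of x r] xZ unfolding in_closure_of by (meson IntI centre_in_ball)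
    then show False using r(2)[of y] by (auto simp: dist_commute)
  qed
  have "\<not> Q x"
  proof
    assume "Q x"
    then obtain r where r: "r > 0" "\<And>b. b \<in> cstar_center \<Longrightarrow> dist b x < r \<Longrightarrow> \<not> P b"
      using Q[OF xZ] \<open>\<not> P x\<close> unfolding locally_in_center_def by blast
    have "cstar_center \<inter> ball x r \<subseteq> ?S" using r(2) by (auto simp: dist_commute)
    then have "x \<in> ?X interior_of ?S"
      unfolding interior_of_def using nbhd[of x r] xZ r(1) by (auto intro!: exI[of _ "cstar_center \<inter> ball x r"])
    then show False using ni by blast
  qed
  then have "x \<in> ?T" using xZ by blast
  then have "x \<in> ?X closure_of ?T" by (intro closure_of_subset[THEN subsetD]) auto
  moreover have "?X interior_of ?T \<subseteq> ?X interior_of ?S" by (rule interior_of_mono) (use sub in blast)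
  ultimately show "x \<in> center_boundary ?T" using ni by (auto simp: center_boundary_def frontier_of_def)
qed

theorem theorem4p2:
  fixes F :: "(nat \<Rightarrow> 'a::cstar_algebra) \<Rightarrow> nat \<Rightarrow> 'a"
  assumes "F \<in> adjointable_ops"
  shows "center_boundary (sigma_ew F) \<subseteq> center_boundary (sigma_ef F) \<and>
    center_boundary (sigma_ef F) \<subseteq> center_boundary (sigma_eb F) \<and>
    center_boundary (sigma_eb F) \<subseteq> center_boundary (sigma_ek F) \<and>
    center_boundary (sigma_ef F) \<subseteq> center_boundary (sigma_ea F) \<and>
    center_boundary (sigma_ea F) \<subseteq> center_boundary (sigma_ek F)"
proof -
  let ?D = "\<lambda>b. F - scalar_op b"
  note plus = MPhi_plus_locally[OF assms] and minus = MPhi_minus_locally[OF assms]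
    and index = fredholm_index_locally_constant[OF assms]
  note sub = MPhi_subset[THEN subsetD]
  have plus_open: "locally_in_center a (\<lambda>b. ?D b \<in> MPhi_plus)" if "a \<in> cstar_center" "?D a \<in> MPhi_plus" for a
    using plus[OF that] by (rule locally_in_center_mono) blast
  have minus_open: "locally_in_center a (\<lambda>b. ?D b \<in> MPhi_minus)" if "a \<in> cstar_center" "?D a \<in> MPhi_minus" for a
    using minus[OF that] by (rule locally_in_center_mono) blast
  have fredholm_open: "locally_in_center a (\<lambda>b. ?D b \<in> MPhi)" if "a \<in> cstar_center" "?D a \<in> MPhi" for a
    using index[OF that] by (rule locally_in_center_mono) blast
  have plus_only: "locally_in_center a (\<lambda>b. ?D b \<notin> MPhi_minus)"
    if "a \<in> cstar_center" "?D a \<in> MPhi_plus" "?D a \<notin> MPhi" for a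
    using plus[OF that(1,2)] by (rule locally_in_center_mono) (use that(3) in blast)
  have minus_only: "locally_in_center a (\<lambda>b. ?D b \<notin> MPhi_plus)"
    if "a \<in> cstar_center" "?D a \<in> MPhi_minus" "?D a \<notin> MPhi" for a
    using minus[OF that(1,2)] by (rule locally_in_center_mono) (use that(3) in blast)
  have "center_boundary (sigma_ew F) \<subseteq> center_boundary (sigma_ef F)"
    unfolding sigma_ew_def sigma_ef_def
  proof (rule center_boundary_subset)
    show "locally_in_center a (\<lambda>b. ?D b \<in> MPhi_zero)" if "a \<in> cstar_center" "?D a \<in> MPhi_zero" for a
      using index[OF that(1) sub(3)[OF that(2)]]
      by (rule locally_in_center_mono) (use that(2) in \<open>simp add: MPhi_zero_def\<close>)
    show "locally_in_center a (\<lambda>b. ?D b \<notin> MPhi_zero)"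
      if "a \<in> cstar_center" "?D a \<in> MPhi" "?D a \<notin> MPhi_zero" for a
      using index[OF that(1,2)]
      by (rule locally_in_center_mono) (use that(2,3) in \<open>simp add: MPhi_zero_def\<close>)
  qed (use sub in blast)
  moreover have "center_boundary (sigma_ef F) \<subseteq> center_boundary (sigma_eb F)"
    unfolding sigma_ef_def sigma_eb_def
  proof (rule center_boundary_subset)
    show "locally_in_center a (\<lambda>b. ?D b \<notin> MPhi)"
      if "a \<in> cstar_center" "?D a \<in> MPhi_minus" "?D a \<notin> MPhi" for a
      using minus_only[OF that] by (rule locally_in_center_mono) (use sub in blast)
  qed (use sub fredholm_open in blast)+
  moreover have "center_boundary (sigma_eb F) \<subseteq> center_boundary (sigma_ek F)"
    unfolding sigma_eb_def sigma_ek_def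
  proof (rule center_boundary_subset)
    show "locally_in_center a (\<lambda>b. ?D b \<notin> MPhi_minus)"
      if "a \<in> cstar_center" "?D a \<in> MPhi_plus \<union> MPhi_minus" "?D a \<notin> MPhi_minus" for a
      using plus_only[of a] that sub by blast
  qed (use minus_open in blast)+
  moreover have "center_boundary (sigma_ef F) \<subseteq> center_boundary (sigma_ea F)"
    unfolding sigma_ef_def sigma_ea_def
  proof (rule center_boundary_subset)
    show "locally_in_center a (\<lambda>b. ?D b \<notin> MPhi)"
      if "a \<in> cstar_center" "?D a \<in> MPhi_plus" "?D a \<notin> MPhi" for a
      using plus_only[OF that] by (rule locally_in_center_mono) (use sub in blast)
  qed (use sub fredholm_open in blast)+
  moreover have "center_boundary (sigma_ea F) \<subseteq> center_boundary (sigma_ek F)"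
    unfolding sigma_ea_def sigma_ek_def
  proof (rule center_boundary_subset)
    show "locally_in_center a (\<lambda>b. ?D b \<notin> MPhi_plus)"
      if "a \<in> cstar_center" "?D a \<in> MPhi_plus \<union> MPhi_minus" "?D a \<notin> MPhi_plus" for a
      using minus_only[of a] that sub by blast
  qed (use plus_open in blast)+
  ultimately show ?thesis by blast
qed

end
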